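(* Let $\lambda>0$. Any rectifiable planar closed curve $c:S^1\to\mathbb{R}^2$ is approximable by smooth curves according to the distance $d_{H^1}$ induced by $H^1$; that is, $c$ represents a point of the $d_{H^1}$-completion of the space of smooth immersed planar curves: there is a sequence $(c_k)_{k\in\mathbb{N}}$ of smooth immersed curves $c_k:S^1\to\mathbb{R}^2$ that is Cauchy with respect to $d_{H^1}$ and satisfies $d_f(c_k,c)\to0$.
   Context: For a smooth immersed curve $c:S^1\to\mathbb{R}^2$ let $L=\mathrm{len}(c)=\int_{S^1}|\dot c(\theta)|\,d\theta$, $ds=|\dot c(\theta)|\,d\theta$, $D_s=\frac1{|\dot c|}\partial_\theta$. For a smooth vector field $h:S^1\to\mathbb{R}^2$ along $c$, $$\|h\|_{H^1}^2=\frac1L\int_{S^1}|h|^2\,ds+\lambda L\int_{S^1}|D_sh|^2\,ds .$$ For smooth immersed curves $c_0,c_1$, $d_{H^1}(c_0,c_1)$ is the infimum of $\int_0^1\|\partial_vC(\cdot,v)\|_{H^1}\,dv$ (the norm at time $v$ being computed with respect to the curve $C(\cdot,v)$) over all smooth homotopies $C:S^1\times[0,1]\to\mathbb{R}^2$ with every $C(\cdot,v)$ immersed, $C(u,0)=c_0(u)$, and $C(u,1)=c_1(\phi(u))$ for some $\phi\in\mathrm{Diff}(S^1)$ (smooth diffeomorphism of $S^1$); the infimum of the empty set is $+\infty$. For continuous closed curves, $d_f(c_0,c_1)=\inf_{\phi\in\mathrm{Diff}(S^1)}\sup_u|c_1(\phi(u))-c_0(u)|$. A rectifiable closed curve is a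 continuous map $c:S^1\to\mathbb{R}^2$ of finite length. *)

theory Defs
  imports "HOL-Analysis.Analysis"
begin

text \<open>
  The circle is the unit circle in \<^typ>\<open>complex\<close>; maps defined on it are total functions
  on \<^typ>\<open>complex\<close> whose values off the circle are never used. The angle \<open>\<theta>\<close> is the
  coordinate given by \<^term>\<open>cis\<close>, so that \<open>\<partial>\<^sub>\<theta>\<close>, \<open>d\<theta>\<close> and smoothness are those of the
  \<open>2\<pi>\<close>-periodic function \<^term>\<open>\<lambda>\<theta>. c (cis \<theta>)\<close>.
\<close>

abbreviation S1 :: "complex set" where
  "S1 \<equiv> sphere 0 1"

text \<open>Meaningful for open \<open>U\<close> only.\<close>

fun Ck_on :: "nat \<Rightarrow> 'a::euclidean_space set \<Rightarrow> ('a \<Rightarrow> 'b::real_normed_vector) \<Rightarrow> bool" where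
  "Ck_on 0 U f \<longleftrightarrow> continuous_on U f"
| "Ck_on (Suc k) U f \<longleftrightarrow>
     (\<forall>x\<in>U. f differentiable (at x)) \<and> (\<forall>v. Ck_on k U (\<lambda>x. frechet_derivative f (at x) v))"

text \<open>
  Smoothness on an arbitrary set is the existence of a smooth extension to an open
  neighbourhood. On \<^term>\<open>UNIV\<close> this is ordinary smoothness; on
  \<^term>\<open>UNIV \<times> {0..1::real}\<close> it is smoothness up to the boundary.
\<close>

definition smooth_on :: "'a::euclidean_space set \<Rightarrow> ('a \<Rightarrow> 'b::real_normed_vector) \<Rightarrow> bool" where
  "smooth_on S f \<longleftrightarrow>
     (\<exists>U g. open U \<and> S \<subseteq> U \<and> (\<forall>k. Ck_on k U g) \<and> (\<forall>x\<in>S. g x = f x))"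

definition smooth_curve :: "(complex \<Rightarrow> 'b::real_normed_vector) \<Rightarrow> bool" where
  "smooth_curve c \<longleftrightarrow> smooth_on UNIV (\<lambda>\<theta>::real. c (cis \<theta>))"

definition d_theta :: "(complex \<Rightarrow> 'b::real_normed_vector) \<Rightarrow> real \<Rightarrow> 'b" where
  "d_theta c \<theta> = vector_derivative (\<lambda>t. c (cis t)) (at \<theta>)"

definition immersed :: "(complex \<Rightarrow> 'b::real_normed_vector) \<Rightarrow> bool" where
  "immersed c \<longleftrightarrow> smooth_curve c \<and> (\<forall>\<theta>. d_theta c \<theta> \<noteq> 0)"

definition Diff_S1 :: "(complex \<Rightarrow> complex) set" where
  "Diff_S1 = {\<phi>. bij_betw \<phi> S1 S1 \<and> smooth_curve \<phi> \<and> smooth_curve (inv_into S1 \<phi>)}"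

text \<open>Integral over the circle against the arc length element \<open>ds\<close> of \<open>c\<close>.\<close>

definition integral_ds :: "(complex \<Rightarrow> 'b::real_normed_vector) \<Rightarrow> (real \<Rightarrow> real) \<Rightarrow> real" where
  "integral_ds c f = integral {0..2*pi} (\<lambda>\<theta>. f \<theta> * norm (d_theta c \<theta>))"

definition len :: "(complex \<Rightarrow> 'b::real_normed_vector) \<Rightarrow> real" where
  "len c = integral_ds c (\<lambda>\<theta>. 1)"

definition D_s ::
  "(complex \<Rightarrow> 'b::real_normed_vector) \<Rightarrow> (complex \<Rightarrow> 'b) \<Rightarrow> real \<Rightarrow> 'b" where
  "D_s c h \<theta> = (1 / norm (d_theta c \<theta>)) *\<^sub>R d_theta h \<theta>"

definition H1_norm ::
  "real \<Rightarrow> (complex \<Rightarrow> 'b::real_normed_vector) \<Rightarrow> (complex \<Rightarrow> 'b) \<Rightarrow> real" where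
  "H1_norm lam c h =
     sqrt (1 / len c * integral_ds c (\<lambda>\<theta>. (norm (h (cis \<theta>)))\<^sup>2)
           + lam * len c * integral_ds c (\<lambda>\<theta>. (norm (D_s c h \<theta>))\<^sup>2))"

definition smooth_homotopy :: "(complex \<Rightarrow> real \<Rightarrow> 'b::real_normed_vector) \<Rightarrow> bool" where
  "smooth_homotopy C \<longleftrightarrow> smooth_on (UNIV \<times> {0..1}) (\<lambda>(\<theta>::real, v::real). C (cis \<theta>) v)"

text \<open>One-sided derivative at the end points of the time interval.\<close>

definition d_v :: "(complex \<Rightarrow> real \<Rightarrow> 'b::real_normed_vector) \<Rightarrow> real \<Rightarrow> complex \<Rightarrow> 'b" where
  "d_v C v u = vector_derivative (C u) (at v within {0..1})"

definition H1_length :: "real \<Rightarrow> (complex \<Rightarrow> real \<Rightarrow> 'b::real_normed_vector) \<Rightarrow> real" where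
  "H1_length lam C = integral {0..1} (\<lambda>v. H1_norm lam (\<lambda>u. C u v) (d_v C v))"

definition admissible_homotopies ::
  "(complex \<Rightarrow> 'b::real_normed_vector) \<Rightarrow> (complex \<Rightarrow> 'b) \<Rightarrow> (complex \<Rightarrow> real \<Rightarrow> 'b) set" where
  "admissible_homotopies c0 c1 =
     {C. smooth_homotopy C \<and> (\<forall>v\<in>{0..1}. immersed (\<lambda>u. C u v)) \<and>
         (\<forall>u\<in>S1. C u 0 = c0 u) \<and> (\<exists>\<phi>\<in>Diff_S1. \<forall>u\<in>S1. C u 1 = c1 (\<phi> u))}"

definition d_H1 ::
  "real \<Rightarrow> (complex \<Rightarrow> 'b::real_normed_vector) \<Rightarrow> (complex \<Rightarrow> 'b) \<Rightarrow> ereal" where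
  "d_H1 lam c0 c1 = (INF C\<in>admissible_homotopies c0 c1. ereal (H1_length lam C))"

definition d_f :: "(complex \<Rightarrow> 'b::real_normed_vector) \<Rightarrow> (complex \<Rightarrow> 'b) \<Rightarrow> real" where
  "d_f c0 c1 = (INF \<phi>\<in>Diff_S1. SUP u\<in>S1. norm (c1 (\<phi> u) - c0 u))"

text \<open>
  For curves that are merely continuous the length is the supremum of the lengths of
  inscribed polygons, over all subdivisions \<open>t 0 \<le> \<dots> \<le> t n\<close> of one period.
\<close>

definition polygonal_length :: "(complex \<Rightarrow> 'b::real_normed_vector) \<Rightarrow> ereal" where
  "polygonal_length c =
     (SUP (n, t)\<in>{(n::nat, t::nat \<Rightarrow> real). mono_on {..n} t \<and> t ` {..n} \<subseteq> {0..2*pi}}.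
        ereal (\<Sum>i<n. norm (c (cis (t (Suc i))) - c (cis (t i)))))"

definition rectifiable_closed_curve :: "(complex \<Rightarrow> 'b::real_normed_vector) \<Rightarrow> bool" where
  "rectifiable_closed_curve c \<longleftrightarrow> continuous_on S1 c \<and> polygonal_length c < \<infinity>"

definition d_H1_Cauchy :: "real \<Rightarrow> (nat \<Rightarrow> complex \<Rightarrow> 'b::real_normed_vector) \<Rightarrow> bool" where
  "d_H1_Cauchy lam ck \<longleftrightarrow>
     (\<forall>e>0. \<exists>N. \<forall>m\<ge>N. \<forall>n\<ge>N. d_H1 lam (ck m) (ck n) < ereal e)"

end

theory Submission
  imports Defs
begin

text \<open>
  Along a curve whose speed lies between two positive constants, the norm of a field \<open>h\<close> that
  vanishes at a base point is controlled by the \<open>L\<^sup>2\<close> norm of \<open>\<partial>\<^sub>\<theta>h\<close>. The obstacle is the factor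
  \<open>1 / speed\<close> in \<open>|D\<^sub>sh|\<^sup>2 ds\<close>: near a cusp of the given curve, its smoothings and the linear homotopies
  between them may almost stop. The homotopies are therefore made linear in the angle of the
  tangent, which keeps the speed away from zero.

  Write \<open>e(a)\<close> for the unit vector at angle \<open>a\<close>. For a smooth \<open>2\<pi>\<close>-periodic function \<open>\<beta>\<close> with
  \<open>w\<close> the mean of \<open>e(\<beta>)\<close>, the curve with derivative \<open>l (e(\<beta>) - w)\<close> is closed and smooth, and its
  speed is at least \<open>l/2\<close> as soon as \<open>|w| \<le> 1/2\<close>. When \<open>w\<close> is small and \<open>\<gamma>\<close> is near \<open>\<beta>\<close>, interpolating
  linearly from \<open>\<beta>\<close> to \<open>\<gamma>\<close> yields an admissible homotopy whose length is at most a constant times the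
  \<open>L\<^sup>2\<close> distance of \<open>\<beta>\<close> and \<open>\<gamma>\<close> (\<open>d_H1_angle_curve_le\<close>). Hence it is enough to find smooth periodic functions \<open>\<beta>\<^sub>k\<close>, Cauchy in
  \<open>L\<^sup>2\<close>, such that \<open>c(0) + l \<integral>\<^sub>0 e(\<beta>\<^sub>k)\<close> converges uniformly to a parametrization of the given
  curve \<open>c\<close>; since \<open>c\<close> is closed, the means \<open>w\<^sub>k\<close> then tend to zero.

  The angles come from the dyadic polygons inscribed in \<open>c\<close>. In terms of the normalized arc length
  \<open>\<sigma>\<close> of \<open>c\<close>, let \<open>d\<^sub>n\<close> be the slopes of the \<open>n\<close>-th polygon, a step function with \<open>|d\<^sub>n| \<le> 1\<close>. For
  \<open>m \<le> n\<close> the value of \<open>d\<^sub>m\<close> on each of its steps is the average of \<open>d\<^sub>n\<close> there, so that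
  \<open>\<parallel>d\<^sub>n - d\<^sub>m\<parallel>\<^sup>2 = \<parallel>d\<^sub>n\<parallel>\<^sup>2 - \<parallel>d\<^sub>m\<parallel>\<^sup>2\<close>, as for a martingale; and \<open>\<integral>|d\<^sub>n|\<close> is the rescaled length of the polygon, which
  tends to that of \<open>c\<close>. Therefore \<open>d\<^sub>n\<close> is Cauchy in \<open>L\<^sup>2\<close> and \<open>|d\<^sub>n|\<close> tends to \<open>1\<close>
  (\<open>chord_directions\<close>). Angles are chosen step by step, the angle of the next direction always
  within \<open>\<pi>\<close> of the present one: this makes their increments comparable with the increments of the
  directions, which no branch of the angle chosen once for all would achieve
  (\<open>simple_angles\<close>). Along a fast subsequence the angles are Cauchy in \<open>L\<^sup>2\<close>, and smooth periodic
  functions are dense (\<open>smooth_angle_sequence\<close>).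

  Finally \<open>\<sigma>\<close> is constant wherever \<open>c\<close> rests, so the arc length parametrization is in general not
  \<open>c\<close> composed with a homeomorphism. But \<open>\<sigma>\<close> is a uniform limit of diffeomorphisms \<open>\<psi>\<close>
  (\<open>smooth_monotone_approx\<close>), and the curve built from \<open>\<beta>\<^sub>k\<close>, evaluated at \<open>\<psi>(\<theta>)\<close>, is close to
  \<open>c(\<theta>)\<close> because these curves are equi-Lipschitz. A constant \<open>c\<close> has no direction at all and is
  approximated by shrinking circles.
\<close>

section \<open>Smooth maps between Euclidean spaces\<close>

text \<open>
  On the whole space the directional derivatives of a smooth map are smooth again; closure properties
  follow from this by induction on the order.
\<close>

definition smooth :: "('a::euclidean_space \<Rightarrow> 'b::real_normed_vector) \<Rightarrow> bool" where
  "smooth f \<longleftrightarrow> (\<forall>k. Ck_on k UNIV f)"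

text \<open>
  The recursion in \<^const>\<open>Ck_on\<close> speaks of the derivative as given by choice. This form lets a known
  derivative take its place.
\<close>

lemma Ck_on_SucI:
  assumes "\<And>x. (f has_derivative f' x) (at x)" and "\<And>v. Ck_on k UNIV (\<lambda>x. f' x v)"
  shows "Ck_on (Suc k) UNIV f"
proof -
  have "frechet_derivative f (at x) = f' x" for x
    using frechet_derivative_at[OF assms(1)] by simp
  then show ?thesis
    using assms by (auto simp: differentiable_def)
qed

lemma smooth_has_derivative:
  "smooth f \<Longrightarrow> (f has_derivative frechet_derivative f (at x)) (at x)"
  unfolding smooth_def by (metis Ck_on.simps(2) UNIV_I frechet_derivative_works)

lemma smooth_frechet_derivative:
  "smooth f \<Longrightarrow> smooth (\<lambda>x. frechet_derivative f (at x) v)"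
  unfolding smooth_def by (metis Ck_on.simps(2))

lemma smooth_isCont: "smooth f \<Longrightarrow> isCont f x"
  using smooth_has_derivative has_derivative_continuous by blast

lemma smooth_continuous_on: "smooth f \<Longrightarrow> continuous_on S f"
  by (simp add: continuous_at_imp_continuous_on smooth_isCont)

lemma smooth_Ck: "smooth f \<Longrightarrow> Ck_on k UNIV f"
  by (simp add: smooth_def)

lemma Ck_on_add:
  "Ck_on k UNIV f \<Longrightarrow> Ck_on k UNIV g \<Longrightarrow> Ck_on k UNIV (\<lambda>x. f x + g x)"
proof (induction k arbitrary: f g)
  case 0
  then show ?case by (auto intro: continuous_intros)
next
  case (Suc k)
  show ?case
  proof (rule Ck_on_SucI)
    show "((\<lambda>x. f x + g x) has_derivative
        (\<lambda>v. frechet_derivative f (at x) v + frechet_derivative g (at x) v)) (at x)" for x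
      using Suc.prems by (intro has_derivative_add) (auto simp: frechet_derivative_works)
  qed (use Suc in auto)
qed

lemma smooth_add: "smooth f \<Longrightarrow> smooth g \<Longrightarrow> smooth (\<lambda>x. f x + g x)"
  unfolding smooth_def using Ck_on_add by blast

lemma smooth_const: "smooth (\<lambda>x::'a::euclidean_space. c :: 'b::real_normed_vector)"
proof -
  have "Ck_on k UNIV (\<lambda>x::'a. c)" for k and c :: 'b
  proof (induction k arbitrary: c)
    case (Suc k)
    show ?case by (rule Ck_on_SucI[where f' = "\<lambda>x v. 0"]) (use Suc in auto)
  qed auto
  then show ?thesis by (simp add: smooth_def)
qed

lemma smooth_bounded_linear: "bounded_linear f \<Longrightarrow> smooth f"
  unfolding smooth_def
proof
  fix k assume f: "bounded_linear f"
  show "Ck_on k UNIV f"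
  proof (cases k)
    case 0
    then show ?thesis using f by (simp add: linear_continuous_on)
  next
    case (Suc j)
    then show ?thesis
      using Ck_on_SucI[of f "\<lambda>x. f"] f smooth_const
      by (metis bounded_linear_imp_has_derivative smooth_Ck)
  qed
qed

lemma Ck_on_Suc_imp: "Ck_on (Suc k) UNIV f \<Longrightarrow> Ck_on k UNIV f"
proof (induction k arbitrary: f)
  case 0
  then show ?case
    by (simp add: continuous_at_imp_continuous_on differentiable_imp_continuous_within)
next
  case (Suc k)
  then show ?case by (metis Ck_on.simps(2))
qed

lemma Ck_on_bilinear:
  assumes "bounded_bilinear bl"
  shows "Ck_on k UNIV f \<Longrightarrow> Ck_on k UNIV g \<Longrightarrow> Ck_on k UNIV (\<lambda>x. bl (f x) (g x))"
proof (induction k arbitrary: f g)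
  interpret bounded_bilinear bl by fact
  case 0
  then show ?case by (auto intro!: continuous_on)
next
  interpret bounded_bilinear bl by fact
  case (Suc k)
  have *: "Ck_on k UNIV f" "Ck_on k UNIV g"
    using Suc.prems Ck_on_Suc_imp by blast+
  show ?case
  proof (rule Ck_on_SucI)
    show "((\<lambda>x. bl (f x) (g x)) has_derivative
        (\<lambda>v. bl (f x) (frechet_derivative g (at x) v) + bl (frechet_derivative f (at x) v) (g x))) (at x)" for x
      using Suc.prems by (intro FDERIV) (auto simp: frechet_derivative_works)
  qed (use Suc * in \<open>auto intro!: Ck_on_add\<close>)
qed

lemma smooth_bilinear:
  "bounded_bilinear bl \<Longrightarrow> smooth f \<Longrightarrow> smooth g \<Longrightarrow> smooth (\<lambda>x. bl (f x) (g x))"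
  unfolding smooth_def using Ck_on_bilinear by blast

lemma Ck_on_sum:
  "(\<And>i. i \<in> I \<Longrightarrow> Ck_on k UNIV (f i)) \<Longrightarrow> Ck_on k UNIV (\<lambda>x. \<Sum>i\<in>I. f i x)"
  by (induction I rule: infinite_finite_induct)
    (auto intro: Ck_on_add smooth_Ck[OF smooth_const])

lemmas smooth_scaleR = smooth_bilinear[OF bounded_bilinear_scaleR]
lemmas smooth_mult = smooth_bilinear[OF bounded_bilinear_mult]

lemma smooth_diff:
  assumes "smooth f" "smooth g" shows "smooth (\<lambda>x. f x - g x)"
  using smooth_add[OF assms(1) smooth_scaleR[OF smooth_const[of "-1"] assms(2)]] by simp

text \<open>
  In the chain rule the direction \<open>g'(x) v\<close> depends on \<open>x\<close>, whereas the induction hypothesis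
  concerns the derivatives of \<open>f\<close> in fixed directions. Expanding the direction in the standard basis
  separates the two.
\<close>

lemma smooth_compose:
  fixes f :: "'a::euclidean_space \<Rightarrow> 'b::real_normed_vector"
    and g :: "'c::euclidean_space \<Rightarrow> 'a"
  assumes "smooth f" "smooth g"
  shows "smooth (\<lambda>x. f (g x))"
proof -
  have "Ck_on k UNIV (\<lambda>x. f (g x))" if "smooth f" "smooth g"
    for k and f :: "'a \<Rightarrow> 'b" and g :: "'c \<Rightarrow> 'a"
    using that
  proof (induction k arbitrary: f)
    case 0
    then show ?case
      using continuous_on_compose2[OF smooth_continuous_on smooth_continuous_on] by auto
  next
    case (Suc k)
    let ?f' = "\<lambda>y. frechet_derivative f (at y)" and ?g' = "\<lambda>x. frechet_derivative g (at x)"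
    have sum_eq: "?f' y w = (\<Sum>b\<in>Basis. (w \<bullet> b) *\<^sub>R ?f' y b)" for y w
    proof -
      interpret bounded_linear "?f' y"
        using smooth_has_derivative[OF Suc.prems(1)] has_derivative_bounded_linear by blast
      have "?f' y w = ?f' y (\<Sum>b\<in>Basis. (w \<bullet> b) *\<^sub>R b)"
        by (simp add: euclidean_representation)
      then show ?thesis by (simp add: sum scaleR)
    qed
    show ?case
    proof (rule Ck_on_SucI)
      show "((\<lambda>x. f (g x)) has_derivative (\<lambda>v. ?f' (g x) (?g' x v))) (at x)" for x
        by (rule has_derivative_compose[OF smooth_has_derivative[OF Suc.prems(2)] smooth_has_derivative[OF Suc.prems(1)]])
      fix v
      have eq: "(\<lambda>x. ?f' (g x) (?g' x v)) = (\<lambda>x. \<Sum>b\<in>Basis. (?g' x v \<bullet> b) *\<^sub>R ?f' (g x) b)"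
        by (rule ext, rule sum_eq)
      have *: "Ck_on k UNIV (\<lambda>x. ?g' x v \<bullet> b)" "Ck_on k UNIV (\<lambda>x. ?f' (g x) b)" for b
        using Suc.IH[OF smooth_frechet_derivative[OF Suc.prems(1)] Suc.prems(2)]
          Ck_on_bilinear[OF bounded_bilinear_inner smooth_Ck[OF smooth_frechet_derivative[OF Suc.prems(2)]]
            smooth_Ck[OF smooth_const]]
        by auto
      show "Ck_on k UNIV (\<lambda>x. ?f' (g x) (?g' x v))"
        unfolding eq by (rule Ck_on_sum, rule Ck_on_bilinear[OF bounded_bilinear_scaleR *])
    qed
  qed
  then show ?thesis using assms by (simp add: smooth_def)
qed

lemma smooth_vector_derivative:
  fixes f :: "real \<Rightarrow> 'b::real_normed_vector"
  assumes "smooth f"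
  shows "(f has_vector_derivative vector_derivative f (at x)) (at x)"
    and "smooth (\<lambda>x. vector_derivative f (at x))"
proof -
  show *: "(f has_vector_derivative vector_derivative f (at x)) (at x)" for x
    using smooth_has_derivative[OF assms] differentiableI vector_derivative_works by blast
  have "frechet_derivative f (at x) 1 = vector_derivative f (at x)" for x
    using frechet_derivative_at[OF *[unfolded has_vector_derivative_def]] by (metis scaleR_one)
  then show "smooth (\<lambda>x. vector_derivative f (at x))"
    using smooth_frechet_derivative[OF assms, of 1] by simp
qed

lemma Ck_on_SucI_1D:
  fixes f :: "real \<Rightarrow> 'b::real_normed_vector"
  assumes "\<And>x. (f has_vector_derivative f' x) (at x)" and "Ck_on k UNIV f'"
  shows "Ck_on (Suc k) UNIV f"
  using assms Ck_on_bilinear[OF bounded_bilinear_scaleR smooth_Ck[OF smooth_const]]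
  by (intro Ck_on_SucI[where f' = "\<lambda>x v. v *\<^sub>R f' x"]) (auto simp: has_vector_derivative_def)

lemma smoothI_1D:
  fixes f :: "real \<Rightarrow> 'b::real_normed_vector"
  assumes "\<And>x. (f has_vector_derivative f' x) (at x)" and "smooth f'"
  shows "smooth f"
  unfolding smooth_def using Ck_on_SucI_1D[OF assms(1)] assms(2) Ck_on_Suc_imp
  by (metis smooth_def)

lemma smooth_cos_sin:
  shows "smooth (cos :: real \<Rightarrow> real)" and "smooth (sin :: real \<Rightarrow> real)"
proof -
  have "Ck_on k UNIV (\<lambda>x::real. a * cos x + b * sin x)" for k a b
  proof (induction k arbitrary: a b)
    case (Suc k)
    show ?case
      by (rule Ck_on_SucI_1D[where f' = "\<lambda>x. b * cos x + (- a) * sin x"])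
        (use Suc[of b "- a"] in \<open>auto intro!: derivative_eq_intros simp flip: has_real_derivative_iff_has_vector_derivative\<close>)
  qed (auto intro!: continuous_intros)
  from this[of _ 1 0] this[of _ 0 1] show "smooth (cos :: real \<Rightarrow> real)" "smooth (sin :: real \<Rightarrow> real)"
    by (simp_all add: smooth_def)
qed

lemma smooth_cis: "smooth cis"
proof -
  have "smooth (\<lambda>x. cos x *\<^sub>R 1 + sin x *\<^sub>R \<i>)"
    by (intro smooth_add smooth_scaleR smooth_cos_sin smooth_const)
  moreover have "(\<lambda>x. cos x *\<^sub>R 1 + sin x *\<^sub>R \<i>) = cis"
    by (auto simp: fun_eq_iff complex_eq_iff)
  ultimately show ?thesis by simp
qed

lemma smooth_inverse:
  fixes q :: "'a::euclidean_space \<Rightarrow> real"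
  assumes q: "smooth q" "\<And>x. q x \<noteq> 0"
  shows "smooth (\<lambda>x. inverse (q x))"
proof -
  have "Ck_on k UNIV (\<lambda>x. inverse (q x))" for k
  proof (induction k)
    case 0
    show ?case
      using continuous_on_inverse[OF smooth_continuous_on[OF q(1)]] q(2) by auto
  next
    case (Suc k)
    show ?case
    proof (rule Ck_on_SucI)
      show "((\<lambda>x. inverse (q x)) has_derivative
          (\<lambda>v. (- frechet_derivative q (at x) v) * (inverse (q x) * inverse (q x)))) (at x)" for x
        using Deriv.has_derivative_inverse[OF q(2) smooth_has_derivative[OF q(1)]]
        by (rule has_derivative_eq_rhs) (simp add: fun_eq_iff)
      show "Ck_on k UNIV (\<lambda>x. (- frechet_derivative q (at x) v) * (inverse (q x) * inverse (q x)))" for v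
        using smooth_diff[OF smooth_const[of 0] smooth_frechet_derivative[OF q(1)], of v]
        by (intro Ck_on_bilinear[OF bounded_bilinear_mult] Suc smooth_Ck) auto
    qed
  qed
  then show ?thesis by (simp add: smooth_def)
qed

text \<open>
  The derivative of \<open>g\<close> is \<open>1 / f'\<close> composed with \<open>g\<close> itself. The induction thus has to carry along all
  compositions \<open>h \<circ> g\<close> with a smooth outer function.
\<close>

lemma smooth_inverse_function:
  fixes f g :: "real \<Rightarrow> real"
  assumes "smooth f" and "\<And>x. vector_derivative f (at x) \<noteq> 0"
    and "\<And>x. g (f x) = x" and "\<And>y. f (g y) = y" and "\<And>y. isCont g y"
  shows "smooth g"
proof -
  let ?q = "\<lambda>x. inverse (vector_derivative f (at x))"
  have q: "smooth ?q" using smooth_inverse smooth_vector_derivative(2) assms(1,2) by blast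
  have g': "(g has_vector_derivative ?q (g y)) (at y)" for y
    unfolding has_real_derivative_iff_has_vector_derivative[symmetric]
    by (rule DERIV_inverse_function[where f = f and a = "y - 1" and b = "y + 1"])
      (use assms smooth_vector_derivative(1)[OF assms(1)] in \<open>auto simp: has_real_derivative_iff_has_vector_derivative\<close>)
  have "Ck_on k UNIV g \<and> (\<forall>h::real\<Rightarrow>real. smooth h \<longrightarrow> Ck_on k UNIV (\<lambda>y. h (g y)))" for k
  proof (induction k)
    case 0
    have "isCont (\<lambda>y. h (g y)) y" if "smooth h" for h :: "real \<Rightarrow> real" and y
      using isCont_o2[OF assms(5) smooth_isCont[OF that]] .
    then show ?case
      using assms(5) by (auto intro: continuous_at_imp_continuous_on)
  next
    case (Suc k)
    have "Ck_on (Suc k) UNIV (\<lambda>y. h (g y))" if h: "smooth h" for h :: "real \<Rightarrow> real"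
    proof (rule Ck_on_SucI_1D)
      show "((\<lambda>y. h (g y)) has_vector_derivative ?q (g y) * vector_derivative h (at (g y))) (at y)" for y
        using vector_diff_chain_at[OF g' smooth_vector_derivative(1)[OF h]] by (simp add: o_def)
      show "Ck_on k UNIV (\<lambda>y. ?q (g y) * vector_derivative h (at (g y)))"
        using Suc q smooth_vector_derivative(2)[OF h] by (intro Ck_on_bilinear[OF bounded_bilinear_mult]) auto
    qed
    then show ?case
      using smooth_bounded_linear[OF bounded_linear_ident] by blast
  qed
  then show ?thesis by (simp add: smooth_def)
qed

section \<open>Primitives depending smoothly on a parameter\<close>

text \<open>
  The primitive \<open>\<integral>\<^sub>0\<^sup>x f\<close>, rescaled to the fixed interval \<open>[0,1]\<close>. This handles both signs of \<open>x\<close> at once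
  and turns the upper limit into a parameter of the integrand, so that one theorem on differentiation
  under the integral sign gives smoothness in the limit and in further parameters.
\<close>

definition prim :: "(real \<Rightarrow> 'b::euclidean_space) \<Rightarrow> real \<Rightarrow> 'b" where
  "prim f x = x *\<^sub>R integral {0..1} (\<lambda>r. f (r * x))"

lemma prim_eq:
  assumes G: "\<And>x. (G has_vector_derivative f x) (at x)"
  shows "prim f x = G x - G 0"
proof -
  have "((\<lambda>r. x *\<^sub>R f (r * x)) has_integral (G (1 * x) - G (0 * x))) {0..1}"
  proof (rule fundamental_theorem_of_calculus)
    fix r :: real
    have "((\<lambda>r. r * x) has_vector_derivative x) (at r)"
      by (auto intro!: derivative_eq_intros simp flip: has_real_derivative_iff_has_vector_derivative)
    from vector_diff_chain_at[OF this G]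
    show "((\<lambda>r. G (r * x)) has_vector_derivative x *\<^sub>R f (r * x)) (at r within {0..1})"
      by (simp add: o_def has_vector_derivative_at_within)
  qed auto
  then show ?thesis
    unfolding prim_def by (simp add: integral_unique flip: integral_cmul)
qed

lemma has_vector_derivative_prim:
  assumes "continuous_on UNIV f"
  shows "(prim f has_vector_derivative f x) (at x)"
proof -
  obtain G where G: "\<And>x. (G has_vector_derivative f x) (at x)"
    using einterval_antiderivative[of "-\<infinity>" "\<infinity>" f] assms by (auto simp: continuous_on_eq_continuous_at)
  have "prim f = (\<lambda>x. G x - G 0)" using prim_eq[OF G] by blast
  then show ?thesis by (auto intro!: derivative_eq_intros G)
qed

lemma prim_0 [simp]: "prim f 0 = 0"
  by (simp add: prim_def)

lemma prim_diff_integral: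
  assumes "continuous_on UNIV f" and "a \<le> b"
  shows "prim f b - prim f a = integral {a..b} f"
  using fundamental_theorem_of_calculus[of a b "prim f" f]
    has_vector_derivative_prim[OF assms(1)] assms(2)
  by (simp add: has_vector_derivative_at_within integral_unique)

lemma smooth_prim:
  fixes f :: "real \<Rightarrow> 'b::euclidean_space"
  assumes "smooth f" shows "smooth (prim f)"
  using assms smoothI_1D has_vector_derivative_prim smooth_continuous_on by blast

text \<open>
  Differentiation under the integral sign. The partial derivatives are jointly continuous, and in
  finite dimension this is continuity of the derivative as a bounded linear map.
\<close>

lemma has_derivative_integral_smooth:
  fixes f :: "real \<times> 'a::euclidean_space \<Rightarrow> 'b::euclidean_space"
  assumes "smooth f"
  shows "((\<lambda>x. integral {0..1} (\<lambda>r. f (r, x))) has_derivative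
          (\<lambda>v. integral {0..1} (\<lambda>r. frechet_derivative f (at (r, x)) (0, v)))) (at x)"
proof -
  let ?D = "\<lambda>x r v. frechet_derivative f (at (r, x)) (0, v)"
  define B where "B x r = Blinfun (?D x r)" for x r
  have D: "((\<lambda>x. f (r, x)) has_derivative ?D x r) (at x)" for x r
    by (rule has_derivative_compose[of "\<lambda>x. (r, x)" "\<lambda>v. (0, v)", OF _ smooth_has_derivative[OF assms]])
      (auto intro!: derivative_eq_intros)
  have B: "blinfun_apply (B x r) = ?D x r" for x r
    unfolding B_def using D has_derivative_bounded_linear bounded_linear_Blinfun_apply by blast
  have cont: "continuous_on UNIV (\<lambda>(x, r). B x r)"
  proof (rule continuous_on_blinfun_componentwise)
    fix i :: 'a
    have "continuous_on UNIV (\<lambda>p. frechet_derivative f (at (snd p, fst p)) (0, i))"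
      by (rule continuous_on_compose2[OF smooth_continuous_on[OF smooth_frechet_derivative[OF assms]]])
        (auto intro!: continuous_intros)
    then show "continuous_on UNIV (\<lambda>p. (case p of (x, r) \<Rightarrow> B x r) i)"
      by (simp add: B case_prod_beta')
  qed
  have cB: "continuous_on {0..1} (B x)" for x
    using continuous_on_compose2[OF cont, of "{0..1}" "\<lambda>r. (x, r)"]
    by (simp add: continuous_on_Pair continuous_on_const continuous_on_id)
  have "((\<lambda>x. integral (cbox 0 1) (\<lambda>r. f (r, x))) has_derivative integral (cbox 0 1) (B x)) (at x within UNIV)"
  proof (rule leibniz_rule)
    show "((\<lambda>x. f (r, x)) has_derivative blinfun_apply (B x r)) (at x within UNIV)" for x r
      using D B by simp
    show "(\<lambda>r. f (r, x)) integrable_on cbox 0 1" for x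
      by (intro integrable_continuous continuous_on_compose2[OF smooth_continuous_on[OF assms]])
        (auto intro!: continuous_intros)
    show "continuous_on (UNIV \<times> cbox 0 1) (\<lambda>(x, r). B x r)"
      using cont continuous_on_subset by blast
  qed auto
  moreover have "blinfun_apply (integral {0..1} (B x)) = (\<lambda>v. integral {0..1} (\<lambda>r. ?D x r v))"
    using blinfun_apply_integral[OF integrable_continuous_interval[OF cB[of x]]] B by (auto simp: fun_eq_iff)
  ultimately show ?thesis by simp
qed

lemma smooth_integral_param:
  fixes f :: "real \<times> 'a::euclidean_space \<Rightarrow> 'b::euclidean_space"
  assumes "smooth f"
  shows "smooth (\<lambda>x. integral {0..1} (\<lambda>r. f (r, x)))"
proof -
  have "Ck_on k UNIV (\<lambda>x. integral {0..1} (\<lambda>r. f (r, x)))" if "smooth f"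
    for k and f :: "real \<times> 'a \<Rightarrow> 'b" using that
  proof (induction k arbitrary: f)
    case 0
    have "isCont (\<lambda>x. integral {0..1} (\<lambda>r. f (r, x))) x" for x
      using has_derivative_integral_smooth[OF 0] by (rule has_derivative_continuous)
    then show ?case by (auto intro: continuous_at_imp_continuous_on)
  next
    case (Suc k)
    show ?case
      by (rule Ck_on_SucI[OF has_derivative_integral_smooth[OF Suc.prems]])
        (rule Suc.IH, rule smooth_frechet_derivative[OF Suc.prems])
  qed
  then show ?thesis using assms by (simp add: smooth_def)
qed

lemma smooth_Pair:
  fixes f :: "'c::euclidean_space \<Rightarrow> 'a::euclidean_space" and g :: "'c \<Rightarrow> 'b::euclidean_space"
  assumes "smooth f" "smooth g"
  shows "smooth (\<lambda>x. (f x, g x))"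
proof -
  have "smooth (\<lambda>x. (f x, 0::'b) + (0::'a, g x))"
    using smooth_compose[where f = "\<lambda>y. (y, 0::'b)", OF smooth_bounded_linear assms(1)]
      smooth_compose[where f = "\<lambda>y. (0::'a, y)", OF smooth_bounded_linear assms(2)]
    by (intro smooth_add) (simp_all add: bounded_linear_Pair bounded_linear_ident bounded_linear_zero)
  then show ?thesis by simp
qed

lemmas smooth_ident = smooth_bounded_linear[OF bounded_linear_ident]
lemmas smooth_fst = smooth_bounded_linear[OF bounded_linear_fst]
lemmas smooth_snd = smooth_bounded_linear[OF bounded_linear_snd]

lemma smooth_prim_param:
  fixes f :: "real \<Rightarrow> real \<Rightarrow> 'b::euclidean_space"
  assumes "smooth (\<lambda>(x, v). f x v)"
  shows "smooth (\<lambda>(x, v). prim (\<lambda>t. f t v) x)"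
proof -
  have "smooth (\<lambda>q::real \<times> (real \<times> real). (fst q * fst (snd q), snd (snd q)))"
    by (rule smooth_Pair[OF smooth_mult[OF smooth_fst smooth_compose[OF smooth_fst smooth_snd]]
        smooth_compose[OF smooth_snd smooth_snd]])
  from smooth_scaleR[OF smooth_fst smooth_integral_param[OF smooth_compose[OF assms this]]]
  show ?thesis by (simp add: prim_def case_prod_beta')
qed

lemma has_vector_derivative_prim_param:
  fixes f :: "real \<Rightarrow> real \<Rightarrow> 'b::euclidean_space"
  assumes "smooth (\<lambda>(x, v). f x v)"
    and "\<And>x v. (f x has_vector_derivative f' x v) (at v)"
  shows "((\<lambda>v. prim (\<lambda>t. f t v) x) has_vector_derivative prim (\<lambda>t. f' t v) x) (at v)"
proof -
  define g where "g = (\<lambda>q::real\<times>real. f (fst q * x) (snd q))"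
  have g: "smooth g"
    unfolding g_def using smooth_compose[OF assms(1) smooth_Pair[OF smooth_mult[OF smooth_fst smooth_const[of x]] smooth_snd]]
    by simp
  have D: "frechet_derivative g (at (r, v)) (0, w) = w *\<^sub>R f' (r * x) v" for r v w
  proof -
    have "((\<lambda>v. g (r, v)) has_derivative (\<lambda>w. frechet_derivative g (at (r, v)) (0, w))) (at v)"
      by (rule has_derivative_compose[of "\<lambda>v. (r, v)" "\<lambda>w. (0, w)", OF _ smooth_has_derivative[OF g]])
        (auto intro!: derivative_eq_intros)
    moreover have "((\<lambda>v. g (r, v)) has_derivative (\<lambda>w. w *\<^sub>R f' (r * x) v)) (at v)"
      using assms(2) by (simp add: g_def has_vector_derivative_def)
    ultimately show ?thesis using has_derivative_unique by metis
  qed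
  have "((\<lambda>v. integral {0..1} (\<lambda>r. g (r, v))) has_vector_derivative
      integral {0..1} (\<lambda>r. f' (r * x) v)) (at v)"
    using has_derivative_integral_smooth[OF g, of v] unfolding D has_vector_derivative_def by simp
  from has_vector_derivative_scaleR[OF DERIV_const this, of x]
  show ?thesis
    by (simp add: prim_def g_def)
qed

section \<open>Unit vectors and periodic functions\<close>

definition unit_vec :: "real \<Rightarrow> real ^ 2" where
  "unit_vec a = cos a *\<^sub>R axis 1 1 + sin a *\<^sub>R axis 2 1"

lemma norm_unit_comb: "norm (x *\<^sub>R axis 1 1 + y *\<^sub>R axis 2 1 :: real ^ 2) = sqrt (x\<^sup>2 + y\<^sup>2)"
  by (simp add: norm_vec_def L2_set_def sum_2 axis_def)

lemma norm_unit_vec [simp]: "norm (unit_vec a) = 1"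
  by (simp add: unit_vec_def norm_unit_comb)

lemma unit_vec_plus_2pi [simp]: "unit_vec (a + 2 * pi) = unit_vec a"
  by (simp add: unit_vec_def)

lemma has_vector_derivative_unit_vec:
  "(unit_vec has_vector_derivative unit_vec (a + pi / 2)) (at a within S)"
proof -
  have "(unit_vec has_vector_derivative (- sin a) *\<^sub>R axis 1 1 + cos a *\<^sub>R axis 2 1) (at a within S)"
    unfolding unit_vec_def by (auto intro!: derivative_eq_intros)
  then show ?thesis by (simp add: unit_vec_def cos_add sin_add)
qed

lemma smooth_unit_vec: "smooth unit_vec"
  unfolding unit_vec_def by (intro smooth_add smooth_scaleR smooth_cos_sin smooth_const)

lemma norm_unit_vec_diff: "norm (unit_vec a - unit_vec b) \<le> \<bar>a - b\<bar>"
proof -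
  have "norm (unit_vec a - unit_vec b) \<le> 1 * norm (a - b)"
    by (rule differentiable_bound[where f' = "\<lambda>a h. h *\<^sub>R unit_vec (a + pi / 2)" and S = UNIV])
      (use has_vector_derivative_unit_vec in \<open>auto simp: has_vector_derivative_def onorm_scaleR_left bounded_linear_ident onorm_id intro: onorm_le\<close>)
  then show ?thesis by simp
qed

lemma periodic_int:
  fixes g :: "real \<Rightarrow> 'b"
  assumes "\<And>x. g (x + 2 * pi) = g x"
  shows "g (x + 2 * pi * of_int k) = g x"
proof (induction k rule: int_induct[of _ 0])
  case (step1 i)
  have "x + 2 * pi * of_int (i + 1) = (x + 2 * pi * of_int i) + 2 * pi"
    by (simp add: algebra_simps)
  then show ?case using step1 assms by metis
next
  case (step2 i)
  have "x + 2 * pi * of_int i = (x + 2 * pi * of_int (i - 1)) + 2 * pi"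
    by (simp add: algebra_simps)
  then show ?case using step2 assms by metis
qed simp

text \<open>
  A periodic function of the angle becomes a function on the circle by composition with \<^const>\<open>Arg\<close>;
  the jump of \<^const>\<open>Arg\<close> is absorbed by periodicity.
\<close>

lemma periodic_Arg_cis:
  fixes g :: "real \<Rightarrow> 'b"
  assumes "\<And>x. g (x + 2 * pi) = g x"
  shows "g (Arg (cis x)) = g x"
proof -
  obtain k where "Im (\<i> * x) - of_int k * (2 * pi) = Arg (exp (\<i> * x))"
    using Arg_exp_diff_2pi by blast
  then have "Arg (cis x) = x + 2 * pi * of_int (- k)"
    by (simp add: cis_conv_exp algebra_simps)
  then show ?thesis using periodic_int[of g, OF assms] by metis
qed

lemma smooth_imp_smooth_on: "smooth f \<Longrightarrow> smooth_on S f"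
  unfolding smooth_on_def smooth_def by blast

lemma smooth_on_UNIV_D: "smooth_on UNIV f \<Longrightarrow> smooth f"
proof -
  assume "smooth_on UNIV f"
  then obtain g where "smooth g" "\<And>x. g x = f x"
    unfolding smooth_on_def smooth_def by (auto simp: top.extremum_unique)
  moreover from this have "g = f" by auto
  ultimately show ?thesis by simp
qed

lemma id_Diff_S1: "id \<in> Diff_S1"
proof -
  have "inv_into S1 id (cis x) = cis x" for x
    by (rule inv_into_f_eq) auto
  then show ?thesis
    by (simp add: Diff_S1_def smooth_curve_def smooth_imp_smooth_on smooth_cis bij_betw_def)
qed

section \<open>Upper bounds for the norm and the distance\<close>

text \<open>
  The only place where the metric itself is estimated. A lower bound \<open>m\<close> for the speed is what makes
  \<open>\<integral> |D\<^sub>sh|\<^sup>2 ds = \<integral> |\<partial>\<^sub>\<theta>h|\<^sup>2 / |\<partial>\<^sub>\<theta>c| d\<theta>\<close> finite.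
\<close>

lemma H1_norm_le:
  assumes "0 \<le> lam" "0 < m"
    and c': "continuous_on {0..2*pi} (d_theta c)" and h': "continuous_on {0..2*pi} (d_theta h)"
    and h: "continuous_on {0..2*pi} (\<lambda>x. h (cis x))"
    and m: "\<And>x. x \<in> {0..2*pi} \<Longrightarrow> m \<le> norm (d_theta c x)"
    and M: "\<And>x. x \<in> {0..2*pi} \<Longrightarrow> norm (d_theta c x) \<le> M"
    and H: "\<And>x. x \<in> {0..2*pi} \<Longrightarrow> norm (h (cis x)) \<le> H"
    and G: "integral {0..2*pi} (\<lambda>x. (norm (d_theta h x))\<^sup>2) \<le> G"
  shows "H1_norm lam c h \<le> sqrt (H\<^sup>2 + lam * (2 * pi * M) * (G / m))"
proof -
  have len: "len c = integral {0..2*pi} (\<lambda>x. norm (d_theta c x))"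
    by (simp add: len_def integral_ds_def)
  have [simp]: "(\<lambda>x. norm (d_theta c x)) integrable_on {0..2*pi}"
    by (intro integrable_continuous_interval continuous_intros c')
  have "integral {0..2*pi} (\<lambda>x. m) \<le> len c" "len c \<le> integral {0..2*pi} (\<lambda>x. M)"
    unfolding len by (intro integral_le; use m M in auto)+
  then have L: "0 < len c" "len c \<le> 2 * pi * M"
    using \<open>0 < m\<close> pi_gt_zero by (auto simp: less_le_trans mult_pos_pos intro: order.strict_trans2[rotated])
  have "integral_ds c (\<lambda>x. (norm (h (cis x)))\<^sup>2) \<le> integral {0..2*pi} (\<lambda>x. H\<^sup>2 * norm (d_theta c x))"
    unfolding integral_ds_def
    by (intro integral_le integrable_continuous_interval continuous_intros c' h)
      (use H in \<open>auto intro!: mult_right_mono power_mono\<close>)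
  then have 1: "1 / len c * integral_ds c (\<lambda>x. (norm (h (cis x)))\<^sup>2) \<le> H\<^sup>2"
    using L by (simp add: len field_simps)
  have "integral_ds c (\<lambda>x. (norm (D_s c h x))\<^sup>2) \<le> integral {0..2*pi} (\<lambda>x. (norm (d_theta h x))\<^sup>2 / m)"
    unfolding integral_ds_def
  proof (intro integral_le integrable_continuous_interval)
    have nz: "norm (d_theta c x) \<noteq> 0" if "x \<in> {0..2*pi}" for x
      using m[OF that] \<open>0 < m\<close> by auto
    show "continuous_on {0..2*pi} (\<lambda>x. (norm (D_s c h x))\<^sup>2 * norm (d_theta c x))"
      unfolding D_s_def by (intro continuous_intros c' h') (use nz in auto)
    show "continuous_on {0..2*pi} (\<lambda>x. (norm (d_theta h x))\<^sup>2 / m)"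
      by (intro continuous_intros h') (use \<open>0 < m\<close> in auto)
    fix x assume x: "x \<in> {0..2*pi}"
    have "(norm (D_s c h x))\<^sup>2 * norm (d_theta c x) = (norm (d_theta h x))\<^sup>2 / norm (d_theta c x)"
      using nz[OF x] by (simp add: D_s_def power_divide power2_eq_square field_simps)
    also have "\<dots> \<le> (norm (d_theta h x))\<^sup>2 / m"
      using m[OF x] \<open>0 < m\<close> by (intro divide_left_mono mult_pos_pos) auto
    finally show "(norm (D_s c h x))\<^sup>2 * norm (d_theta c x) \<le> (norm (d_theta h x))\<^sup>2 / m" .
  qed
  also have "\<dots> \<le> G / m"
    using G \<open>0 < m\<close> by (simp add: divide_right_mono)
  finally have 2: "integral_ds c (\<lambda>x. (norm (D_s c h x))\<^sup>2) \<le> G / m" .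
  have "0 \<le> integral {0..2*pi} (\<lambda>x. (norm (d_theta h x))\<^sup>2)"
    by (intro integral_nonneg integrable_continuous_interval continuous_intros h') auto
  then have "0 \<le> G / m" using G \<open>0 < m\<close> by simp
  then have "lam * len c * integral_ds c (\<lambda>x. (norm (D_s c h x))\<^sup>2) \<le> lam * (2 * pi * M) * (G / m)"
    using L 2 \<open>0 \<le> lam\<close>
    by (meson mult_left_mono mult_mono' mult_mono order.trans less_imp_le mult_nonneg_nonneg mult_right_mono)
  with 1 show ?thesis unfolding H1_norm_def by (intro real_sqrt_le_mono add_mono)
qed

lemma d_H1_le:
  assumes "C \<in> admissible_homotopies c0 c1" and "0 \<le> B"
    and "\<And>v. v \<in> {0..1} \<Longrightarrow> H1_norm lam (\<lambda>u. C u v) (d_v C v) \<le> B"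
  shows "d_H1 lam c0 c1 \<le> ereal B"
proof -
  have "H1_length lam C \<le> B"
  proof (cases "(\<lambda>v. H1_norm lam (\<lambda>u. C u v) (d_v C v)) integrable_on {0..1}")
    case True
    then have "H1_length lam C \<le> integral {0..1} (\<lambda>v::real. B)"
      unfolding H1_length_def using assms by (intro integral_le) auto
    then show ?thesis by simp
  next
    \<comment> \<open>the integral of a non-integrable function is \<open>0\<close>\<close>
    case False
    then show ?thesis using \<open>0 \<le> B\<close> by (simp add: H1_length_def not_integrable_integral)
  qed
  then show ?thesis
    unfolding d_H1_def using assms(1) by (intro INF_lower2[OF assms(1)]) simp
qed

text \<open>
  The Cauchy-Schwarz inequality against the constant \<open>1\<close>: the variance of \<open>f\<close> is nonnegative.
\<close>

lemma integral_squared_le: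
  fixes f :: "real \<Rightarrow> real"
  assumes f: "f integrable_on {a..b}" "(\<lambda>x. (f x)\<^sup>2) integrable_on {a..b}" and "a \<le> b"
  shows "(integral {a..b} f)\<^sup>2 \<le> (b - a) * integral {a..b} (\<lambda>x. (f x)\<^sup>2)"
proof (cases "a = b")
  case False
  define k where "k = integral {a..b} f / (b - a)"
  have eq: "(f x - k)\<^sup>2 = ((f x)\<^sup>2 - 2 * k * f x) + k\<^sup>2" for x
    by (simp add: power2_eq_square algebra_simps)
  have i: "(\<lambda>x. 2 * k * f x) integrable_on {a..b}" "(\<lambda>x. (f x)\<^sup>2 - 2 * k * f x) integrable_on {a..b}"
    using f by (auto intro!: integrable_diff integrable_on_mult_right)
  have "0 \<le> integral {a..b} (\<lambda>x. (f x - k)\<^sup>2)"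
    unfolding eq using i by (intro integral_nonneg integrable_add) (auto simp flip: eq)
  also have "\<dots> = integral {a..b} (\<lambda>x. (f x)\<^sup>2) - 2 * k * integral {a..b} f + (b - a) * k\<^sup>2"
    unfolding eq using i f \<open>a \<le> b\<close>
    by (subst Henstock_Kurzweil_Integration.integral_add, simp, simp add: integrable_const_ivl)
      (subst Henstock_Kurzweil_Integration.integral_diff, simp_all)
  also have "\<dots> = integral {a..b} (\<lambda>x. (f x)\<^sup>2) - (integral {a..b} f)\<^sup>2 / (b - a)"
  proof -
    have "k * integral {a..b} f = (integral {a..b} f)\<^sup>2 / (b - a)"
      "(b - a) * k\<^sup>2 = (integral {a..b} f)\<^sup>2 / (b - a)"
      using False by (simp_all add: k_def power2_eq_square)
    then show ?thesis by (simp add: mult.assoc)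
  qed
  finally show ?thesis using \<open>a \<le> b\<close> False by (simp add: field_simps)
qed simp

section \<open>Closed curves with prescribed tangent angle\<close>

definition mean :: "(real \<Rightarrow> 'b::euclidean_space) \<Rightarrow> 'b" where
  "mean f = (1 / (2 * pi)) *\<^sub>R prim f (2 * pi)"

text \<open>
  Subtracting the mean of \<open>f\<close> from \<open>f\<close> makes the primitive \<open>2\<pi>\<close>-periodic.
\<close>

definition closed_prim :: "(real \<Rightarrow> 'b::euclidean_space) \<Rightarrow> real \<Rightarrow> 'b" where
  "closed_prim f x = prim f x - x *\<^sub>R mean f"

lemma closed_prim_periodic:
  assumes "continuous_on UNIV f" and "\<And>x. f (x + 2 * pi) = f x"
  shows "closed_prim f (x + 2 * pi) = closed_prim f x"
proof -
  have "((\<lambda>x. prim f (x + 2 * pi) - prim f x) has_vector_derivative 0) (at x within UNIV)" for x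
  proof -
    have "((\<lambda>x. x + 2 * pi) has_vector_derivative 1) (at x)"
      by (auto intro!: derivative_eq_intros)
    from vector_diff_chain_at[OF this has_vector_derivative_prim[OF assms(1)]]
    have "((\<lambda>x. prim f (x + 2 * pi)) has_vector_derivative f x) (at x)"
      using assms(2) by (simp add: o_def)
    from has_vector_derivative_diff[OF this has_vector_derivative_prim[OF assms(1)]]
    show ?thesis by simp
  qed
  then obtain k where k: "\<And>x. prim f (x + 2 * pi) - prim f x = k"
    using has_vector_derivative_zero_constant[of UNIV "\<lambda>x. prim f (x + 2 * pi) - prim f x"] by auto
  have "prim f (x + 2 * pi) = prim f x + prim f (2 * pi)"
    using k[of 0] k[of x] by (simp add: algebra_simps)
  then show ?thesis
    by (simp add: closed_prim_def mean_def add_divide_distrib scaleR_add_left)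
qed

lemma has_vector_derivative_closed_prim:
  assumes "continuous_on UNIV f"
  shows "(closed_prim f has_vector_derivative f x - mean f) (at x)"
proof -
  have "((\<lambda>x. x *\<^sub>R mean f) has_vector_derivative mean f) (at x)"
    by (auto intro!: derivative_eq_intros)
  from has_vector_derivative_diff[OF has_vector_derivative_prim[OF assms] this]
  show ?thesis unfolding closed_prim_def .
qed

lemma norm_mean_le:
  assumes "continuous_on UNIV f"
  shows "norm (mean f) \<le> 1 / (2 * pi) * integral {0..2*pi} (\<lambda>x. norm (f x))"
proof -
  have "norm (prim f (2*pi)) \<le> integral {0..2*pi} (\<lambda>x. norm (f x))"
    unfolding prim_diff_integral[OF assms, of 0 "2*pi", simplified, symmetric]
    using prim_diff_integral[OF assms, of 0 "2*pi"]
      integral_norm_bound_integral[of f "{0..2*pi}" "\<lambda>x. norm (f x)"]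
      integrable_continuous_interval[OF continuous_on_subset[OF assms]]
      integrable_continuous_interval[OF continuous_on_subset[OF continuous_on_norm[OF assms]]]
    by simp
  then show ?thesis by (simp add: mean_def divide_right_mono)
qed

lemma norm_closed_prim_le:
  assumes f: "continuous_on UNIV f" and x: "x \<in> {0..2*pi}"
  shows "norm (closed_prim f x) \<le> 2 * integral {0..2*pi} (\<lambda>x. norm (f x))"
proof -
  let ?I = "integral {0..2*pi} (\<lambda>x. norm (f x))"
  have cf: "continuous_on S f" for S using f continuous_on_subset by blast
  have int: "f integrable_on {a..b}" "(\<lambda>x. norm (f x)) integrable_on {a..b}" for a b
    by (intro integrable_continuous_interval continuous_intros cf)+
  have "norm (prim f x) \<le> integral {0..x} (\<lambda>x. norm (f x))"
    using prim_diff_integral[OF f, of 0 x] x int by (auto simp: integral_norm_bound_integral)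
  also have "\<dots> \<le> ?I"
    using x by (intro integral_subset_le int) auto
  finally have 1: "norm (prim f x) \<le> ?I" .
  have "norm (x *\<^sub>R mean f) \<le> 2 * pi * (1 / (2 * pi) * ?I)"
    unfolding norm_scaleR using x by (intro mult_mono norm_mean_le f) auto
  with 1 show ?thesis
    unfolding closed_prim_def by (intro norm_triangle_le_diff) simp
qed


text \<open>
  The tangent has direction \<open>unit_vec (\<beta> \<theta>)\<close> up to the correction by the mean which closes the curve.
\<close>

definition angle_curve :: "real ^ 2 \<Rightarrow> real \<Rightarrow> (real \<Rightarrow> real) \<Rightarrow> complex \<Rightarrow> real ^ 2" where
  "angle_curve p l \<beta> z = p + l *\<^sub>R closed_prim (\<lambda>t. unit_vec (\<beta> t)) (Arg z)"

lemma continuous_unit_vec_comp: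
  "continuous_on UNIV \<beta> \<Longrightarrow> continuous_on UNIV (\<lambda>t. unit_vec (\<beta> t))"
  by (rule continuous_on_compose2[OF smooth_continuous_on[OF smooth_unit_vec, of UNIV]]) auto

lemma angle_curve_cis:
  assumes "continuous_on UNIV \<beta>" and "\<And>x. \<beta> (x + 2 * pi) = \<beta> x"
  shows "angle_curve p l \<beta> (cis x) = p + l *\<^sub>R closed_prim (\<lambda>t. unit_vec (\<beta> t)) x"
  unfolding angle_curve_def
  using periodic_Arg_cis[of "closed_prim (\<lambda>t. unit_vec (\<beta> t))"]
    closed_prim_periodic[OF continuous_unit_vec_comp[OF assms(1)]] assms(2)
  by simp

lemma d_theta_angle_curve:
  assumes "continuous_on UNIV \<beta>" and "\<And>x. \<beta> (x + 2 * pi) = \<beta> x"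
  shows "d_theta (angle_curve p l \<beta>) x = l *\<^sub>R (unit_vec (\<beta> x) - mean (\<lambda>t. unit_vec (\<beta> t)))"
  unfolding d_theta_def angle_curve_cis[OF assms]
  by (rule vector_derivative_at)
    (auto intro!: derivative_eq_intros has_vector_derivative_closed_prim continuous_unit_vec_comp assms)

lemma norm_d_theta_angle_curve:
  assumes "continuous_on UNIV \<beta>" and "\<And>x. \<beta> (x + 2 * pi) = \<beta> x" and "0 < l"
    and "norm (mean (\<lambda>t. unit_vec (\<beta> t))) \<le> 1 / 2"
  shows "l / 2 \<le> norm (d_theta (angle_curve p l \<beta>) x)"
    and "norm (d_theta (angle_curve p l \<beta>) x) \<le> 3 * l / 2"
proof -
  let ?w = "mean (\<lambda>t. unit_vec (\<beta> t))"
  have "1 / 2 \<le> norm (unit_vec (\<beta> x) - ?w)" "norm (unit_vec (\<beta> x) - ?w) \<le> 3 / 2"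
    using assms(4) norm_triangle_ineq2[of "unit_vec (\<beta> x)" ?w] norm_triangle_ineq4[of "unit_vec (\<beta> x)" ?w]
    by simp_all
  then show "l / 2 \<le> norm (d_theta (angle_curve p l \<beta>) x)"
    "norm (d_theta (angle_curve p l \<beta>) x) \<le> 3 * l / 2"
    using \<open>0 < l\<close> by (simp_all add: d_theta_angle_curve[OF assms(1,2)] mult.commute)
qed

lemma smooth_angle_curve_family:
  fixes \<alpha> :: "real \<Rightarrow> real \<Rightarrow> real"
  assumes "smooth (\<lambda>(x, v). \<alpha> v x)" and "\<And>v x. \<alpha> v (x + 2 * pi) = \<alpha> v x"
  shows "smooth (\<lambda>(x, v). angle_curve p l (\<alpha> v) (cis x))"
proof -
  have c: "continuous_on UNIV (\<alpha> v)" for v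
  proof -
    have "continuous_on UNIV (\<lambda>x::real. (x, v))" by (intro continuous_intros)
    from continuous_on_compose2[OF smooth_continuous_on[OF assms(1), of UNIV] this] show ?thesis by simp
  qed
  have s: "smooth (\<lambda>(x, v). prim (\<lambda>t. unit_vec (\<alpha> v t)) x)"
    using smooth_prim_param[of "\<lambda>t v. unit_vec (\<alpha> v t)"] smooth_compose[OF smooth_unit_vec assms(1)]
    by (simp add: case_prod_beta')
  have "smooth (\<lambda>q. prim (\<lambda>t. unit_vec (\<alpha> (snd q) t)) (2 * pi))"
    using smooth_compose[OF s smooth_Pair[OF smooth_const[of "2*pi"] smooth_snd]] by simp
  with s have "smooth (\<lambda>q. p + l *\<^sub>R (prim (\<lambda>t. unit_vec (\<alpha> (snd q) t)) (fst q)
      - fst q *\<^sub>R ((1 / (2 * pi)) *\<^sub>R prim (\<lambda>t. unit_vec (\<alpha> (snd q) t)) (2 * pi))))"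
    by (intro smooth_add smooth_diff smooth_scaleR smooth_const smooth_fst) (simp_all add: case_prod_beta')
  then show ?thesis
    using angle_curve_cis[OF c assms(2)] by (simp add: closed_prim_def mean_def case_prod_beta')
qed

lemma smooth_angle_curve:
  assumes "smooth \<beta>" and "\<And>x. \<beta> (x + 2 * pi) = \<beta> x"
  shows "smooth (\<lambda>x. angle_curve p l \<beta> (cis x))"
proof -
  have "smooth (\<lambda>q::real\<times>real. \<beta> (fst q))"
    by (rule smooth_compose[OF assms(1) smooth_fst])
  then have "smooth (\<lambda>(x, v). angle_curve p l ((\<lambda>_. \<beta>) (v::real)) (cis x))"
    by (intro smooth_angle_curve_family) (use assms(2) in \<open>auto simp: case_prod_beta'\<close>)
  from smooth_compose[OF this smooth_Pair[OF smooth_ident smooth_const[of 0]]] show ?thesis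
    by simp
qed

lemma immersed_angle_curve:
  assumes "smooth \<beta>" and "\<And>x. \<beta> (x + 2 * pi) = \<beta> x" and "0 < l"
    and "norm (mean (\<lambda>t. unit_vec (\<beta> t))) \<le> 1 / 2"
  shows "immersed (angle_curve p l \<beta>)"
proof -
  have "d_theta (angle_curve p l \<beta>) x \<noteq> 0" for x
    using norm_d_theta_angle_curve(1)[OF smooth_continuous_on[OF assms(1)] assms(2-4), of p x] \<open>0 < l\<close>
    by auto
  then show ?thesis
    unfolding immersed_def smooth_curve_def
    using smooth_imp_smooth_on[OF smooth_angle_curve[OF assms(1,2)]] by blast
qed

text \<open>
  The homotopy is linear in the angle: \<open>\<alpha>\<^sub>v = \<beta> + v (\<gamma> - \<beta>)\<close>. Its directions are \<open>\<bar>\<gamma> - \<beta>\<bar>\<close>-close to those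
  of \<open>\<beta>\<close>, so that the hypotheses \<open>1/4\<close> keep their mean below \<open>1/2\<close> and the speed above \<open>l/2\<close>. The variation
  field is the closed primitive of \<open>l (\<gamma> - \<beta>)\<close> times the unit normal, whose derivative is bounded in
  \<open>L\<^sup>2\<close> by a multiple of \<open>\<gamma> - \<beta>\<close>.
\<close>

lemma d_H1_angle_curve_le:
  assumes lam: "0 \<le> lam" and l: "0 < l"
    and \<beta>: "smooth \<beta>" "\<And>x. \<beta> (x + 2 * pi) = \<beta> x"
    and \<gamma>: "smooth \<gamma>" "\<And>x. \<gamma> (x + 2 * pi) = \<gamma> x"
    and mean: "norm (mean (\<lambda>t. unit_vec (\<beta> t))) \<le> 1 / 4"
    and D: "integral {0..2*pi} (\<lambda>x. (\<gamma> x - \<beta> x)\<^sup>2) \<le> D" "D \<le> 1 / 4"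
  shows "d_H1 lam (angle_curve p l \<beta>) (angle_curve p l \<gamma>) \<le> ereal (sqrt (8 * pi * l\<^sup>2 * (1 + 3 * lam) * D))"
proof -
  define \<alpha> where "\<alpha> v x = \<beta> x + v * (\<gamma> x - \<beta> x)" for v x
  define C where "C u v = angle_curve p l (\<alpha> v) u" for u v
  have \<alpha>2: "smooth (\<lambda>(x, v). \<alpha> v x)"
    unfolding \<alpha>_def case_prod_beta'
    by (intro smooth_add smooth_mult smooth_diff smooth_compose[OF \<beta>(1) smooth_fst]
        smooth_compose[OF \<gamma>(1) smooth_fst] smooth_snd)
  have \<alpha>p: "\<alpha> v (x + 2 * pi) = \<alpha> v x" for v x
    by (simp add: \<alpha>_def \<beta> \<gamma>)
  have \<alpha>s: "smooth (\<alpha> v)" for v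
    unfolding \<alpha>_def by (intro smooth_add smooth_mult smooth_diff \<beta> \<gamma> smooth_const)
  have \<alpha>c: "continuous_on S (\<alpha> v)" for S v by (rule smooth_continuous_on[OF \<alpha>s])
  have cont: "continuous_on S \<beta>" "continuous_on S \<gamma>" for S
    using smooth_continuous_on \<beta> \<gamma> by blast+
  have cd: "continuous_on S (\<lambda>x. \<bar>\<gamma> x - \<beta> x\<bar>)" "continuous_on S (\<lambda>x. (\<gamma> x - \<beta> x)\<^sup>2)" for S
    by (intro continuous_intros cont)+
  define I where "I = integral {0..2*pi} (\<lambda>x. \<bar>\<gamma> x - \<beta> x\<bar>)"
  have I0: "0 \<le> I"
    unfolding I_def by (intro integral_nonneg integrable_continuous_interval cd) auto
  have I: "I\<^sup>2 \<le> 2 * pi * D"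
  proof -
    have "I\<^sup>2 \<le> (2 * pi - 0) * integral {0..2*pi} (\<lambda>x. \<bar>\<gamma> x - \<beta> x\<bar>\<^sup>2)"
      unfolding I_def by (intro integral_squared_le integrable_continuous_interval) (use cd in auto)
    also have "\<dots> \<le> 2 * pi * D" using D by simp
    finally show ?thesis .
  qed
  have D0: "0 \<le> D"
    using I zero_le_power2[of I] pi_gt_zero by (smt (verit) mult_pos_neg)
  have mean_\<alpha>: "norm (mean (\<lambda>t. unit_vec (\<alpha> v t))) \<le> 1 / 2" if "v \<in> {0..1}" for v
  proof -
    have c: "continuous_on UNIV (\<lambda>t. unit_vec (\<alpha> v t))" "continuous_on UNIV (\<lambda>t. unit_vec (\<beta> t))"
      by (intro continuous_unit_vec_comp \<alpha>c cont)+
    have "prim (\<lambda>t. unit_vec (\<alpha> v t)) (2*pi) - prim (\<lambda>t. unit_vec (\<beta> t)) (2*pi)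
        = integral {0..2*pi} (\<lambda>t. unit_vec (\<alpha> v t) - unit_vec (\<beta> t))"
      using prim_diff_integral[OF c(1), of 0 "2*pi"] prim_diff_integral[OF c(2), of 0 "2*pi"]
        integrable_continuous_interval[OF continuous_on_subset[OF c(1)]]
        integrable_continuous_interval[OF continuous_on_subset[OF c(2)]]
      by (simp add: Henstock_Kurzweil_Integration.integral_diff)
    also have "norm \<dots> \<le> I"
      unfolding I_def
    proof (intro integral_norm_bound_integral integrable_continuous_interval cd)
      show "continuous_on {0..2*pi} (\<lambda>t. unit_vec (\<alpha> v t) - unit_vec (\<beta> t))"
        using c continuous_on_subset by (intro continuous_on_diff) blast+
      fix t
      have "norm (unit_vec (\<alpha> v t) - unit_vec (\<beta> t)) \<le> \<bar>v * (\<gamma> t - \<beta> t)\<bar>"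
        using norm_unit_vec_diff[of "\<alpha> v t" "\<beta> t"] by (simp add: \<alpha>_def)
      also have "\<dots> \<le> 1 * \<bar>\<gamma> t - \<beta> t\<bar>"
        unfolding abs_mult using that by (intro mult_right_mono) auto
      finally show "norm (unit_vec (\<alpha> v t) - unit_vec (\<beta> t)) \<le> \<bar>\<gamma> t - \<beta> t\<bar>" by simp
    qed
    finally have "norm (mean (\<lambda>t. unit_vec (\<alpha> v t)) - mean (\<lambda>t. unit_vec (\<beta> t))) \<le> I / (2 * pi)"
      by (simp add: mean_def divide_right_mono flip: scaleR_diff_right)
    moreover have "I / (2 * pi) \<le> 1 / 4"
    proof -
      have "I\<^sup>2 \<le> 2 * pi * (1 / 4)" using I D(2) pi_gt_zero by (smt (verit) mult_left_mono)
      also have "\<dots> \<le> (2 * pi / 4)\<^sup>2" using pi_gt3 by (simp add: power2_eq_square field_simps)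
      finally have "I \<le> 2 * pi / 4" by (rule power2_le_imp_le) simp
      then show ?thesis by (simp add: field_simps)
    qed
    ultimately show ?thesis
      using mean norm_triangle_sub[of "mean (\<lambda>t. unit_vec (\<alpha> v t))" "mean (\<lambda>t. unit_vec (\<beta> t))"] by linarith
  qed
  have adm: "C \<in> admissible_homotopies (angle_curve p l \<beta>) (angle_curve p l \<gamma>)"
    unfolding admissible_homotopies_def mem_Collect_eq
  proof (intro conjI ballI)
    show "smooth_homotopy C"
      unfolding smooth_homotopy_def C_def
      by (rule smooth_imp_smooth_on[OF smooth_angle_curve_family[OF \<alpha>2 \<alpha>p]])
    show "immersed (\<lambda>u. C u v)" if "v \<in> {0..1}" for v
      using immersed_angle_curve[OF \<alpha>s \<alpha>p l mean_\<alpha>[OF that], of p] by (simp add: C_def)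
    show "C u 0 = angle_curve p l \<beta> u" for u by (simp add: C_def \<alpha>_def[abs_def])
    show "\<exists>\<phi>\<in>Diff_S1. \<forall>u\<in>S1. C u 1 = angle_curve p l \<gamma> (\<phi> u)"
      by (rule bexI[OF _ id_Diff_S1]) (simp add: C_def \<alpha>_def[abs_def])
  qed
  \<comment> \<open>the derivative in \<open>v\<close> of the direction \<open>unit_vec (\<alpha> v x)\<close>\<close>
  define g where "g v x = (\<gamma> x - \<beta> x) *\<^sub>R unit_vec (\<alpha> v x + pi / 2)" for v x
  have gc: "continuous_on UNIV (g v)" for v
    unfolding g_def by (intro continuous_intros cont continuous_unit_vec_comp \<alpha>c)
  have gp: "g v (x + 2 * pi) = g v x" for v x by (simp add: g_def \<alpha>p \<beta> \<gamma>)
  have ng: "norm (g v x) = \<bar>\<gamma> x - \<beta> x\<bar>" for v x by (simp add: g_def)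
  have dv: "d_v C v z = l *\<^sub>R closed_prim (g v) (Arg z)" if "v \<in> {0..1}" for v z
  proof -
    have *: "((\<lambda>v. prim (\<lambda>t. unit_vec (\<alpha> v t)) x) has_vector_derivative prim (g v) x) (at v)" for x
    proof (rule has_vector_derivative_prim_param)
      show "smooth (\<lambda>(t, v). unit_vec (\<alpha> v t))"
        using smooth_compose[OF smooth_unit_vec \<alpha>2] by (simp add: case_prod_beta')
      fix t v
      have "((\<lambda>v. \<alpha> v t) has_vector_derivative (\<gamma> t - \<beta> t)) (at v)"
        unfolding \<alpha>_def by (auto intro!: derivative_eq_intros simp flip: has_real_derivative_iff_has_vector_derivative)
      from vector_diff_chain_at[OF this has_vector_derivative_unit_vec]
      show "((\<lambda>v. unit_vec (\<alpha> v t)) has_vector_derivative g v t) (at v)"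
        by (simp add: o_def g_def)
    qed
    have "((\<lambda>v. l *\<^sub>R closed_prim (\<lambda>t. unit_vec (\<alpha> v t)) (Arg z)) has_vector_derivative
        l *\<^sub>R closed_prim (g v) (Arg z)) (at v)"
      unfolding closed_prim_def mean_def
      by (intro bounded_linear.has_vector_derivative[OF bounded_linear_scaleR_right] has_vector_derivative_diff *)
    from has_vector_derivative_add[OF has_vector_derivative_const this, of p]
    have "((\<lambda>v. C z v) has_vector_derivative l *\<^sub>R closed_prim (g v) (Arg z)) (at v within {0..1})"
      unfolding C_def angle_curve_def by (simp add: has_vector_derivative_at_within)
    then show ?thesis
      unfolding d_v_def using that by (intro vector_derivative_within_closed_interval) auto
  qed
  have H1: "H1_norm lam (\<lambda>u. C u v) (d_v C v) \<le> sqrt (8 * pi * l\<^sup>2 * (1 + 3 * lam) * D)" if v: "v \<in> {0..1}" for v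
  proof -
    let ?h = "\<lambda>z. l *\<^sub>R closed_prim (g v) (Arg z)"
    have hcis: "?h (cis x) = l *\<^sub>R closed_prim (g v) x" for x
      using periodic_Arg_cis[of "closed_prim (g v)", OF closed_prim_periodic[OF gc gp]] by simp
    have dh: "d_theta ?h x = l *\<^sub>R (g v x - mean (g v))" for x
      unfolding d_theta_def hcis
      by (rule vector_derivative_at) (auto intro!: derivative_eq_intros has_vector_derivative_closed_prim gc)
    have I': "integral {0..2*pi} (\<lambda>x. norm (g v x)) = I" by (simp add: ng I_def)
    have mg: "norm (mean (g v)) \<le> I / (2 * pi)"
      using norm_mean_le[OF gc[of v]] I' by simp
    have mg2: "(norm (mean (g v)))\<^sup>2 \<le> D / (2 * pi)"
    proof -
      have "(norm (mean (g v)))\<^sup>2 \<le> (I / (2 * pi))\<^sup>2" using mg by (intro power_mono) auto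
      also have "\<dots> \<le> 2 * pi * D / (2 * pi)\<^sup>2"
        unfolding power_divide using I by (intro divide_right_mono) auto
      also have "\<dots> = D / (2 * pi)" by (simp add: power2_eq_square)
      finally show ?thesis .
    qed
    have "H1_norm lam (\<lambda>u. C u v) ?h \<le> sqrt ((2 * l * I)\<^sup>2 + lam * (2 * pi * (3 * l / 2)) * ((4 * l\<^sup>2 * D) / (l / 2)))"
    proof (rule H1_norm_le[OF lam])
      have Cv: "(\<lambda>u. C u v) = angle_curve p l (\<alpha> v)" by (auto simp: C_def)
      show "0 < l / 2" using l by simp
      show "continuous_on {0..2*pi} (d_theta (\<lambda>u. C u v))"
        unfolding Cv d_theta_angle_curve[OF \<alpha>c \<alpha>p, abs_def]
        using continuous_on_subset[OF continuous_unit_vec_comp[OF \<alpha>c]] by (intro continuous_intros) auto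
      show "continuous_on {0..2*pi} (d_theta ?h)"
        unfolding dh[abs_def] using continuous_on_subset[OF gc] by (intro continuous_intros) auto
      show "continuous_on {0..2*pi} (\<lambda>x. ?h (cis x))"
        unfolding hcis
        by (intro continuous_intros continuous_at_imp_continuous_on ballI
            has_vector_derivative_continuous[OF has_vector_derivative_closed_prim[OF gc]])
      show "l / 2 \<le> norm (d_theta (\<lambda>u. C u v) x)" "norm (d_theta (\<lambda>u. C u v) x) \<le> 3 * l / 2" for x
        unfolding Cv using norm_d_theta_angle_curve[OF \<alpha>c \<alpha>p l mean_\<alpha>[OF v]] by auto
      show "norm (?h (cis x)) \<le> 2 * l * I" if "x \<in> {0..2*pi}" for x
        unfolding hcis using norm_closed_prim_le[OF gc[of v] that] I' l by simp
      have "integral {0..2*pi} (\<lambda>x. (norm (d_theta ?h x))\<^sup>2)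
          \<le> integral {0..2*pi} (\<lambda>x. 2 * l\<^sup>2 * (\<gamma> x - \<beta> x)\<^sup>2 + 2 * l\<^sup>2 * (D / (2 * pi)))"
      proof (intro integral_le integrable_continuous_interval)
        show "continuous_on {0..2*pi} (\<lambda>x. (norm (d_theta ?h x))\<^sup>2)"
          unfolding dh[abs_def] using continuous_on_subset[OF gc] by (intro continuous_intros) auto
        show "continuous_on {0..2*pi} (\<lambda>x. 2 * l\<^sup>2 * (\<gamma> x - \<beta> x)\<^sup>2 + 2 * l\<^sup>2 * (D / (2 * pi)))"
          by (intro continuous_intros cont)
        fix x
        have "(norm (d_theta ?h x))\<^sup>2 = l\<^sup>2 * (norm (g v x - mean (g v)))\<^sup>2"
          using l by (simp add: dh power_mult_distrib)
        also have "\<dots> \<le> l\<^sup>2 * (2 * (norm (g v x))\<^sup>2 + 2 * (norm (mean (g v)))\<^sup>2)"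
        proof (intro mult_left_mono)
          have "(norm (g v x - mean (g v)))\<^sup>2 \<le> (norm (g v x) + norm (mean (g v)))\<^sup>2"
            by (intro power_mono norm_triangle_ineq4) auto
          also have "\<dots> \<le> 2 * (norm (g v x))\<^sup>2 + 2 * (norm (mean (g v)))\<^sup>2"
            using sum_squares_bound[of "norm (g v x)" "norm (mean (g v))"] by (simp add: power2_sum)
          finally show "(norm (g v x - mean (g v)))\<^sup>2 \<le> 2 * (norm (g v x))\<^sup>2 + 2 * (norm (mean (g v)))\<^sup>2" .
        qed auto
        also have "\<dots> \<le> l\<^sup>2 * (2 * (\<gamma> x - \<beta> x)\<^sup>2 + 2 * (D / (2 * pi)))"
          using mg2 by (intro mult_left_mono) (auto simp: ng)
        finally show "(norm (d_theta ?h x))\<^sup>2 \<le> 2 * l\<^sup>2 * (\<gamma> x - \<beta> x)\<^sup>2 + 2 * l\<^sup>2 * (D / (2 * pi))"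
          by (simp add: algebra_simps)
      qed
      also have "\<dots> = 2 * l\<^sup>2 * integral {0..2*pi} (\<lambda>x. (\<gamma> x - \<beta> x)\<^sup>2) + 2 * l\<^sup>2 * D"
        using integrable_continuous_interval[OF cd(2)]
        by (subst Henstock_Kurzweil_Integration.integral_add) (auto intro!: integrable_on_mult_right)
      also have "\<dots> \<le> 2 * l\<^sup>2 * D + 2 * l\<^sup>2 * D"
        using D by (intro add_mono mult_left_mono) auto
      finally show "integral {0..2*pi} (\<lambda>x. (norm (d_theta ?h x))\<^sup>2) \<le> 4 * l\<^sup>2 * D" by (simp add: mult_ac)
    qed
    also have "\<dots> \<le> sqrt (8 * pi * l\<^sup>2 * (1 + 3 * lam) * D)"
    proof (rule real_sqrt_le_mono)
      have "(2 * l * I)\<^sup>2 \<le> 4 * l\<^sup>2 * (2 * pi * D)"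
        using I mult_left_mono[of "I\<^sup>2" "2 * pi * D" "4 * l\<^sup>2"] by (simp add: power_mult_distrib)
      moreover have "lam * (2 * pi * (3 * l / 2)) * ((4 * l\<^sup>2 * D) / (l / 2)) = 24 * lam * pi * l\<^sup>2 * D"
        using l by (simp add: power2_eq_square)
      ultimately show "(2 * l * I)\<^sup>2 + lam * (2 * pi * (3 * l / 2)) * ((4 * l\<^sup>2 * D) / (l / 2))
          \<le> 8 * pi * l\<^sup>2 * (1 + 3 * lam) * D"
        by (simp add: algebra_simps)
    qed
    finally show ?thesis using dv[OF v] by presburger
  qed
  show ?thesis
    by (rule d_H1_le[OF adm _ H1]) (use lam D0 in \<open>auto intro!: mult_nonneg_nonneg\<close>)
qed

section \<open>Smooth periodic functions are dense in square mean\<close>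

lemma bounded_borel_integrable:
  fixes f :: "real \<Rightarrow> 'b::euclidean_space"
  assumes "f \<in> borel_measurable borel" "bounded (range f)"
  shows "f integrable_on {a..b}"
proof -
  obtain B where B: "\<And>x. norm (f x) \<le> B" using assms(2) by (auto simp: bounded_iff)
  have "f \<in> borel_measurable (lebesgue_on {a..b})"
    using assms(1) by (intro measurable_restrict_space1 measurable_completion) simp
  then show ?thesis
    by (rule measurable_bounded_by_integrable_imp_integrable[where g = "\<lambda>x. B"]) (use B in auto)
qed

lemma diff_square_integrable:
  fixes f h :: "real \<Rightarrow> real"
  assumes h: "continuous_on UNIV h" and f: "f \<in> borel_measurable borel" "bounded (range f)"
  shows "(\<lambda>x. (h x - f x)\<^sup>2) integrable_on {a..b}"
proof -
  obtain B where B: "\<And>x. \<bar>f x\<bar> \<le> B" using f(2) by (auto simp: bounded_iff)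
  have "bounded (h ` {a..b})"
    by (intro compact_imp_bounded compact_continuous_image continuous_on_subset[OF h]) auto
  then obtain K where K: "\<And>x. x \<in> {a..b} \<Longrightarrow> \<bar>h x\<bar> \<le> K"
    unfolding bounded_iff by (metis imageI real_norm_def)
  have "(\<lambda>x. (h x - f x)\<^sup>2) \<in> borel_measurable borel"
    using borel_measurable_continuous_onI[OF h] f(1) by measurable
  then have "(\<lambda>x. (h x - f x)\<^sup>2) \<in> borel_measurable (lebesgue_on {a..b})"
    by (intro measurable_restrict_space1 measurable_completion) simp
  then show ?thesis
  proof (rule measurable_bounded_by_integrable_imp_integrable[where g = "\<lambda>x. (K + B)\<^sup>2"])
    fix x :: real assume "x \<in> {a..b}"
    then have "\<bar>h x - f x\<bar> \<le> \<bar>K + B\<bar>" using K[of x] B[of x] by linarith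
    then show "norm ((h x - f x)\<^sup>2) \<le> (K + B)\<^sup>2" by (simp add: abs_le_square_iff)
  qed auto
qed

text \<open>
  A measurable function is the limit almost everywhere of continuous functions. Truncating them at
  a bound of \<open>f\<close> and multiplying by \<open>min 1 (n x (2\<pi> - x))\<close>, which vanishes at both ends and tends
  to \<open>1\<close> in between, produces a dominated sequence of continuous functions on the circle.
\<close>

lemma L2_approx_continuous:
  fixes f :: "real \<Rightarrow> real"
  assumes "f \<in> borel_measurable borel" "bounded (range f)" "0 < e"
  obtains G where "continuous_on UNIV G" "G 0 = 0" "G (2*pi) = 0" 
    "integral {0..2*pi} (\<lambda>x. (G x - f x)\<^sup>2) < e"
proof -
  obtain B where B: "\<And>x. \<bar>f x\<bar> \<le> B" using assms(2) by (auto simp: bounded_iff)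
  have B0: "0 \<le> B" using B[of 0] by simp
  have "f \<in> borel_measurable lebesgue"
    using assms(1) by (intro measurable_completion) simp
  then have "f measurable_on UNIV"
    by (rule lebesgue_measurable_imp_measurable_on) simp
  then obtain N g where N: "negligible N" and g: "\<And>n::nat. continuous_on UNIV (g n)"
    and lim: "\<And>x. x \<notin> N \<Longrightarrow> (\<lambda>n. g n x) \<longlonglongrightarrow> f x"
    unfolding measurable_on_def by (simp only: UNIV_I if_True) blast
  define G where "G n x = max (- B) (min B (g n x)) * min 1 (real n * (x * (2 * pi - x)))" for n x
  have Gc: "continuous_on S (G n)" for n S
    unfolding G_def by (intro continuous_intros continuous_on_max continuous_on_min continuous_on_subset[OF g]) auto
  have cut: "\<bar>min 1 (real n * (x * (2 * pi - x)))\<bar> \<le> 1" if "x \<in> {0..2*pi}" for n x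
  proof -
    have "0 \<le> real n * (x * (2 * pi - x))" using that by auto
    then show ?thesis by linarith
  qed
  have GB: "\<bar>G n x\<bar> \<le> B" if "x \<in> {0..2*pi}" for n x
  proof -
    have "\<bar>G n x\<bar> \<le> B * 1"
      unfolding G_def abs_mult using cut[OF that] B0 by (intro mult_mono) auto
    then show ?thesis by simp
  qed
  define Z where "Z = N \<union> {0, 2*pi}"
  have Z: "negligible Z" unfolding Z_def using N by (simp add: negligible_Un)
  have limG: "(\<lambda>n. G n x) \<longlonglongrightarrow> f x" if x: "x \<in> {0..2*pi} - Z" for x
  proof -
    have "(\<lambda>n. max (- B) (min B (g n x))) \<longlonglongrightarrow> max (- B) (min B (f x))"
      using x by (intro tendsto_intros lim) (auto simp: Z_def)
    moreover have "max (- B) (min B (f x)) = f x" using B[of x] by auto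
    moreover have "(\<lambda>n. min 1 (real n * (x * (2 * pi - x)))) \<longlonglongrightarrow> 1"
    proof -
      have "0 < x * (2 * pi - x)" using x by (auto simp: Z_def intro!: mult_pos_pos)
      then obtain n0 where "1 < real n0 * (x * (2 * pi - x))"
        using ex_less_of_nat_mult by blast
      then have "1 \<le> real n * (x * (2 * pi - x))" if "n \<ge> n0" for n
        using that \<open>0 < x * (2 * pi - x)\<close> mult_right_mono[of "real n0" "real n" "x * (2 * pi - x)"] by simp
      then have "\<forall>\<^sub>F n in sequentially. min 1 (real n * (x * (2 * pi - x))) = 1"
        unfolding eventually_sequentially by (intro exI[of _ n0]) auto
      then show ?thesis by (rule tendsto_eventually)
    qed
    ultimately show ?thesis unfolding G_def using tendsto_mult by fastforce
  qed
  note int2 = diff_square_integrable[OF Gc assms(1,2)]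
  have "(\<lambda>n. integral {0..2*pi} (\<lambda>x. if x \<in> Z then 0 else (G n x - f x)\<^sup>2))
      \<longlonglongrightarrow> integral {0..2*pi} (\<lambda>x. 0)"
  proof (rule dominated_convergence(2)[where h = "\<lambda>x. (2 * B)\<^sup>2"])
    fix n
    show "(\<lambda>x. if x \<in> Z then 0 else (G n x - f x)\<^sup>2) integrable_on {0..2*pi}"
      by (rule integrable_spike[OF int2 Z]) auto
    fix x :: real assume x: "x \<in> {0..2*pi}"
    then have "\<bar>G n x - f x\<bar> \<le> 2 * B" using GB[of x n] B[of x] by linarith
    then have "(G n x - f x)\<^sup>2 \<le> (2 * B)\<^sup>2" by (metis abs_ge_zero power2_abs power_mono)
    then show "norm (if x \<in> Z then 0 else (G n x - f x)\<^sup>2) \<le> (2 * B)\<^sup>2" by simp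
  next
    fix x :: real assume x: "x \<in> {0..2*pi}"
    show "(\<lambda>n. if x \<in> Z then 0 else (G n x - f x)\<^sup>2) \<longlonglongrightarrow> 0"
    proof (cases "x \<in> Z")
      case False
      then have "(\<lambda>n. (G n x - f x)\<^sup>2) \<longlonglongrightarrow> (f x - f x)\<^sup>2"
        using x by (intro tendsto_intros limG) auto
      then show ?thesis using False by simp
    qed simp
  qed auto
  moreover have "integral {0..2*pi} (\<lambda>x. if x \<in> Z then 0 else (G n x - f x)\<^sup>2)
      = integral {0..2*pi} (\<lambda>x. (G n x - f x)\<^sup>2)" for n
    by (rule integral_spike[OF Z]) auto
  ultimately have "(\<lambda>n. integral {0..2*pi} (\<lambda>x. (G n x - f x)\<^sup>2)) \<longlonglongrightarrow> 0" by simp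
  then have "\<forall>\<^sub>F n in sequentially. integral {0..2*pi} (\<lambda>x. (G n x - f x)\<^sup>2) < e"
    by (rule order_tendstoD) fact
  then obtain n where "integral {0..2*pi} (\<lambda>x. (G n x - f x)\<^sup>2) < e"
    by (meson eventually_sequentially le_refl)
  with Gc[of UNIV n] show thesis by (intro that[of "G n"]) (auto simp: G_def)
qed

lemma smooth_real_polynomial_function:
  assumes "real_polynomial_function p" shows "smooth (\<lambda>x. p (cis x))"
  using assms
proof induction
  case (linear f)
  then have "smooth f" by (rule smooth_bounded_linear)
  then show ?case using smooth_cis by (rule smooth_compose)
qed (auto intro: smooth_const smooth_add smooth_mult)

text \<open>
  Polynomials in \<open>cos x\<close> and \<open>sin x\<close>, that is real polynomial functions on the unit circle, are dense
  by the Stone-Weierstrass theorem.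
\<close>

lemma periodic_approx_continuous:
  fixes G :: "real \<Rightarrow> real"
  assumes "continuous_on UNIV G" "G 0 = G (2*pi)" "0 < e"
  obtains \<beta> where "smooth \<beta>" "\<And>x. \<beta> (x + 2 * pi) = \<beta> x" "\<And>x. x \<in> {0..2*pi} \<Longrightarrow> \<bar>\<beta> x - G x\<bar> < e"
proof -
  define P where "P t = G (2 * pi * t)" for t
  have c: "continuous_on S P" for S
    unfolding P_def by (intro continuous_on_compose2[OF assms(1)] continuous_intros) auto
  \<comment> \<open>a loop is homotopic to itself, which yields its continuity as a map on the circle\<close>
  have "homotopic_loops UNIV P P"
    using assms(2) c by (simp add: homotopic_loops_refl path_def pathstart_def pathfinish_def P_def)
  from homotopic_loops_imp_homotopic_circlemaps[OF this]
  have "continuous_on (sphere 0 1) (P \<circ> (\<lambda>z. Arg2pi z / (2 * pi)))"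
    using homotopic_with_imp_continuous by blast
  then obtain p where p: "real_polynomial_function p"
    and pe: "\<And>z. z \<in> sphere 0 1 \<Longrightarrow> \<bar>(P \<circ> (\<lambda>z. Arg2pi z / (2 * pi))) z - p z\<bar> < e"
    using Stone_Weierstrass_real_polynomial_function[OF compact_sphere _ assms(3)] by metis
  have 1: "\<bar>p (cis x) - G x\<bar> < e" if "0 \<le> x" "x < 2 * pi" for x
  proof -
    have "Arg2pi (cis x) = x"
      using that by (intro Arg2pi_unique[of 1]) (auto simp: cis_conv_exp)
    then show ?thesis using pe[of "cis x"] by (simp add: P_def)
  qed
  show thesis
  proof (rule that[of "\<lambda>x. p (cis x)"])
    show "smooth (\<lambda>x. p (cis x))" by (rule smooth_real_polynomial_function[OF p])
    show "p (cis (x + 2 * pi)) = p (cis x)" for x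
      by (metis cis_2pi cis_mult mult.right_neutral)
    show "\<bar>p (cis x) - G x\<bar> < e" if "x \<in> {0..2*pi}" for x
      using 1[of x] 1[of 0] that assms(2) by (cases "x = 2 * pi") auto
  qed
qed

lemma L2_approx_smooth_periodic:
  fixes f :: "real \<Rightarrow> real"
  assumes f: "f \<in> borel_measurable borel" "bounded (range f)" and "0 < e"
  obtains \<beta> where "smooth \<beta>" "\<And>x. \<beta> (x + 2 * pi) = \<beta> x"
    "integral {0..2*pi} (\<lambda>x. (\<beta> x - f x)\<^sup>2) < e"
proof -
  obtain G where G: "continuous_on UNIV G" "G 0 = 0" "G (2*pi) = 0" 
    and Ge: "integral {0..2*pi} (\<lambda>x. (G x - f x)\<^sup>2) < e / 4"
    using L2_approx_continuous[OF f, of "e / 4"] \<open>0 < e\<close> by auto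
  obtain \<beta> where \<beta>: "smooth \<beta>" "\<And>x. \<beta> (x + 2 * pi) = \<beta> x"
    and \<beta>e: "\<And>x. x \<in> {0..2*pi} \<Longrightarrow> \<bar>\<beta> x - G x\<bar> < sqrt (e / (8 * pi))"
    using periodic_approx_continuous[OF G(1), of "sqrt (e / (8 * pi))"] G(2,3) \<open>0 < e\<close> by auto
  note int = diff_square_integrable[OF _ f]
  have "integral {0..2*pi} (\<lambda>x. (\<beta> x - f x)\<^sup>2)
      \<le> integral {0..2*pi} (\<lambda>x. 2 * (G x - f x)\<^sup>2 + e / (4 * pi))"
  proof (intro integral_le integrable_add integrable_on_mult_right int G smooth_continuous_on \<beta>)
    fix x assume x: "x \<in> {0..2*pi}"
    have "(\<beta> x - G x)\<^sup>2 \<le> (sqrt (e / (8 * pi)))\<^sup>2"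
      using \<beta>e[OF x] by (simp add: abs_le_square_iff[symmetric] less_imp_le)
    then have "(\<beta> x - G x)\<^sup>2 \<le> e / (8 * pi)" using \<open>0 < e\<close> by simp
    moreover have "(\<beta> x - f x)\<^sup>2 \<le> 2 * (G x - f x)\<^sup>2 + 2 * (\<beta> x - G x)\<^sup>2"
      using zero_le_power2[of "(\<beta> x - G x) - (G x - f x)"] by (simp add: power2_eq_square algebra_simps)
    ultimately show "(\<beta> x - f x)\<^sup>2 \<le> 2 * (G x - f x)\<^sup>2 + e / (4 * pi)" by simp
  qed auto
  also have "\<dots> = 2 * integral {0..2*pi} (\<lambda>x. (G x - f x)\<^sup>2) + e / 2"
    using int[OF G(1)] by (subst Henstock_Kurzweil_Integration.integral_add) (auto intro!: integrable_on_mult_right)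
  also have "\<dots> < e" using Ge by simp
  finally show thesis using that \<beta> by blast
qed

section \<open>Arc length of a continuous curve of bounded variation\<close>

definition dyadic :: "real \<Rightarrow> nat \<Rightarrow> nat \<Rightarrow> real" where
  "dyadic T n j = T * real j / 2 ^ n"

definition truncate_to :: "real \<Rightarrow> real \<Rightarrow> real \<Rightarrow> real" where
  "truncate_to a b x = max a (min b x)"

text \<open>
  The length of the dyadic polygon restricted to the part of the curve between \<open>a\<close> and \<open>b\<close>. Truncating
  the nodes, instead of selecting those between \<open>a\<close> and \<open>b\<close>, keeps the index set fixed and makes the
  expression continuous in \<open>a\<close> and \<open>b\<close>.
\<close>

definition variation :: "(real \<Rightarrow> 'b::real_normed_vector) \<Rightarrow> real \<Rightarrow> nat \<Rightarrow> real \<Rightarrow> real \<Rightarrow> real" where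
  "variation f T n a b =
     (\<Sum>j<2 ^ n. norm (f (truncate_to a b (dyadic T n (Suc j))) - f (truncate_to a b (dyadic T n j))))"

lemma dyadic_0 [simp]: "dyadic T n 0 = 0"
  by (simp add: dyadic_def)

lemma dyadic_last [simp]: "dyadic T n (2 ^ n) = T"
  by (simp add: dyadic_def)

lemma dyadic_Suc_double: "dyadic T (Suc n) (2 * j) = dyadic T n j"
  by (simp add: dyadic_def)

lemma dyadic_mono: "0 < T \<Longrightarrow> i \<le> j \<Longrightarrow> dyadic T n i \<le> dyadic T n j"
  by (simp add: dyadic_def divide_right_mono)

lemma dyadic_range: "0 < T \<Longrightarrow> j \<le> 2 ^ n \<Longrightarrow> dyadic T n j \<in> {0..T}"
  using dyadic_mono[of T 0 j n] dyadic_mono[of T j "2 ^ n" n] by simp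

lemma dyadic_step: "dyadic T n (Suc j) - dyadic T n j = T / 2 ^ n"
  by (simp add: dyadic_def field_simps)

lemma dyadic_interval:
  assumes "0 < T" "u \<in> {0..T}"
  obtains j where "j < 2 ^ n" "dyadic T n j \<le> u" "u \<le> dyadic T n (Suc j)"
proof -
  define P where "P j \<longleftrightarrow> u \<le> dyadic T n (Suc j)" for j
  have "P (2 ^ n - 1)" using assms by (simp add: P_def)
  then have P: "P (LEAST j. P j)" by (rule LeastI)
  have le: "(LEAST j. P j) \<le> 2 ^ n - 1" using \<open>P (2 ^ n - 1)\<close> by (rule Least_le)
  have "dyadic T n (LEAST j. P j) \<le> u"
  proof (cases "LEAST j. P j")
    case 0
    then show ?thesis using assms by simp
  next
    case (Suc i)
    then have "\<not> P i" by (metis lessI not_less_Least)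
    then show ?thesis using Suc by (simp add: P_def)
  qed
  moreover have "(LEAST j. P j) < 2 ^ n"
    using le by (metis One_nat_def Suc_pred le_imp_less_Suc zero_less_numeral zero_less_power)
  ultimately show thesis using that P by (simp add: P_def)
qed

lemma eventually_dyadic_oscillation:
  fixes f :: "real \<Rightarrow> 'b::real_normed_vector"
  assumes f: "continuous_on {0..T} f" and "0 < e"
  shows "\<forall>\<^sub>F n in sequentially. \<forall>x\<in>{0..T}. \<forall>y\<in>{0..T}. \<bar>x - y\<bar> \<le> T / 2 ^ n \<longrightarrow> norm (f x - f y) \<le> e"
proof -
  have "uniformly_continuous_on {0..T} f"
    using f by (intro compact_uniformly_continuous) auto
  then obtain \<delta> where \<delta>: "0 < \<delta>" "\<And>x y. x \<in> {0..T} \<Longrightarrow> y \<in> {0..T} \<Longrightarrow> dist x y < \<delta> \<Longrightarrow> dist (f x) (f y) < e"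
    unfolding uniformly_continuous_on_def using \<open>0 < e\<close> by (metis dist_commute)
  have "(\<lambda>n. T * (1 / 2) ^ n) \<longlonglongrightarrow> T * 0"
    by (intro tendsto_intros LIMSEQ_power_zero) auto
  then have "\<forall>\<^sub>F n in sequentially. T * (1 / 2) ^ n < \<delta>"
    using \<delta>(1) by (auto intro: order_tendstoD)
  then show ?thesis
  proof eventually_elim
    case (elim n)
    show ?case
    proof (intro ballI impI)
      fix x y assume "x \<in> {0..T}" "y \<in> {0..T}" "\<bar>x - y\<bar> \<le> T / 2 ^ n"
      then show "norm (f x - f y) \<le> e"
        using \<delta>(2)[of x y] elim by (simp add: dist_norm power_divide)
    qed
  qed
qed

lemma sum_double: "(\<Sum>i<2 * n. h i) = (\<Sum>j<n. h (2 * j) + h (Suc (2 * j)))"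
  for h :: "nat \<Rightarrow> 'a::comm_monoid_add"
  by (induction n) (simp_all add: ac_simps)

lemma variation_mono: "variation f T n a b \<le> variation f T (Suc n) a b"
proof -
  let ?g = "\<lambda>x. f (truncate_to a b x)"
  have "norm (?g (dyadic T n (Suc j)) - ?g (dyadic T n j))
      \<le> norm (?g (dyadic T (Suc n) (Suc (2 * j))) - ?g (dyadic T (Suc n) (2 * j)))
       + norm (?g (dyadic T (Suc n) (Suc (Suc (2 * j)))) - ?g (dyadic T (Suc n) (Suc (2 * j))))" for j
  proof -
    have "dyadic T (Suc n) (2 * j) = dyadic T n j"
      "dyadic T (Suc n) (Suc (Suc (2 * j))) = dyadic T n (Suc j)"
      using dyadic_Suc_double[of T n j] dyadic_Suc_double[of T n "Suc j"] by simp_all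
    then show ?thesis
      using norm_triangle_ineq[of "?g (dyadic T (Suc n) (Suc (2 * j))) - ?g (dyadic T n j)"
          "?g (dyadic T n (Suc j)) - ?g (dyadic T (Suc n) (Suc (2 * j)))"]
      by (simp add: algebra_simps)
  qed
  then show ?thesis
    unfolding variation_def power_Suc sum_double by (intro sum_mono)
qed

lemma norm_diff_le_variation:
  assumes "0 < T" "0 \<le> a" "a \<le> b" "b \<le> T"
  shows "norm (f b - f a) \<le> variation f T n a b"
proof -
  let ?g = "\<lambda>j. f (truncate_to a b (dyadic T n j))"
  have "f b - f a = ?g (2 ^ n) - ?g 0"
    using assms by (simp add: truncate_to_def)
  also have "\<dots> = (\<Sum>j<2 ^ n. ?g (Suc j) - ?g j)"
    by (rule sum_lessThan_telescope[symmetric])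
  finally show ?thesis unfolding variation_def by (metis norm_sum)
qed

text \<open>
  Cutting at \<open>b\<close> splits the increment of \<open>f\<close> over any pair of nodes exactly into the increments over
  the two truncated pairs.
\<close>

lemma variation_subadditive:
  assumes "a \<le> b" "b \<le> d"
  shows "variation f T n a d \<le> variation f T n a b + variation f T n b d"
proof -
  have split: "f (truncate_to a b x) + f (truncate_to b d x) = f (truncate_to a d x) + f b" for x
    using assms by (cases "x \<le> b") (auto simp: truncate_to_def max_def min_def)
  have "norm (f (truncate_to a d y) - f (truncate_to a d x))
      \<le> norm (f (truncate_to a b y) - f (truncate_to a b x)) + norm (f (truncate_to b d y) - f (truncate_to b d x))" for x y
  proof -
    have "f (truncate_to a d y) - f (truncate_to a d x)
        = (f (truncate_to a b y) - f (truncate_to a b x)) + (f (truncate_to b d y) - f (truncate_to b d x))"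
      using split[of x] split[of y] by (simp add: algebra_simps)
    then show ?thesis by (metis norm_triangle_ineq)
  qed
  then show ?thesis
    unfolding variation_def sum.distrib[symmetric] by (intro sum_mono)
qed

text \<open>
  The splitting at \<open>b\<close> lengthens the polygon only at the one edge that has \<open>b\<close> in its interior.
\<close>

lemma variation_superadditive:
  assumes T: "0 < T" and ab: "0 \<le> a" "a \<le> b" "b \<le> d" "d \<le> T"
    and \<omega>: "\<And>x y. x \<in> {0..T} \<Longrightarrow> y \<in> {0..T} \<Longrightarrow> \<bar>x - y\<bar> \<le> T / 2 ^ n \<Longrightarrow> norm (f x - f y) \<le> \<omega>"
  shows "variation f T n a b + variation f T n b d \<le> variation f T n a d + 2 * \<omega>"
proof -
  let ?t = "dyadic T n"
  \<comment> \<open>the lengthening at the edge \<open>j\<close>\<close>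
  define e where "e j = norm (f (truncate_to a b (?t (Suc j))) - f (truncate_to a b (?t j)))
     + norm (f (truncate_to b d (?t (Suc j))) - f (truncate_to b d (?t j)))
     - norm (f (truncate_to a d (?t (Suc j))) - f (truncate_to a d (?t j)))" for j
  define J where "J = {j. j < 2 ^ n \<and> ?t j < b \<and> b < ?t (Suc j)}"
  have \<omega>0: "0 \<le> \<omega>"
    using \<omega>[of 0 0] T by simp
  have e1: "e j \<le> (if j \<in> J then 2 * \<omega> else 0)" if j: "j < 2 ^ n" for j
  proof (cases "j \<in> J")
    case True
    have "norm (f (truncate_to p q (?t (Suc j))) - f (truncate_to p q (?t j))) \<le> \<omega>" if "0 \<le> p" "p \<le> q" "q \<le> T" for p q
    proof (rule \<omega>)
      show "\<bar>truncate_to p q (?t (Suc j)) - truncate_to p q (?t j)\<bar> \<le> T / 2 ^ n"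
        using dyadic_step[of T n j] dyadic_mono[OF T, of j "Suc j" n] by (auto simp: truncate_to_def max_def min_def)
    qed (use that in \<open>auto simp: truncate_to_def\<close>)
    from this[of a b] this[of b d] True ab show ?thesis
      unfolding e_def by (smt (verit) norm_ge_zero)
  next
    case False
    then have "?t (Suc j) \<le> b \<or> b \<le> ?t j" using j by (auto simp: J_def)
    moreover have "?t j \<le> ?t (Suc j)" using dyadic_mono[OF T, of j "Suc j" n] by simp
    moreover have "truncate_to a b x = truncate_to a d x" "truncate_to b d x = b" if "x \<le> b" for x
      using that ab by (auto simp: truncate_to_def)
    moreover have "truncate_to b d x = truncate_to a d x" "truncate_to a b x = b" if "b \<le> x" for x
      using that ab by (auto simp: truncate_to_def)
    ultimately have "e j = 0"
      unfolding e_def by (smt (verit) diff_self norm_zero)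
    then show ?thesis using False by simp
  qed
  have J1: "i = j" if "i \<in> J" "j \<in> J" for i j
  proof (rule ccontr)
    assume "i \<noteq> j"
    then have "Suc i \<le> j \<or> Suc j \<le> i" by auto
    then show False
      using that dyadic_mono[OF T, of "Suc i" j n] dyadic_mono[OF T, of "Suc j" i n] by (auto simp: J_def)
  qed
  have "finite J" by (auto simp: J_def)
  then have "card J \<le> 1" using J1 by (auto simp: card_le_Suc0_iff_eq)
  have "(\<Sum>j<2 ^ n. e j) \<le> (\<Sum>j<2 ^ n. if j \<in> J then 2 * \<omega> else 0)"
    using e1 by (intro sum_mono) auto
  also have "\<dots> = (\<Sum>j\<in>J. 2 * \<omega>)"
  proof -
    have "{..<2 ^ n} \<inter> J = J" by (auto simp: J_def)
    then show ?thesis using sum.inter_restrict[of "{..<2 ^ n}" "\<lambda>_. 2 * \<omega>" J] by simp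
  qed
  also have "\<dots> \<le> 2 * \<omega>"
    using \<open>card J \<le> 1\<close> \<omega>0 mult_right_mono[of "real (card J)" 1 "2 * \<omega>"] by simp
  finally show ?thesis
    unfolding e_def sum_subtractf sum.distrib variation_def by simp
qed

text \<open>
  The dyadic lengths increase with \<open>n\<close> to a function \<open>W\<close>, which is additive by the two preceding
  lemmas. With \<open>s = W 0\<close>, additivity gives \<open>0 \<le> s x - variation f T n 0 x \<le> s T - variation f T n 0 T\<close>:
  the error at \<open>x\<close> is at most the error at the right end. So the convergence is uniform and \<open>s\<close> is
  continuous.
\<close>

lemma arc_length_function:
  fixes f :: "real \<Rightarrow> 'b::real_normed_vector"
  assumes T: "0 < T" and f: "continuous_on {0..T} f"
    and B: "\<And>n t. mono_on {..n} t \<Longrightarrow> t ` {..n} \<subseteq> {0..T} \<Longrightarrow> (\<Sum>i<n. norm (f (t (Suc i)) - f (t i))) \<le> B"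
  obtains s where "continuous_on {0..T} s" "s 0 = 0"
    "\<And>a b. 0 \<le> a \<Longrightarrow> a \<le> b \<Longrightarrow> b \<le> T \<Longrightarrow> norm (f b - f a) \<le> s b - s a"
    "(\<lambda>n. \<Sum>j<2 ^ n. norm (f (dyadic T n (Suc j)) - f (dyadic T n j))) \<longlonglongrightarrow> s T"
proof -
  let ?V = "variation f T"
  define W where "W a b = (SUP n. ?V n a b)" for a b
  have inc: "incseq (\<lambda>n. ?V n a b)" for a b
    by (intro incseq_SucI variation_mono)
  have VB: "?V n a b \<le> B" if "0 \<le> a" "a \<le> b" "b \<le> T" for n a b
    unfolding variation_def
  proof (rule B)
    show "mono_on {..2 ^ n} (\<lambda>j. truncate_to a b (dyadic T n j))"
      unfolding mono_on_def truncate_to_def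
      by (intro allI impI max.mono min.mono dyadic_mono[OF T] order_refl) auto
  qed (use that in \<open>auto simp: truncate_to_def\<close>)
  have bdd: "bdd_above (range (\<lambda>n. ?V n a b))" if "0 \<le> a" "a \<le> b" "b \<le> T" for a b
    using VB[OF that] by (intro bdd_aboveI2)
  have VW: "?V n a b \<le> W a b" if "0 \<le> a" "a \<le> b" "b \<le> T" for n a b
    unfolding W_def by (rule cSUP_upper[OF _ bdd[OF that]]) simp
  have lim: "(\<lambda>n. ?V n a b) \<longlonglongrightarrow> W a b" if "0 \<le> a" "a \<le> b" "b \<le> T" for a b
    unfolding W_def by (rule LIMSEQ_incseq_SUP[OF bdd[OF that] inc])
  have additive: "W a d = W a b + W b d" if ab: "0 \<le> a" "a \<le> b" "b \<le> d" "d \<le> T" for a b d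
  proof (rule antisym)
    have 1: "(\<lambda>n. ?V n a b + ?V n b d) \<longlonglongrightarrow> W a b + W b d"
      using ab by (intro tendsto_add lim) auto
    show "W a d \<le> W a b + W b d"
      using ab by (intro LIMSEQ_le[OF lim 1]) (auto intro: variation_subadditive)
    show "W a b + W b d \<le> W a d"
    proof (rule field_le_epsilon)
      fix e :: real assume "0 < e"
      have "0 < e / 2" using \<open>0 < e\<close> by simp
      from eventually_dyadic_oscillation[OF f this]
      have "\<forall>\<^sub>F n in sequentially. ?V n a b + ?V n b d \<le> W a d + e"
      proof eventually_elim
        case (elim n)
        have "?V n a b + ?V n b d \<le> ?V n a d + 2 * (e / 2)"
        proof (rule variation_superadditive[OF T ab])
          fix x y assume "x \<in> {0..T}" "y \<in> {0..T}" "\<bar>x - y\<bar> \<le> T / 2 ^ n"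
          then show "norm (f x - f y) \<le> e / 2" using elim by blast
        qed
        then show ?case using VW[of a d n] ab by linarith
      qed
      then show "W a b + W b d \<le> W a d + e"
        by (intro tendsto_upperbound[OF 1]) auto
    qed
  qed
  define s where "s = W 0"
  show thesis
  proof (rule that[of s])
    show fs: "norm (f b - f a) \<le> s b - s a" if "0 \<le> a" "a \<le> b" "b \<le> T" for a b
      using additive[of 0 a b] norm_diff_le_variation[OF T that, of f 0] VW[OF that, of 0] that
      by (simp add: s_def)
    show "s 0 = 0"
      using additive[of 0 0 0] T by (simp add: s_def)
    have V0T: "?V n 0 T = (\<Sum>j<2 ^ n. norm (f (dyadic T n (Suc j)) - f (dyadic T n j)))" for n
      unfolding variation_def
    proof (intro sum.cong refl)
      fix j :: nat assume "j \<in> {..<2 ^ n}"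
      then have "dyadic T n j \<in> {0..T}" "dyadic T n (Suc j) \<in> {0..T}"
        by (auto intro!: dyadic_range[OF T] simp del: atLeastAtMost_iff)
      then show "norm (f (truncate_to 0 T (dyadic T n (Suc j))) - f (truncate_to 0 T (dyadic T n j)))
          = norm (f (dyadic T n (Suc j)) - f (dyadic T n j))"
        by (simp add: truncate_to_def)
    qed
    show "(\<lambda>n. \<Sum>j<2 ^ n. norm (f (dyadic T n (Suc j)) - f (dyadic T n j))) \<longlonglongrightarrow> s T"
      using lim[of 0 T] T unfolding V0T s_def by simp
    have "uniform_limit {0..T} (\<lambda>n x. ?V n 0 x) s sequentially"
    proof (rule uniform_limitI)
      fix e :: real assume "0 < e"
      then have "\<forall>\<^sub>F n in sequentially. W 0 T - e < ?V n 0 T"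
        using lim[of 0 T] T by (auto intro: order_tendstoD)
      then show "\<forall>\<^sub>F n in sequentially. \<forall>x\<in>{0..T}. dist (?V n 0 x) (s x) < e"
      proof eventually_elim
        case (elim n)
        show ?case
        proof
          fix x assume x: "x \<in> {0..T}"
          have "?V n 0 T \<le> ?V n 0 x + ?V n x T" using x by (intro variation_subadditive) auto
          moreover have "?V n x T \<le> W x T" "?V n 0 x \<le> W 0 x" using x by (auto intro: VW)
          moreover have "W 0 T = W 0 x + W x T" using additive[of 0 x T] x by simp
          ultimately show "dist (?V n 0 x) (s x) < e"
            using elim by (simp add: s_def dist_real_def)
        qed
      qed
    qed
    moreover have "continuous_on {0..T} (\<lambda>x. ?V n 0 x)" for n
      unfolding variation_def
      by (intro continuous_intros continuous_on_compose2[OF f])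
        (auto simp: truncate_to_def intro!: continuous_intros continuous_on_max continuous_on_min)
    ultimately show "continuous_on {0..T} s"
      by (intro uniform_limit_theorem[where F = sequentially]) auto
  qed
qed

section \<open>Directions of the inscribed polygons\<close>

lemma simple_integrable:
  fixes f :: "real \<Rightarrow> 'b::euclidean_space"
  assumes "simple_function borel f" shows "f integrable_on {a..b}"
  using assms
  by (intro bounded_borel_integrable borel_measurable_simple_function)
    (auto simp: simple_function_def finite_imp_bounded)

text \<open>
  The half-open intervals are disjoint and may be empty, as two nodes coincide where the curve rests.
\<close>

definition step :: "(nat \<Rightarrow> real) \<Rightarrow> nat \<Rightarrow> (nat \<Rightarrow> 'b::real_vector) \<Rightarrow> real \<Rightarrow> 'b" where
  "step x N v y = (\<Sum>j<N. indicator {x j<..x (Suc j)} y *\<^sub>R v j)"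

lemma step_eq:
  assumes x: "mono x" and j: "j < N" and y: "y \<in> {x j<..x (Suc j)}"
  shows "step x N v y = v j"
proof -
  have "indicator {x i<..x (Suc i)} y *\<^sub>R v i = (if i = j then v j else 0)" for i
  proof (cases "i = j")
    case False
    then have "Suc i \<le> j \<or> Suc j \<le> i" by auto
    then have "y \<notin> {x i<..x (Suc i)}"
      using y monoD[OF x, of "Suc i" j] monoD[OF x, of "Suc j" i] by auto
    then show ?thesis using False by simp
  qed (use y in simp)
  then show ?thesis using j by (simp add: step_def)
qed

lemma simple_function_step:
  fixes v :: "nat \<Rightarrow> 'b::real_normed_vector"
  shows "simple_function borel (step x N v)"
  unfolding step_def
  by (intro simple_function_sum simple_function_compose1[where g = "\<lambda>r. r *\<^sub>R _"] simple_function_indicator) auto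

lemma has_integral_nodes:
  fixes h :: "real \<Rightarrow> 'b::euclidean_space"
  assumes x: "mono x" and h: "\<And>j. j < N \<Longrightarrow> (h has_integral I j) {x j..x (Suc j)}"
  shows "(h has_integral (\<Sum>j<N. I j)) {x 0..x N}"
  using h
proof (induction N)
  case (Suc N)
  then have "(h has_integral (\<Sum>j<N. I j)) {x 0..x N}" "(h has_integral I N) {x N..x (Suc N)}"
    by auto
  from has_integral_combine[OF _ _ this] show ?case
    using monoD[OF x] by simp
qed (simp add: has_integral_refl)

lemma has_integral_const_Ioc:
  fixes h :: "real \<Rightarrow> 'b::euclidean_space"
  assumes "a \<le> b" and "\<And>y. y \<in> {a<..b} \<Longrightarrow> h y = c"
  shows "(h has_integral (b - a) *\<^sub>R c) {a..b}"
proof -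
  have "((\<lambda>_. c) has_integral (b - a) *\<^sub>R c) {a..b}"
    using has_integral_const_real[of c a b] assms(1) by simp
  then show ?thesis
    by (rule has_integral_spike_finite[of "{a}", rotated 2]) (use assms(2) in auto)
qed

lemma mono_dyadic_comp:
  assumes "0 < T" "\<And>x y. 0 \<le> x \<Longrightarrow> x \<le> y \<Longrightarrow> y \<le> T \<Longrightarrow> \<sigma> x \<le> \<sigma> y"
  shows "mono (\<lambda>j. \<sigma> (dyadic T n (min (2 ^ n) j)))"
proof (rule monoI)
  fix i j :: nat assume "i \<le> j"
  then have "dyadic T n (min (2 ^ n) i) \<le> dyadic T n (min (2 ^ n) j)"
    by (intro dyadic_mono[OF assms(1)]) auto
  then show "\<sigma> (dyadic T n (min (2 ^ n) i)) \<le> \<sigma> (dyadic T n (min (2 ^ n) j))"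
    using dyadic_range[OF assms(1), of "min (2 ^ n) i" n] dyadic_range[OF assms(1), of "min (2 ^ n) j" n]
    by (intro assms(2)) auto
qed

text \<open>
  The step function \<open>d n\<close> lists the slopes of the \<open>n\<close>-th dyadic polygon over arc length, so \<open>d m\<close> is
  the orthogonal projection of \<open>d n\<close> onto the step functions of level \<open>m \<le> n\<close>. Pythagoras turns the
  convergence of the energies \<open>\<integral> |d n|\<^sup>2\<close> into convergence in square mean, and the energies are squeezed
  between \<open>2 len n - T\<close> and \<open>T\<close>, where \<open>l len n\<close> is the length of the polygon.
\<close>

lemma chord_directions:
  fixes f :: "real \<Rightarrow> 'b::euclidean_space"
  assumes T: "0 < T" and l: "0 < l" and f: "continuous_on {0..T} f"
    and \<sigma>: "\<sigma> 0 = 0" "\<sigma> T = T"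
    and lip: "\<And>a b. 0 \<le> a \<Longrightarrow> a \<le> b \<Longrightarrow> b \<le> T \<Longrightarrow> norm (f b - f a) \<le> l * (\<sigma> b - \<sigma> a)"
    and lim: "(\<lambda>n. \<Sum>j<2 ^ n. norm (f (dyadic T n (Suc j)) - f (dyadic T n j))) \<longlonglongrightarrow> l * T"
  obtains d :: "nat \<Rightarrow> real \<Rightarrow> 'b" and \<eta> where
    "\<And>n. simple_function borel (d n)" "\<And>n y. norm (d n y) \<le> 1" "\<eta> \<longlonglongrightarrow> 0"
    "\<And>n. integral {0..T} (\<lambda>y. 1 - norm (d n y)) \<le> \<eta> n"
    "\<And>m n. m \<le> n \<Longrightarrow> integral {0..T} (\<lambda>y. (norm (d n y - d m y))\<^sup>2) \<le> \<eta> m"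
    "\<And>e. 0 < e \<Longrightarrow> \<forall>\<^sub>F n in sequentially. \<forall>t\<in>{0..T}. norm (f 0 + l *\<^sub>R integral {0..\<sigma> t} (d n) - f t) \<le> e"
proof -
  have \<sigma>_mono: "\<sigma> a \<le> \<sigma> b" if "0 \<le> a" "a \<le> b" "b \<le> T" for a b
    using lip[OF that] l norm_ge_zero[of "f b - f a"] by (smt (verit) mult_pos_neg)
  \<comment> \<open>constant beyond the last node, so that \<open>x n\<close> below is monotone on all of \<open>nat\<close>\<close>
  define t where "t n j = dyadic T n (min (2 ^ n) j)" for n j
  define x where "x n j = \<sigma> (t n j)" for n j
  define v where "v n j = (1 / (l * (x n (Suc j) - x n j))) *\<^sub>R (f (t n (Suc j)) - f (t n j))" for n j
  define d where "d n = step (x n) (2 ^ n) (v n)" for n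
  have xm: "mono (x n)" for n
    unfolding x_def t_def by (rule mono_dyadic_comp[OF T \<sigma>_mono])
  have x0: "x n 0 = 0" and xT: "x n (2 ^ n) = T" for n
    by (simp_all add: x_def t_def \<sigma>)
  have tr: "t n j \<in> {0..T}" for n j
    unfolding t_def by (rule dyadic_range[OF T]) simp
  have tm: "t n i \<le> t n j" if "i \<le> j" for n i j
    unfolding t_def using that by (intro dyadic_mono[OF T]) auto
  have chord: "norm (f (t n (Suc j)) - f (t n j)) \<le> l * (x n (Suc j) - x n j)" for n j
    unfolding x_def using tr tm[of j "Suc j"] by (intro lip) auto
  have v1: "norm (v n j) \<le> 1" for n j
    using chord[of n j] l monoD[OF xm, of j "Suc j" n]
    by (cases "x n (Suc j) = x n j") (simp_all add: v_def divide_le_eq)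
  have vx: "(x n (Suc j) - x n j) *\<^sub>R v n j = (1 / l) *\<^sub>R (f (t n (Suc j)) - f (t n j))" for n j
    using chord[of n j] l by (cases "x n (Suc j) = x n j") (simp_all add: v_def)
  have dv: "d n y = v n j" if "j < 2 ^ n" "y \<in> {x n j<..x n (Suc j)}" for n j y
    unfolding d_def by (rule step_eq[OF xm that])
  have simple: "simple_function borel (d n)" for n
    unfolding d_def by (rule simple_function_step)
  have d1: "norm (d n y) \<le> 1" for n y
  proof (cases "\<exists>j<2 ^ n. y \<in> {x n j<..x n (Suc j)}")
    case True
    then show ?thesis using dv v1 by metis
  next
    case False
    then have "d n y = 0"
      unfolding d_def step_def by (intro sum.neutral) auto
    then show ?thesis by simp
  qed
  have int_g: "((\<lambda>y. g (d n y)) has_integral (\<Sum>j<2 ^ n. (x n (Suc j) - x n j) *\<^sub>R g (v n j))) {0..T}"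
    for g :: "'b \<Rightarrow> real" and n
    unfolding x0[of n, symmetric] xT[of n, symmetric]
    using dv monoD[OF xm] by (intro has_integral_nodes[OF xm] has_integral_const_Ioc) (auto simp: xT)
  have int_d: "(d n has_integral (1 / l) *\<^sub>R (f (t n (i + k)) - f (t n i))) {x n i..x n (i + k)}"
    if "i + k \<le> 2 ^ n" for n i k
  proof -
    have "(d n has_integral (\<Sum>j<k. (x n (Suc (i + j)) - x n (i + j)) *\<^sub>R v n (i + j))) {x n (i + 0)..x n (i + k)}"
    proof (rule has_integral_nodes[where x = "\<lambda>j. x n (i + j)"])
      show "mono (\<lambda>j. x n (i + j))" using monoD[OF xm] by (auto intro!: monoI)
      show "(d n has_integral (x n (Suc (i + j)) - x n (i + j)) *\<^sub>R v n (i + j)) {x n (i + j)..x n (i + Suc j)}"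
        if "j < k" for j
        using has_integral_const_Ioc[of "x n (i + j)" "x n (Suc (i + j))" "d n" "v n (i + j)"]
          dv[of "i + j" n] monoD[OF xm, of "i + j" "Suc (i + j)" n] that \<open>i + k \<le> 2 ^ n\<close> by simp
    qed
    moreover have "(\<Sum>j<k. (x n (Suc (i + j)) - x n (i + j)) *\<^sub>R v n (i + j)) = (1 / l) *\<^sub>R (f (t n (i + k)) - f (t n i))"
      unfolding vx scaleR_right.sum[symmetric]
      using sum_lessThan_telescope[of "\<lambda>j. f (t n (i + j))" k] by simp
    ultimately show ?thesis by simp
  qed
  define len where "len n = (\<Sum>j<2 ^ n. norm (f (dyadic T n (Suc j)) - f (dyadic T n j))) / l" for n
  have int_norm: "((\<lambda>y. norm (d n y)) has_integral len n) {0..T}" for n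
  proof -
    have "(x n (Suc j) - x n j) *\<^sub>R norm (v n j) = norm (f (dyadic T n (Suc j)) - f (dyadic T n j)) / l"
      if "j < 2 ^ n" for j
    proof -
      have "(x n (Suc j) - x n j) *\<^sub>R norm (v n j) = norm ((x n (Suc j) - x n j) *\<^sub>R v n j)"
        using monoD[OF xm, of j "Suc j" n] by simp
      then show ?thesis
        unfolding vx using l that by (simp add: t_def min_absorb2)
    qed
    then show ?thesis
      using int_g[of norm n] by (simp add: len_def sum_divide_distrib)
  qed
  define \<eta> where "\<eta> n = 2 * (T - len n)" for n
  have \<eta>0: "\<eta> \<longlonglongrightarrow> 0"
  proof -
    have "(\<lambda>n. 2 * (T - len n)) \<longlonglongrightarrow> 2 * (T - l * T / l)"
      unfolding len_def using l by (intro tendsto_intros lim) auto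
    then show ?thesis using l by (simp add: \<eta>_def[abs_def])
  qed
  have one_minus: "((\<lambda>y. 1 - norm (d n y)) has_integral T - len n) {0..T}" for n
    using has_integral_diff[OF has_integral_const_real[of 1 0 T] int_norm[of n]] T by simp
  have len_le: "len n \<le> T" for n
    using has_integral_nonneg[OF one_minus[of n]] d1 by auto
  have energy: "integral {0..T} (\<lambda>y. (norm (d n y - d m y))\<^sup>2) \<le> \<eta> m" if "m \<le> n" for m n
  proof -
    define E where "E k = integral {0..T} (\<lambda>y. (norm (d k y))\<^sup>2)" for k
    have intE: "(\<lambda>y. (norm (d k y))\<^sup>2) integrable_on {0..T}" for k
      using has_integral_integrable[OF int_g[of "\<lambda>w. (norm w)\<^sup>2" k]] .
    have "E n \<le> integral {0..T} (\<lambda>y. 1)"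
      unfolding E_def using intE d1 by (intro integral_le) (auto intro: power_le_one)
    then have En: "E n \<le> T" using T by simp
    have "integral {0..T} (\<lambda>y. 2 * norm (d m y) - 1) \<le> E m"
      unfolding E_def
    proof (intro integral_le intE)
      show "(\<lambda>y. 2 * norm (d m y) - 1) integrable_on {0..T}"
        using has_integral_integrable[OF int_norm[of m]] by (intro integrable_diff integrable_on_mult_right) auto
      fix y show "2 * norm (d m y) - 1 \<le> (norm (d m y))\<^sup>2"
        using zero_le_power2[of "norm (d m y) - 1"] by (simp add: power2_diff)
    qed
    moreover have "((\<lambda>y. 2 * norm (d m y) - 1) has_integral 2 * len m - T) {0..T}"
      using has_integral_diff[OF has_integral_mult_right[OF int_norm[of m], of 2] has_integral_const_real[of 1 0 T]] T
      by simp
    ultimately have Em: "2 * len m - T \<le> E m" by (simp add: integral_unique)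
    \<comment> \<open>over a step of level \<open>m\<close> the integral of \<open>d n\<close> telescopes to the chord of that step\<close>
    have cross: "((\<lambda>y. d n y \<bullet> d m y) has_integral E m) {0..T}"
    proof -
      obtain k where k: "n = m + k" using \<open>m \<le> n\<close> le_Suc_ex by blast
      have t_eq: "t m j = t n (j * 2 ^ k)" for j
      proof -
        have "min (2 ^ n) (j * 2 ^ k) = min (2 ^ m) j * (2 ^ k :: nat)"
          by (cases "j \<le> 2 ^ m") (simp_all add: k power_add min_def)
        then show ?thesis by (simp add: t_def dyadic_def k power_add)
      qed
      have "((\<lambda>y. d n y \<bullet> d m y) has_integral (x m (Suc j) - x m j) *\<^sub>R (norm (v m j))\<^sup>2) {x m j..x m (Suc j)}"
        if j: "j < 2 ^ m" for j
      proof -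
        have "Suc j * 2 ^ k \<le> 2 ^ m * 2 ^ k" using j by (intro mult_right_mono) auto
        then have "j * 2 ^ k + 2 ^ k \<le> 2 ^ n" by (simp add: k power_add)
        from int_d[OF this]
        have "(d n has_integral (1 / l) *\<^sub>R (f (t m (Suc j)) - f (t m j))) {x m j..x m (Suc j)}"
          by (simp add: t_eq x_def algebra_simps)
        then have "(d n has_integral (x m (Suc j) - x m j) *\<^sub>R v m j) {x m j..x m (Suc j)}"
          by (simp add: vx)
        from has_integral_linear[OF this bounded_linear_inner_left[of "v m j"]]
        have "((\<lambda>y. d n y \<bullet> v m j) has_integral (x m (Suc j) - x m j) *\<^sub>R (norm (v m j))\<^sup>2) {x m j..x m (Suc j)}"
          by (simp add: o_def power2_norm_eq_inner)
        then show ?thesis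
          by (rule has_integral_spike_finite[of "{x m j}", rotated 2]) (use dv[OF j] in auto)
      qed
      from has_integral_nodes[OF xm this, of "2 ^ m"]
      have "((\<lambda>y. d n y \<bullet> d m y) has_integral (\<Sum>j<2 ^ m. (x m (Suc j) - x m j) *\<^sub>R (norm (v m j))\<^sup>2)) {0..T}"
        by (simp add: x0 xT)
      moreover have "E m = (\<Sum>j<2 ^ m. (x m (Suc j) - x m j) *\<^sub>R (norm (v m j))\<^sup>2)"
        unfolding E_def using int_g[of "\<lambda>w. (norm w)\<^sup>2" m] by (rule integral_unique)
      ultimately show ?thesis by simp
    qed
    have "((\<lambda>y. ((norm (d n y))\<^sup>2 - 2 * (d n y \<bullet> d m y)) + (norm (d m y))\<^sup>2) has_integral (E n - 2 * E m) + E m) {0..T}"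
      unfolding E_def
      by (intro has_integral_add has_integral_diff has_integral_mult_right cross[unfolded E_def]
          integrable_integral intE)
    moreover have "((norm (d n y))\<^sup>2 - 2 * (d n y \<bullet> d m y)) + (norm (d m y))\<^sup>2 = (norm (d n y - d m y))\<^sup>2" for y
      by (simp add: power2_norm_eq_inner inner_diff inner_commute)
    ultimately have "integral {0..T} (\<lambda>y. (norm (d n y - d m y))\<^sup>2) = E n - E m"
      by (simp add: integral_unique)
    then show ?thesis using En Em by (simp add: \<eta>_def)
  qed
  have unif: "\<forall>\<^sub>F n in sequentially. \<forall>u\<in>{0..T}. norm (f 0 + l *\<^sub>R integral {0..\<sigma> u} (d n) - f u) \<le> e" if "0 < e" for e
  proof -
    have "0 < e / 2" using \<open>0 < e\<close> by simp
    from eventually_dyadic_oscillation[OF f this] show ?thesis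
    proof eventually_elim
      case (elim n)
      show ?case
      proof
        fix u assume u: "u \<in> {0..T}"
        obtain j where j': "j < 2 ^ n" "dyadic T n j \<le> u" "u \<le> dyadic T n (Suc j)"
          using dyadic_interval[OF T u] .
        then have j: "j < 2 ^ n" "t n j \<le> u" "u \<le> t n (Suc j)"
          by (simp_all add: t_def min_absorb2)
        have step: "t n (Suc j) - t n j = T / 2 ^ n"
          using j(1) dyadic_step[of T n j] by (simp add: t_def min_absorb2)
        have f1: "norm (f (t n j) - f u) \<le> e / 2"
          using elim tr[of n j] u j step by (auto simp: abs_if)
        have f2: "norm (f (t n (Suc j)) - f (t n j)) \<le> e / 2"
          using elim tr[of n j] tr[of n "Suc j"] tm[of j "Suc j" n] step by (auto simp: abs_if)
        have xu: "x n j \<le> \<sigma> u" "\<sigma> u \<le> x n (Suc j)"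
          unfolding x_def using u j tr[of n j] tr[of n "Suc j"] by (auto intro: \<sigma>_mono)
        have "(d n has_integral (1 / l) *\<^sub>R (f (t n j) - f (t n 0))) {0..x n j}"
          using int_d[of 0 j n] j(1) by (simp add: x0)
        moreover have "(d n has_integral (\<sigma> u - x n j) *\<^sub>R v n j) {x n j..\<sigma> u}"
          using xu dv[OF j(1)] by (intro has_integral_const_Ioc) auto
        ultimately have "(d n has_integral (1 / l) *\<^sub>R (f (t n j) - f (t n 0)) + (\<sigma> u - x n j) *\<^sub>R v n j) {0..\<sigma> u}"
          using xu monoD[OF xm, of 0 j n] x0[of n] by (intro has_integral_combine[of 0 "x n j" "\<sigma> u"]) auto
        then have eq: "f 0 + l *\<^sub>R integral {0..\<sigma> u} (d n) - f u = (f (t n j) - f u) + (l * (\<sigma> u - x n j)) *\<^sub>R v n j"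
          using l by (simp add: integral_unique t_def scaleR_add_right)
        have "norm ((l * (\<sigma> u - x n j)) *\<^sub>R v n j) \<le> e / 2"
        proof -
          have "norm ((l * (\<sigma> u - x n j)) *\<^sub>R v n j) = l * ((\<sigma> u - x n j) * norm (v n j))"
            using xu l by (simp add: abs_mult)
          also have "\<dots> \<le> l * ((x n (Suc j) - x n j) * norm (v n j))"
            using xu l by (intro mult_left_mono mult_right_mono) auto
          also have "\<dots> = l * norm ((x n (Suc j) - x n j) *\<^sub>R v n j)"
            using xu by simp
          also have "\<dots> = norm (f (t n (Suc j)) - f (t n j))"
            unfolding vx using l by simp
          finally show ?thesis using f2 by simp
        qed
        then show "norm (f 0 + l *\<^sub>R integral {0..\<sigma> u} (d n) - f u) \<le> e"
          unfolding eq using f1 norm_triangle_ineq[of "f (t n j) - f u" "(l * (\<sigma> u - x n j)) *\<^sub>R v n j"]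
          by linarith
      qed
    qed
  qed
  show thesis
  proof (rule that[of d \<eta>])
    show "integral {0..T} (\<lambda>y. 1 - norm (d n y)) \<le> \<eta> n" for n
      using integral_unique[OF one_minus[of n]] len_le[of n] by (simp add: \<eta>_def)
  qed (use simple d1 \<eta>0 energy unif in auto)
qed

section \<open>Angles of the directions\<close>

lemma norm_unit_vec_diff_eq: "norm (unit_vec a - unit_vec b) = 2 * \<bar>sin ((a - b) / 2)\<bar>"
proof (rule power2_eq_imp_eq)
  have "(norm (unit_vec a - unit_vec b))\<^sup>2 = (cos a - cos b)\<^sup>2 + (sin a - sin b)\<^sup>2"
    using norm_unit_comb[of "cos a - cos b" "sin a - sin b"]
    by (simp add: unit_vec_def algebra_simps)
  also have "\<dots> = ((cos a)\<^sup>2 + (sin a)\<^sup>2) + ((cos b)\<^sup>2 + (sin b)\<^sup>2) - 2 * cos (a - b)"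
    by (simp add: cos_diff power2_diff algebra_simps)
  also have "\<dots> = 2 - 2 * cos (2 * ((a - b) / 2))"
    by (simp add: diff_divide_distrib)
  also have "\<dots> = (2 * \<bar>sin ((a - b) / 2)\<bar>)\<^sup>2"
    unfolding cos_double_sin by (simp add: power_mult_distrib)
  finally show "(norm (unit_vec a - unit_vec b))\<^sup>2 = (2 * \<bar>sin ((a - b) / 2)\<bar>)\<^sup>2" .
qed auto

text \<open>
  With \<open>y = (a - b) / 2\<close> this is \<open>\<bar>y\<bar> \<le> 2 \<bar>sin y\<bar>\<close> for \<open>\<bar>y\<bar> \<le> \<pi>/2\<close>, which follows from
  \<open>sin y = 2 tan (y/2) cos\<^sup>2 (y/2)\<close>, where \<open>tan\<close> exceeds its argument and \<open>2 cos\<^sup>2 (y/2) = 1 + cos y \<ge> 1\<close>.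
\<close>

lemma angle_diff_le_chord:
  assumes "\<bar>a - b\<bar> \<le> pi"
  shows "\<bar>a - b\<bar> \<le> 2 * norm (unit_vec a - unit_vec b)"
proof -
  define y where "y = (a - b) / 2"
  have y: "\<bar>y\<bar> \<le> pi / 2" using assms by (simp add: y_def)
  have "\<bar>y\<bar> / 2 \<le> \<bar>sin y\<bar>"
  proof -
    have h: "\<bar>y / 2\<bar> < pi / 2" using y pi_gt_zero by linarith
    have c: "0 < cos (y / 2)" using h by (intro cos_gt_zero_pi) auto
    have "0 \<le> cos y" using y by (intro cos_ge_zero) auto
    then have "1 / 2 \<le> (cos (y / 2))\<^sup>2"
      using cos_double_cos[of "y / 2"] by simp
    have "\<bar>y / 2\<bar> * (2 * (1 / 2)) \<le> \<bar>tan (y / 2)\<bar> * (2 * (cos (y / 2))\<^sup>2)"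
      using abs_tan_ge[OF h] \<open>1 / 2 \<le> (cos (y / 2))\<^sup>2\<close> by (intro mult_mono) auto
    also have "\<dots> = \<bar>2 * sin (y / 2) * cos (y / 2)\<bar>"
      using c by (simp add: tan_def abs_mult power2_eq_square)
    also have "\<dots> = \<bar>sin y\<bar>" using sin_double[of "y / 2"] by simp
    finally show ?thesis by simp
  qed
  then show ?thesis
    unfolding norm_unit_vec_diff_eq y_def[symmetric] by (simp add: y_def)
qed

lemma angle_near_exists: "\<exists>b. \<bar>b - a\<bar> \<le> pi \<and> norm w *\<^sub>R unit_vec b = w"
proof -
  define \<theta> where "\<theta> = Arg (Complex (w $ 1) (w $ 2))"
  have n: "cmod (Complex (w $ 1) (w $ 2)) = norm w"
    by (simp add: norm_vec_def L2_set_def sum_2 cmod_def)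
  have "norm w * cos \<theta> = w $ 1" "norm w * sin \<theta> = w $ 2"
    using rcis_cmod_Arg[of "Complex (w $ 1) (w $ 2)"] unfolding n \<theta>_def[symmetric]
    by (auto simp: complex_eq_iff)
  then have \<theta>: "norm w *\<^sub>R unit_vec \<theta> = w"
    by (simp add: vec_eq_iff forall_2 unit_vec_def axis_def)
  define k where "k = round ((a - \<theta>) / (2 * pi))"
  have "\<bar>of_int k - (a - \<theta>) / (2 * pi)\<bar> * (2 * pi) \<le> 1 / 2 * (2 * pi)"
    unfolding k_def by (intro mult_right_mono of_int_round_abs_le) auto
  then have "\<bar>(of_int k - (a - \<theta>) / (2 * pi)) * (2 * pi)\<bar> \<le> pi" by (simp add: abs_mult)
  moreover have "(of_int k - (a - \<theta>) / (2 * pi)) * (2 * pi) = \<theta> + 2 * pi * of_int k - a"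
    by (simp add: left_diff_distrib diff_divide_distrib)
  ultimately have "\<bar>\<theta> + 2 * pi * of_int k - a\<bar> \<le> pi" by simp
  moreover have "unit_vec (\<theta> + 2 * pi * of_int k) = unit_vec \<theta>"
    by (rule periodic_int) simp
  ultimately show ?thesis using \<theta> by metis
qed

text \<open>
  The equation for \<open>w\<close> is stated without division, so that any angle will do when \<open>w = 0\<close>.
\<close>

definition angle_near :: "real \<Rightarrow> real ^ 2 \<Rightarrow> real" where
  "angle_near a w = (SOME b. \<bar>b - a\<bar> \<le> pi \<and> norm w *\<^sub>R unit_vec b = w)"

lemma angle_near:
  "\<bar>angle_near a w - a\<bar> \<le> pi" "norm w *\<^sub>R unit_vec (angle_near a w) = w"
  using someI_ex[OF angle_near_exists[of a w]] by (auto simp: angle_near_def)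

lemma fast_subsequence:
  fixes \<eta> :: "nat \<Rightarrow> real"
  assumes "\<eta> \<longlonglongrightarrow> 0" and "\<And>k. 0 < e k"
  obtains r :: "nat \<Rightarrow> nat" where "strict_mono r" "\<And>k. \<eta> (r k) \<le> e k"
proof -
  have "\<exists>N. \<forall>n\<ge>N. \<eta> n < e k" for k
    using order_tendstoD(2)[OF assms(1) assms(2)[of k]] by (simp add: eventually_sequentially)
  then obtain N where N: "\<And>k n. N k \<le> n \<Longrightarrow> \<eta> n < e k" by metis
  define r where "r k = k + (\<Sum>i\<le>k. N i)" for k
  have "strict_mono r" by (rule strict_monoI_Suc) (simp add: r_def)
  moreover have "N k \<le> r k" for k
    unfolding r_def by (simp add: lessThan_Suc_atMost[symmetric] trans_le_add2)
  ultimately show thesis using that N less_imp_le by metis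
qed

lemma square_sum3_le: "(x + y + z)\<^sup>2 \<le> 3 * (x\<^sup>2 + y\<^sup>2 + z\<^sup>2)" for x y z :: real
  using zero_le_power2[of "x - y"] zero_le_power2[of "y - z"] zero_le_power2[of "x - z"]
  by (simp add: power2_eq_square algebra_simps)

text \<open>
  The unit vector at angle \<open>a\<close> differs from \<open>d\<close> by exactly \<open>1 - norm d\<close>.
\<close>

lemma angle_increment_le:
  assumes "norm d \<le> 1" "norm d' \<le> 1" "norm d *\<^sub>R unit_vec a = d" "norm d' *\<^sub>R unit_vec a' = d'" "\<bar>a' - a\<bar> \<le> pi"
  shows "(a' - a)\<^sup>2 \<le> 12 * ((1 - norm d') + (norm (d' - d))\<^sup>2 + (1 - norm d))"
proof -
  have u: "norm (unit_vec b - w) = 1 - norm w" if "norm w \<le> 1" "norm w *\<^sub>R unit_vec b = w" for b w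
  proof -
    have "unit_vec b - w = (1 - norm w) *\<^sub>R unit_vec b"
      using that(2) by (simp add: scaleR_diff_left)
    then show ?thesis using that(1) by simp
  qed
  have sq: "(1 - norm w)\<^sup>2 \<le> 1 - norm w" if "norm w \<le> 1" for w :: "real ^ 2"
    using that mult_left_le_one_le[of "1 - norm w" "1 - norm w"] by (simp add: power2_eq_square)
  have "norm (unit_vec a' - unit_vec a) \<le> norm (unit_vec a' - d') + norm (d' - d) + norm (d - unit_vec a)"
    using norm_triangle_ineq[of "unit_vec a' - d'" "d' - d"]
      norm_triangle_ineq[of "unit_vec a' - d" "d - unit_vec a"] by simp
  also have "\<dots> = (1 - norm d') + norm (d' - d) + (1 - norm d)"
    using u assms by (simp add: norm_minus_commute)
  finally have "\<bar>a' - a\<bar> \<le> 2 * ((1 - norm d') + norm (d' - d) + (1 - norm d))"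
    using angle_diff_le_chord[OF assms(5)] by simp
  then have "(a' - a)\<^sup>2 \<le> (2 * ((1 - norm d') + norm (d' - d) + (1 - norm d)))\<^sup>2"
    by (metis abs_ge_zero power2_abs power_mono)
  also have "\<dots> \<le> 4 * (3 * ((1 - norm d')\<^sup>2 + (norm (d' - d))\<^sup>2 + (1 - norm d)\<^sup>2))"
    unfolding power_mult_distrib
    using square_sum3_le[of "1 - norm d'" "norm (d' - d)" "1 - norm d"]
    by (intro mult_mono) auto
  also have "\<dots> \<le> 4 * (3 * ((1 - norm d') + (norm (d' - d))\<^sup>2 + (1 - norm d)))"
    using sq[of d] sq[of d'] assms by simp
  finally show ?thesis by simp
qed

lemma integral_scaled_sum3:
  fixes f g h :: "real \<Rightarrow> real"
  assumes "f integrable_on S" "g integrable_on S" "h integrable_on S"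
  shows "integral S (\<lambda>y. c * (f y + g y + h y)) = c * (integral S f + integral S g + integral S h)"
  by (intro integral_unique has_integral_mult_right has_integral_add integrable_integral assms)

text \<open>
  Angles are chosen by recursion on \<open>n\<close>, always as near as possible to the preceding ones. They remain
  simple functions, because each is a function of the finitely many values of simple functions.
\<close>

lemma simple_angles:
  fixes d :: "nat \<Rightarrow> real \<Rightarrow> real ^ 2"
  assumes d: "\<And>n. simple_function borel (d n)" "\<And>n y. norm (d n y) \<le> 1"
    and e: "\<And>n. integral {0..T} (\<lambda>y. 1 - norm (d n y)) \<le> e n"
      "\<And>n. integral {0..T} (\<lambda>y. (norm (d (Suc n) y - d n y))\<^sup>2) \<le> e n" "\<And>n. e (Suc n) \<le> e n"
  obtains \<alpha> :: "nat \<Rightarrow> real \<Rightarrow> real" where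
    "\<And>n. simple_function borel (\<alpha> n)" "\<And>n y. norm (d n y) *\<^sub>R unit_vec (\<alpha> n y) = d n y"
    "\<And>n. integral {0..T} (\<lambda>y. (\<alpha> (Suc n) y - \<alpha> n y)\<^sup>2) \<le> 36 * e n"
proof -
  define \<alpha> where "\<alpha> = rec_nat (\<lambda>y. angle_near 0 (d 0 y)) (\<lambda>n a y. angle_near (a y) (d (Suc n) y))"
  have \<alpha>_simps: "\<alpha> 0 = (\<lambda>y. angle_near 0 (d 0 y))" "\<alpha> (Suc n) = (\<lambda>y. angle_near (\<alpha> n y) (d (Suc n) y))" for n
    by (simp_all add: \<alpha>_def)
  have simple: "simple_function borel (\<alpha> n)" for n
  proof (induction n)
    case 0
    then show ?case unfolding \<alpha>_simps by (rule simple_function_compose1[OF d(1)])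
  next
    case (Suc n)
    then show ?case unfolding \<alpha>_simps by (rule simple_function_compose2[OF _ d(1)])
  qed
  have dir: "norm (d n y) *\<^sub>R unit_vec (\<alpha> n y) = d n y" for n y
    by (cases n) (simp_all add: \<alpha>_simps angle_near)
  have "integral {0..T} (\<lambda>y. (\<alpha> (Suc n) y - \<alpha> n y)\<^sup>2) \<le> 36 * e n" for n
  proof -
    have s1: "simple_function borel (\<lambda>y. 1 - norm (d k y))" for k
      by (rule simple_function_compose1[OF d(1)])
    have s2: "simple_function borel (\<lambda>y. (norm (d (Suc n) y - d n y))\<^sup>2)"
      by (rule simple_function_compose2[OF d(1) d(1)])
    have s3: "simple_function borel (\<lambda>y. (\<alpha> (Suc n) y - \<alpha> n y)\<^sup>2)"
      by (rule simple_function_compose2[OF simple simple])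
    note i = s1[THEN simple_integrable, of _ 0 T] s2[THEN simple_integrable, of 0 T] s3[THEN simple_integrable, of 0 T]
    have "integral {0..T} (\<lambda>y. (\<alpha> (Suc n) y - \<alpha> n y)\<^sup>2)
        \<le> integral {0..T} (\<lambda>y. 12 * ((1 - norm (d (Suc n) y)) + (norm (d (Suc n) y - d n y))\<^sup>2 + (1 - norm (d n y))))"
      by (intro integral_le integrable_on_mult_right integrable_add i angle_increment_le d dir)
        (simp add: \<alpha>_simps angle_near)
    also have "\<dots> = 12 * (integral {0..T} (\<lambda>y. 1 - norm (d (Suc n) y))
        + integral {0..T} (\<lambda>y. (norm (d (Suc n) y - d n y))\<^sup>2) + integral {0..T} (\<lambda>y. 1 - norm (d n y)))"
      by (rule integral_scaled_sum3[OF i(1,2,1)])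
    also have "\<dots> \<le> 12 * (e n + e n + e n)"
      using e(1)[of "Suc n"] e(1)[of n] e(2)[of n] e(3)[of n] by simp
    finally show ?thesis by simp
  qed
  with simple dir show thesis using that by blast
qed

text \<open>
  The decay \<open>8\<^sup>-\<^sup>n\<close> leaves room to sum squares of increments without the triangle inequality in \<open>L\<^sup>2\<close>:
  from \<open>(x + y)\<^sup>2 \<le> 2 x\<^sup>2 + 2 y\<^sup>2\<close> the bound \<open>480 / 8\<^sup>m\<close> reproduces itself, as
  \<open>2 \<cdot> 480 / 8 + 2 \<cdot> 120 \<le> 480\<close>, where \<open>120 \<ge> 3 (1 + 36 + 1)\<close> bounds one increment.
\<close>

lemma smooth_angle_sequence:
  fixes d :: "nat \<Rightarrow> real \<Rightarrow> real ^ 2"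
  assumes d: "\<And>n. simple_function borel (d n)" "\<And>n y. norm (d n y) \<le> 1"
    and e: "\<And>n. integral {0..2*pi} (\<lambda>y. 1 - norm (d n y)) \<le> 1 / 8 ^ n"
      "\<And>n. integral {0..2*pi} (\<lambda>y. (norm (d (Suc n) y - d n y))\<^sup>2) \<le> 1 / 8 ^ n"
  obtains \<beta> :: "nat \<Rightarrow> real \<Rightarrow> real" where
    "\<And>n. smooth (\<beta> n)" "\<And>n x. \<beta> n (x + 2 * pi) = \<beta> n x"
    "\<And>m n. m \<le> n \<Longrightarrow> integral {0..2*pi} (\<lambda>x. (\<beta> n x - \<beta> m x)\<^sup>2) \<le> 480 / 8 ^ m"
    "\<And>n x. x \<in> {0..2*pi} \<Longrightarrow> norm (prim (\<lambda>t. unit_vec (\<beta> n t)) x - integral {0..x} (d n)) \<le> sqrt (2 * pi / 8 ^ n) + 1 / 8 ^ n"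
proof -
  obtain \<alpha> :: "nat \<Rightarrow> real \<Rightarrow> real" where \<alpha>: "\<And>n. simple_function borel (\<alpha> n)"
    and dir: "\<And>n y. norm (d n y) *\<^sub>R unit_vec (\<alpha> n y) = d n y"
    and \<alpha>e: "\<And>n. integral {0..2*pi} (\<lambda>y. (\<alpha> (Suc n) y - \<alpha> n y)\<^sup>2) \<le> 36 * (1 / 8 ^ n)"
    using simple_angles[of d "2 * pi" "\<lambda>n. 1 / 8 ^ n", OF d e] by (auto simp: field_simps)
  have \<alpha>b: "\<alpha> n \<in> borel_measurable borel" "bounded (range (\<alpha> n))" for n
    using \<alpha>[of n] by (auto simp: borel_measurable_simple_function simple_function_def finite_imp_bounded)
  have "\<exists>b. smooth b \<and> (\<forall>x. b (x + 2 * pi) = b x) \<and> integral {0..2*pi} (\<lambda>x. (b x - \<alpha> n x)\<^sup>2) < 1 / 8 ^ n" for n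
    by (rule L2_approx_smooth_periodic[OF \<alpha>b[of n], of "1 / 8 ^ n"]) auto
  then obtain \<beta> where \<beta>: "\<And>n. smooth (\<beta> n)" "\<And>n x. \<beta> n (x + 2 * pi) = \<beta> n x"
    and \<beta>e: "\<And>n. integral {0..2*pi} (\<lambda>x. (\<beta> n x - \<alpha> n x)\<^sup>2) < 1 / 8 ^ n" by metis
  have \<beta>c: "continuous_on S (\<beta> n)" for S n using \<beta>(1) by (rule smooth_continuous_on)
  have i\<beta>\<alpha>: "(\<lambda>x. (\<beta> n x - \<alpha> n x)\<^sup>2) integrable_on {a..b}" for n a b
    by (rule diff_square_integrable[OF \<beta>c \<alpha>b])
  have i\<beta>: "(\<lambda>x. (\<beta> n x - \<beta> m x)\<^sup>2) integrable_on {a..b}" for n m a b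
    by (intro integrable_continuous_interval continuous_intros \<beta>c)
  have i\<alpha>: "(\<lambda>x. (\<alpha> (Suc n) x - \<alpha> n x)\<^sup>2) integrable_on {a..b}" for n a b
    by (rule simple_integrable[OF simple_function_compose2[OF \<alpha> \<alpha>]])
  have step: "integral {0..2*pi} (\<lambda>x. (\<beta> (Suc n) x - \<beta> n x)\<^sup>2) \<le> 120 / 8 ^ n" for n
  proof -
    have "integral {0..2*pi} (\<lambda>x. (\<beta> (Suc n) x - \<beta> n x)\<^sup>2)
        \<le> integral {0..2*pi} (\<lambda>x. 3 * ((\<beta> (Suc n) x - \<alpha> (Suc n) x)\<^sup>2 + (\<alpha> (Suc n) x - \<alpha> n x)\<^sup>2 + (\<beta> n x - \<alpha> n x)\<^sup>2))"
    proof (intro integral_le integrable_on_mult_right integrable_add i\<beta> i\<beta>\<alpha> i\<alpha>)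
      fix x
      show "(\<beta> (Suc n) x - \<beta> n x)\<^sup>2 \<le> 3 * ((\<beta> (Suc n) x - \<alpha> (Suc n) x)\<^sup>2 + (\<alpha> (Suc n) x - \<alpha> n x)\<^sup>2 + (\<beta> n x - \<alpha> n x)\<^sup>2)"
        using square_sum3_le[of "\<beta> (Suc n) x - \<alpha> (Suc n) x" "\<alpha> (Suc n) x - \<alpha> n x" "- (\<beta> n x - \<alpha> n x)"]
        by (simp only: power2_minus) simp
    qed
    also have "\<dots> = 3 * (integral {0..2*pi} (\<lambda>x. (\<beta> (Suc n) x - \<alpha> (Suc n) x)\<^sup>2)
        + integral {0..2*pi} (\<lambda>x. (\<alpha> (Suc n) x - \<alpha> n x)\<^sup>2) + integral {0..2*pi} (\<lambda>x. (\<beta> n x - \<alpha> n x)\<^sup>2))"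
      by (rule integral_scaled_sum3[OF i\<beta>\<alpha> i\<alpha> i\<beta>\<alpha>])
    also have "\<dots> \<le> 3 * (1 / 8 ^ n + 36 / 8 ^ n + 1 / 8 ^ n)"
      using \<beta>e[of "Suc n"] \<beta>e[of n] \<alpha>e[of n] by (simp add: field_simps)
    also have "\<dots> \<le> 120 / 8 ^ n" by (simp add: field_simps)
    finally show ?thesis .
  qed
  have cauchy: "integral {0..2*pi} (\<lambda>x. (\<beta> (m + k) x - \<beta> m x)\<^sup>2) \<le> 480 / 8 ^ m" for m k
  proof (induction k arbitrary: m)
    case (Suc k)
    have "integral {0..2*pi} (\<lambda>x. (\<beta> (m + Suc k) x - \<beta> m x)\<^sup>2)
        \<le> integral {0..2*pi} (\<lambda>x. 2 * (\<beta> (Suc m + k) x - \<beta> (Suc m) x)\<^sup>2 + 2 * (\<beta> (Suc m) x - \<beta> m x)\<^sup>2)"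
    proof (intro integral_le integrable_on_mult_right integrable_add i\<beta>)
      fix x
      show "(\<beta> (m + Suc k) x - \<beta> m x)\<^sup>2 \<le> 2 * (\<beta> (Suc m + k) x - \<beta> (Suc m) x)\<^sup>2 + 2 * (\<beta> (Suc m) x - \<beta> m x)\<^sup>2"
        using zero_le_power2[of "(\<beta> (Suc m + k) x - \<beta> (Suc m) x) - (\<beta> (Suc m) x - \<beta> m x)"]
        by (simp add: power2_eq_square algebra_simps)
    qed
    also have "\<dots> = 2 * integral {0..2*pi} (\<lambda>x. (\<beta> (Suc m + k) x - \<beta> (Suc m) x)\<^sup>2)
        + 2 * integral {0..2*pi} (\<lambda>x. (\<beta> (Suc m) x - \<beta> m x)\<^sup>2)"
      using i\<beta> by (subst Henstock_Kurzweil_Integration.integral_add) (auto intro!: integrable_on_mult_right)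
    also have "\<dots> \<le> 2 * (480 / 8 ^ Suc m) + 2 * (120 / 8 ^ m)"
      using Suc.IH[of "Suc m"] step[of m] by (intro add_mono mult_left_mono) auto
    also have "\<dots> \<le> 480 / 8 ^ m" by (simp add: field_simps)
    finally show ?case .
  qed simp
  have approx: "norm (prim (\<lambda>t. unit_vec (\<beta> n t)) x - integral {0..x} (d n)) \<le> sqrt (2 * pi / 8 ^ n) + 1 / 8 ^ n"
    if x: "x \<in> {0..2*pi}" for n x
  proof -
    have c: "continuous_on UNIV (\<lambda>t. unit_vec (\<beta> n t))" by (intro continuous_unit_vec_comp \<beta>c)
    have iu: "(\<lambda>t. unit_vec (\<beta> n t)) integrable_on {0..x}"
      by (intro integrable_continuous_interval continuous_on_subset[OF c]) auto
    have id: "d n integrable_on {0..x}" by (rule simple_integrable[OF d(1)])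
    have in': "(\<lambda>y. 1 - norm (d n y)) integrable_on {a..b}" for a b
      by (rule simple_integrable[OF simple_function_compose1[OF d(1)]])
    have iab: "(\<lambda>y. \<bar>\<beta> n y - \<alpha> n y\<bar>) integrable_on {a..b}" for a b
    proof -
      have "(\<lambda>y. \<beta> n y - \<alpha> n y) \<in> borel_measurable borel"
        using borel_measurable_continuous_onI[OF \<beta>c] \<alpha>b(1) by measurable
      then have "(\<lambda>y. \<bar>\<beta> n y - \<alpha> n y\<bar>) \<in> borel_measurable (lebesgue_on {a..b})"
        by (intro measurable_restrict_space1 measurable_completion) simp
      then show ?thesis
      proof (rule measurable_bounded_by_integrable_imp_integrable[where g = "\<lambda>x. (\<beta> n x - \<alpha> n x)\<^sup>2 + 1"])
        show "(\<lambda>x. (\<beta> n x - \<alpha> n x)\<^sup>2 + 1) integrable_on {a..b}"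
          by (intro integrable_add i\<beta>\<alpha>) auto
        have "\<bar>w\<bar> \<le> w\<^sup>2 + 1" for w :: real
          using zero_le_power2[of "\<bar>w\<bar> - 1 / 2"] by (simp add: power2_eq_square algebra_simps)
        then show "norm \<bar>\<beta> n x - \<alpha> n x\<bar> \<le> (\<beta> n x - \<alpha> n x)\<^sup>2 + 1" for x
          by simp
      qed auto
    qed
    have "prim (\<lambda>t. unit_vec (\<beta> n t)) x - integral {0..x} (d n) = integral {0..x} (\<lambda>t. unit_vec (\<beta> n t) - d n t)"
      using prim_diff_integral[OF c, of 0 x] x iu id by (simp add: Henstock_Kurzweil_Integration.integral_diff)
    also have "norm \<dots> \<le> integral {0..x} (\<lambda>t. \<bar>\<beta> n t - \<alpha> n t\<bar> + (1 - norm (d n t)))"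
    proof (rule integral_norm_bound_integral[OF integrable_diff[OF iu id] integrable_add[OF iab in']])
      fix t
      have "unit_vec (\<alpha> n t) - d n t = (1 - norm (d n t)) *\<^sub>R unit_vec (\<alpha> n t)"
        using dir[of n t] by (simp add: scaleR_diff_left)
      then have "norm (unit_vec (\<alpha> n t) - d n t) = 1 - norm (d n t)" using d(2)[of n t] by simp
      then show "norm (unit_vec (\<beta> n t) - d n t) \<le> \<bar>\<beta> n t - \<alpha> n t\<bar> + (1 - norm (d n t))"
        using norm_triangle_ineq[of "unit_vec (\<beta> n t) - unit_vec (\<alpha> n t)" "unit_vec (\<alpha> n t) - d n t"]
          norm_unit_vec_diff[of "\<beta> n t" "\<alpha> n t"] by simp
    qed
    also have "\<dots> \<le> integral {0..2*pi} (\<lambda>t. \<bar>\<beta> n t - \<alpha> n t\<bar> + (1 - norm (d n t)))"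
      using x d(2) by (intro integral_subset_le integrable_add[OF iab in']) (auto intro!: add_nonneg_nonneg)
    also have "\<dots> = integral {0..2*pi} (\<lambda>t. \<bar>\<beta> n t - \<alpha> n t\<bar>) + integral {0..2*pi} (\<lambda>t. 1 - norm (d n t))"
      by (intro Henstock_Kurzweil_Integration.integral_add iab in')
    also have "\<dots> \<le> sqrt (2 * pi / 8 ^ n) + 1 / 8 ^ n"
    proof (rule add_mono[OF _ e(1)])
      have "(integral {0..2*pi} (\<lambda>t. \<bar>\<beta> n t - \<alpha> n t\<bar>))\<^sup>2 \<le> (2 * pi - 0) * integral {0..2*pi} (\<lambda>t. \<bar>\<beta> n t - \<alpha> n t\<bar>\<^sup>2)"
        by (intro integral_squared_le iab) (use i\<beta>\<alpha> in auto)
      also have "\<dots> \<le> 2 * pi * (1 / 8 ^ n)"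
        using mult_left_mono[OF less_imp_le[OF \<beta>e[of n]], of "2 * pi"] by simp
      finally show "integral {0..2*pi} (\<lambda>t. \<bar>\<beta> n t - \<alpha> n t\<bar>) \<le> sqrt (2 * pi / 8 ^ n)"
        by (intro real_le_rsqrt) simp
    qed
    finally show ?thesis .
  qed
  show thesis
  proof (rule that[of \<beta>])
    show "integral {0..2*pi} (\<lambda>x. (\<beta> n x - \<beta> m x)\<^sup>2) \<le> 480 / 8 ^ m" if "m \<le> n" for m n
      using cauchy[of m "n - m"] that by simp
  qed (use \<beta> approx in auto)
qed

section \<open>Diffeomorphisms close to a monotone map\<close>

text \<open>
  Interpolate \<open>\<sigma>\<close> linearly between dyadic nodes and approximate in \<open>L\<^sup>2\<close> the square root \<open>g\<close> of the slope by
  a smooth periodic \<open>b\<close>. The square root guarantees positivity: the density \<open>b\<^sup>2 + \<delta>\<close> is positive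
  and \<open>L\<^sup>1\<close>-close to \<open>g\<^sup>2\<close>. It is then rescaled to total mass \<open>2\<pi>\<close>.
\<close>

lemma smooth_monotone_approx:
  fixes \<sigma> :: "real \<Rightarrow> real"
  assumes \<sigma>: "continuous_on {0..2*pi} \<sigma>" "\<And>x y. 0 \<le> x \<Longrightarrow> x \<le> y \<Longrightarrow> y \<le> 2 * pi \<Longrightarrow> \<sigma> x \<le> \<sigma> y"
    "\<sigma> 0 = 0" "\<sigma> (2*pi) = 2*pi" and "0 < e"
  obtains q where "smooth q" "\<And>x. q (x + 2 * pi) = q x" "\<And>x. 0 < q x" "prim q (2*pi) = 2*pi"
    "\<And>x. x \<in> {0..2*pi} \<Longrightarrow> \<bar>prim q x - \<sigma> x\<bar> \<le> e"
proof -
  define \<epsilon> where "\<epsilon> = min 1 (e / 6)"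
  have \<epsilon>: "0 < \<epsilon>" "\<epsilon> \<le> 1" "6 * \<epsilon> \<le> e" using \<open>0 < e\<close> by (auto simp: \<epsilon>_def)
  have T: "0 < 2 * pi" by simp
  obtain n where n: "\<And>x y. x \<in> {0..2*pi} \<Longrightarrow> y \<in> {0..2*pi} \<Longrightarrow> \<bar>x - y\<bar> \<le> 2 * pi / 2 ^ n \<Longrightarrow> norm (\<sigma> x - \<sigma> y) \<le> \<epsilon>"
    using eventually_dyadic_oscillation[OF \<sigma>(1) \<epsilon>(1)] unfolding eventually_sequentially
    by (metis order_refl)
  let ?t = "dyadic (2 * pi) n"
  have tm: "mono ?t" by (auto intro!: monoI dyadic_mono)
  define h where "h = 2 * pi / 2 ^ n"
  have h: "0 < h" "?t (Suc j) - ?t j = h" for j by (simp_all add: h_def dyadic_step)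
  define w where "w j = (\<sigma> (?t (Suc j)) - \<sigma> (?t j)) / h" for j
  have tr: "?t j \<in> {0..2*pi}" if "j \<le> 2 ^ n" for j by (rule dyadic_range[OF T that])
  have w0: "0 \<le> w j" if "j < 2 ^ n" for j
    using \<sigma>(2)[of "?t j" "?t (Suc j)"] tr[of j] tr[of "Suc j"] that h monoD[OF tm, of j "Suc j"] by (simp add: w_def)
  define g where "g = step ?t (2 ^ n) (\<lambda>j. sqrt (w j))"
  have g: "simple_function borel g" unfolding g_def by (rule simple_function_step)
  have gw: "(g y)\<^sup>2 = w j" if "j < 2 ^ n" "y \<in> {?t j<..?t (Suc j)}" for j y
    using step_eq[OF tm that, of "\<lambda>j. sqrt (w j)"] w0[OF that(1)] by (simp add: g_def)
  have ig2: "(\<lambda>y. (g y)\<^sup>2) integrable_on {a..b}" for a b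
    by (rule simple_integrable[OF simple_function_compose1[OF g]])
  have ig_nodes: "((\<lambda>y. (g y)\<^sup>2) has_integral \<sigma> (?t j)) {0..?t j}" if "j \<le> 2 ^ n" for j
  proof -
    have "((\<lambda>y. (g y)\<^sup>2) has_integral (\<Sum>i<j. (?t (Suc i) - ?t i) *\<^sub>R w i)) {?t 0..?t j}"
      using that by (intro has_integral_nodes[OF tm] has_integral_const_Ioc gw monoD[OF tm]) auto
    moreover have "(\<Sum>i<j. (?t (Suc i) - ?t i) *\<^sub>R w i) = \<sigma> (?t j)"
      using sum_lessThan_telescope[of "\<lambda>i. \<sigma> (?t i)" j] h \<sigma>(3) by (simp add: w_def)
    ultimately show ?thesis by simp
  qed
  have ig_close: "\<bar>integral {0..x} (\<lambda>y. (g y)\<^sup>2) - \<sigma> x\<bar> \<le> \<epsilon>" if x: "x \<in> {0..2*pi}" for x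
  proof -
    obtain j where j: "j < 2 ^ n" "?t j \<le> x" "x \<le> ?t (Suc j)"
      using dyadic_interval[OF T x] .
    have "integral {0..?t j} (\<lambda>y. (g y)\<^sup>2) \<le> integral {0..x} (\<lambda>y. (g y)\<^sup>2)"
      "integral {0..x} (\<lambda>y. (g y)\<^sup>2) \<le> integral {0..?t (Suc j)} (\<lambda>y. (g y)\<^sup>2)"
      using j by (intro integral_subset_le ig2; auto)+
    then have "\<sigma> (?t j) \<le> integral {0..x} (\<lambda>y. (g y)\<^sup>2)" "integral {0..x} (\<lambda>y. (g y)\<^sup>2) \<le> \<sigma> (?t (Suc j))"
      using ig_nodes[of j] ig_nodes[of "Suc j"] j by (auto simp: integral_unique)
    moreover have "\<sigma> (?t j) \<le> \<sigma> x" "\<sigma> x \<le> \<sigma> (?t (Suc j))"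
      using j x tr[of j] tr[of "Suc j"] by (auto intro!: \<sigma>(2))
    moreover have "norm (\<sigma> (?t (Suc j)) - \<sigma> (?t j)) \<le> \<epsilon>"
      using n[of "?t (Suc j)" "?t j"] tr[of j] tr[of "Suc j"] j(1) h by (auto simp: h_def)
    ultimately show ?thesis by (auto simp: abs_if split: if_splits)
  qed
  have gb: "g \<in> borel_measurable borel" "bounded (range g)"
    using g by (auto simp: borel_measurable_simple_function simple_function_def finite_imp_bounded)
  obtain B where B: "\<And>y. \<bar>g y\<bar> \<le> B" using gb(2) by (auto simp: bounded_iff)
  have B0: "0 \<le> B" using B[of 0] by simp
  define M where "M = 1 + 2 * (pi * B\<^sup>2)"
  have M: "1 \<le> M" by (simp add: M_def)
  obtain b where b: "smooth b" "\<And>x. b (x + 2 * pi) = b x"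
    and be: "integral {0..2*pi} (\<lambda>x. (b x - g x)\<^sup>2) < \<epsilon>\<^sup>2 / (4 * M)"
    using L2_approx_smooth_periodic[OF gb, of "\<epsilon>\<^sup>2 / (4 * M)"] \<epsilon> M by auto
  have bc: "continuous_on S b" for S using b(1) by (rule smooth_continuous_on)
  have ibg: "(\<lambda>x. (b x - g x)\<^sup>2) integrable_on {x..y}" for x y
    by (rule diff_square_integrable[OF bc gb])
  have ib: "(\<lambda>x. (b x)\<^sup>2) integrable_on {x..y}" for x y
    by (intro integrable_continuous_interval continuous_intros bc)
  define \<delta> where "\<delta> = \<epsilon> / (4 * pi)"
  have \<delta>: "0 < \<delta>" using \<epsilon> by (simp add: \<delta>_def)
  have close: "\<bar>integral {0..x} (\<lambda>y. (b y)\<^sup>2) - \<sigma> x\<bar> \<le> 2 * \<epsilon>" if x: "x \<in> {0..2*pi}" for x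
  proof -
    have "\<bar>integral {0..x} (\<lambda>y. (b y)\<^sup>2) - integral {0..x} (\<lambda>y. (g y)\<^sup>2)\<bar> = norm (integral {0..x} (\<lambda>y. (b y)\<^sup>2 - (g y)\<^sup>2))"
      using ib ig2 by (simp add: Henstock_Kurzweil_Integration.integral_diff)
    \<comment> \<open>the mixed term \<open>2 g (b - g)\<close> is split by Young's inequality with weight \<open>\<delta>\<close>\<close>
    also have "\<dots> \<le> integral {0..x} (\<lambda>y. (4 * pi * B\<^sup>2 / \<epsilon> + 1) * (b y - g y)\<^sup>2 + \<epsilon> / (4 * pi))"
    proof (intro integral_norm_bound_integral integrable_diff integrable_add integrable_on_mult_right ib ig2 ibg)
      fix y
      have "\<bar>(b y)\<^sup>2 - (g y)\<^sup>2\<bar> \<le> (b y - g y)\<^sup>2 + 2 * (B * \<bar>b y - g y\<bar>)"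
      proof -
        have "(b y)\<^sup>2 - (g y)\<^sup>2 = (b y - g y)\<^sup>2 + 2 * (g y * (b y - g y))"
          by (simp add: power2_eq_square algebra_simps)
        moreover have "\<bar>g y * (b y - g y)\<bar> \<le> B * \<bar>b y - g y\<bar>"
          unfolding abs_mult using B by (intro mult_right_mono) auto
        ultimately show ?thesis by (smt (verit) zero_le_power2)
      qed
      also have "2 * (B * \<bar>b y - g y\<bar>) \<le> 4 * pi * B\<^sup>2 / \<epsilon> * (b y - g y)\<^sup>2 + \<epsilon> / (4 * pi)"
      proof -
        have "0 \<le> (B * \<bar>b y - g y\<bar> - \<delta>)\<^sup>2 / \<delta>" using \<delta> by simp
        also have "\<dots> = B\<^sup>2 / \<delta> * (b y - g y)\<^sup>2 + \<delta> - 2 * (B * \<bar>b y - g y\<bar>)"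
          using \<delta> by (simp add: power2_diff power_mult_distrib diff_divide_distrib add_divide_distrib) (simp add: power2_eq_square)
        finally show ?thesis using \<epsilon> by (simp add: \<delta>_def field_simps)
      qed
      finally show "norm ((b y)\<^sup>2 - (g y)\<^sup>2) \<le> (4 * pi * B\<^sup>2 / \<epsilon> + 1) * (b y - g y)\<^sup>2 + \<epsilon> / (4 * pi)"
        by (simp add: algebra_simps)
    qed auto
    also have "\<dots> \<le> integral {0..2*pi} (\<lambda>y. (4 * pi * B\<^sup>2 / \<epsilon> + 1) * (b y - g y)\<^sup>2 + \<epsilon> / (4 * pi))"
      using x \<epsilon> by (intro integral_subset_le integrable_add integrable_on_mult_right ibg) auto
    also have "\<dots> = (4 * pi * B\<^sup>2 / \<epsilon> + 1) * integral {0..2*pi} (\<lambda>y. (b y - g y)\<^sup>2) + \<epsilon> / 2"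
      using ibg by (subst Henstock_Kurzweil_Integration.integral_add) (auto intro!: integrable_on_mult_right)
    also have "\<dots> \<le> (4 * pi * B\<^sup>2 / \<epsilon> + 1) * (\<epsilon>\<^sup>2 / (4 * M)) + \<epsilon> / 2"
      using be \<epsilon> by (intro add_mono mult_left_mono) auto
    also have "(4 * pi * B\<^sup>2 / \<epsilon> + 1) * (\<epsilon>\<^sup>2 / (4 * M)) \<le> \<epsilon> / 2"
    proof -
      have "(4 * pi * B\<^sup>2 / \<epsilon> + 1) * \<epsilon>\<^sup>2 = \<epsilon> * (4 * pi * B\<^sup>2 + \<epsilon>)"
        using \<epsilon> by (simp add: power2_eq_square field_simps)
      also have "\<dots> \<le> \<epsilon> * (2 * M)"
      proof (rule mult_left_mono)
        show "4 * pi * B\<^sup>2 + \<epsilon> \<le> 2 * M"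
          using \<epsilon> by (simp add: M_def)
      qed (use \<epsilon> in simp)
      finally have "(4 * pi * B\<^sup>2 / \<epsilon> + 1) * \<epsilon>\<^sup>2 / (4 * M) \<le> \<epsilon> * (2 * M) / (4 * M)"
        using M by (intro divide_right_mono) auto
      then show ?thesis using M by simp
    qed
    finally show ?thesis using ig_close[OF x] by simp
  qed
  define q0 where "q0 x = (b x)\<^sup>2 + \<delta>" for x
  have q0: "smooth q0" 
    unfolding q0_def[abs_def] power2_eq_square by (intro smooth_add smooth_mult smooth_const b)
  have q0c: "continuous_on UNIV q0" by (rule smooth_continuous_on[OF q0])
  have prim0: "\<bar>prim q0 x - \<sigma> x\<bar> \<le> 3 * \<epsilon>" if x: "x \<in> {0..2*pi}" for x
  proof -
    have "prim q0 x = integral {0..x} (\<lambda>y. (b y)\<^sup>2) + x * \<delta>"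
      using prim_diff_integral[OF q0c, of 0 x] x
        Henstock_Kurzweil_Integration.integral_add[OF ib integrable_const_ivl[of \<delta>], of 0 x]
      by (simp add: q0_def[abs_def])
    moreover have "0 \<le> x * \<delta>" "x * \<delta> \<le> 2 * pi * \<delta>" using x \<delta> by auto
    moreover have "2 * pi * \<delta> = \<epsilon> / 2" by (simp add: \<delta>_def)
    ultimately show ?thesis using close[OF x] \<epsilon> by linarith
  qed
  define P where "P = prim q0 (2 * pi)"
  have P3: "\<bar>P - 2 * pi\<bar> \<le> 3 * \<epsilon>" using prim0[of "2 * pi"] \<sigma>(4) by (simp add: P_def)
  have q0pos: "0 < q0 x" for x using \<delta> by (simp add: q0_def add_nonneg_pos)
  have iq0: "q0 integrable_on {a..b}" for a b
    by (intro integrable_continuous_interval continuous_on_subset[OF q0c]) auto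
  have "2 * pi * \<delta> \<le> P"
  proof -
    have "integral {0..2*pi} (\<lambda>x. \<delta>) \<le> integral {0..2*pi} q0"
      by (intro integral_le iq0) (auto simp: q0_def)
    then show ?thesis using prim_diff_integral[OF q0c, of 0 "2*pi"] by (simp add: P_def)
  qed
  moreover have "0 < 2 * pi * \<delta>" using \<delta> by simp
  ultimately have P0: "0 < P" by linarith
  define q where "q x = (2 * pi / P) * q0 x" for x
  have prim_q: "prim q x = (2 * pi / P) * prim q0 x" for x
    unfolding prim_def q_def by simp
  show thesis
  proof (rule that[of q])
    show "smooth q" unfolding q_def[abs_def] by (intro smooth_mult smooth_const q0)
    show "q (x + 2 * pi) = q x" for x by (simp add: q_def q0_def b)
    show "0 < q x" for x using P0 q0pos by (simp add: q_def)
    show "prim q (2 * pi) = 2 * pi" using P0 by (simp add: prim_q P_def)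
    fix x assume x: "x \<in> {0..2*pi}"
    have "prim q0 x = integral {0..x} q0" using prim_diff_integral[OF q0c, of 0 x] x by simp
    then have 1: "0 \<le> prim q0 x" "prim q0 x \<le> P"
      using x q0pos prim_diff_integral[OF q0c, of 0 "2*pi"]
      by (auto intro!: integral_nonneg integral_subset_le iq0 simp: P_def less_imp_le)
    have "prim q x - prim q0 x = (prim q0 x / P) * (2 * pi - P)"
      using P0 by (simp add: prim_q field_simps)
    moreover have "\<bar>(prim q0 x / P) * (2 * pi - P)\<bar> \<le> 1 * (3 * \<epsilon>)"
      unfolding abs_mult using 1 P0 P3 by (intro mult_mono) auto
    ultimately have "\<bar>prim q x - prim q0 x\<bar> \<le> 3 * \<epsilon>" by simp
    then show "\<bar>prim q x - \<sigma> x\<bar> \<le> e" using prim0[OF x] \<epsilon>(3) by linarith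
  qed
qed

text \<open>
  The primitive \<open>\<psi>\<close> of \<open>q\<close> satisfies \<open>\<psi>(x + 2\<pi>) = \<psi>(x) + 2\<pi>\<close> and is a smooth bijection of the line with
  positive derivative. The diffeomorphism obtained is the one induced by the inverse of \<open>\<psi>\<close>.
\<close>

lemma Diff_S1_of_density:
  assumes q: "smooth q" "\<And>x. q (x + 2 * pi) = q x" "\<And>x. 0 < q x" "prim q (2*pi) = 2*pi"
  obtains \<phi> where "\<phi> \<in> Diff_S1" "\<And>x. \<phi> (cis (prim q x)) = cis x"
    "\<And>u. u \<in> S1 \<Longrightarrow> \<exists>x\<in>{0..2*pi}. u = cis (prim q x)"
proof -
  let ?\<psi> = "prim q"
  have qc: "continuous_on UNIV q" by (rule smooth_continuous_on[OF q(1)])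
  have D: "(?\<psi> has_real_derivative q x) (at x)" for x
    using has_vector_derivative_prim[OF qc] by (simp add: has_real_derivative_iff_has_vector_derivative)
  have \<psi>_smooth: "smooth ?\<psi>" by (rule smooth_prim[OF q(1)])
  have sm: "strict_mono ?\<psi>"
  proof (rule strict_monoI)
    fix x y :: real assume "x < y"
    then show "?\<psi> x < ?\<psi> y" by (rule DERIV_pos_imp_increasing) (use D q(3) in blast)
  qed
  have per: "?\<psi> (x + 2 * pi) = ?\<psi> x + 2 * pi" for x
  proof -
    have "mean q = 1" using q(4) by (simp add: mean_def)
    then show ?thesis using closed_prim_periodic[OF qc q(2), of x] by (simp add: closed_prim_def)
  qed
  have onto: "\<exists>x. \<psi>x = ?\<psi> x \<and> (\<psi>x \<in> {0..2*pi} \<longrightarrow> x \<in> {0..2*pi})" for \<psi>x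
  proof -
    have small: "\<exists>x\<in>{0..2*pi}. y = ?\<psi> x" if "y \<in> {0..2*pi}" for y
    proof -
      have "\<exists>x\<ge>0. x \<le> 2 * pi \<and> ?\<psi> x = y"
        using that q(4) smooth_continuous_on[OF \<psi>_smooth] by (intro IVT') auto
      then show ?thesis by auto
    qed
    show ?thesis
    proof (cases "\<psi>x \<in> {0..2*pi}")
      case True
      then show ?thesis using small by blast
    next
      case False
      define k where "k = \<lfloor>\<psi>x / (2 * pi)\<rfloor>"
      have "of_int k \<le> \<psi>x / (2 * pi)" "\<psi>x / (2 * pi) \<le> of_int k + 1"
        unfolding k_def by (auto intro: less_imp_le)
      then have "\<psi>x - 2 * pi * of_int k \<in> {0..2*pi}"
        by (simp add: field_simps)
      then obtain x where "\<psi>x - 2 * pi * of_int k = ?\<psi> x" using small by blast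
      moreover have "?\<psi> (x + 2 * pi * of_int k) - (x + 2 * pi * of_int k) = ?\<psi> x - x"
        by (rule periodic_int[where g = "\<lambda>x. ?\<psi> x - x"]) (simp add: per)
      ultimately have "\<psi>x = ?\<psi> (x + 2 * pi * of_int k)" by linarith
      then show ?thesis using False by blast
    qed
  qed
  define g where "g = inv ?\<psi>"
  have inj: "inj ?\<psi>" using sm strict_mono_imp_inj_on by blast
  have g\<psi>: "g (?\<psi> x) = x" for x by (simp add: g_def inj)
  have "surj ?\<psi>" using onto by (metis surjI)
  then have \<psi>g: "?\<psi> (g y) = y" for y by (simp add: g_def surj_f_inv_f)
  have gper: "g (y + 2 * pi) = g y + 2 * pi" for y
    by (metis \<psi>g g\<psi> per)
  have g_cont: "isCont g y" for y
  proof -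
    have "isCont g (?\<psi> (g y))"
      by (rule isCont_inverse_function[where d = 1]) (auto simp: g\<psi> smooth_isCont \<psi>_smooth)
    then show ?thesis by (simp add: \<psi>g)
  qed
  have "vector_derivative ?\<psi> (at x) \<noteq> 0" for x
    using vector_derivative_at[OF has_vector_derivative_prim[OF qc]] q(3)[of x] by simp
  then have g_smooth: "smooth g"
    by (rule smooth_inverse_function[OF \<psi>_smooth _ g\<psi> \<psi>g g_cont])
  define \<phi> where "\<phi> z = cis (g (Arg z))" for z
  define \<kappa> where "\<kappa> z = cis (?\<psi> (Arg z))" for z
  have \<phi>c: "\<phi> (cis y) = cis (g y)" for y
    unfolding \<phi>_def by (rule periodic_Arg_cis[where g = "\<lambda>y. cis (g y)"]) (simp add: gper cis_mult[symmetric])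
  have \<kappa>c: "\<kappa> (cis y) = cis (?\<psi> y)" for y
    unfolding \<kappa>_def by (rule periodic_Arg_cis[where g = "\<lambda>y. cis (?\<psi> y)"]) (simp add: per cis_mult[symmetric])
  have S1: "\<exists>y. z = cis y" if "z \<in> S1" for z
    using that cis_Arg_unique rcis_cmod_Arg[of z] by (metis dist_0_norm mem_sphere rcis_def mult_1 of_real_1)
  have bij: "bij_betw \<phi> S1 S1"
  proof -
    have "\<kappa> (\<phi> z) = z \<and> \<phi> (\<kappa> z) = z \<and> \<phi> z \<in> S1 \<and> \<kappa> z \<in> S1" if "z \<in> S1" for z
      using S1[OF that] by (auto simp: \<phi>c \<kappa>c g\<psi> \<psi>g)
    then show ?thesis by (intro bij_betw_byWitness[where f' = \<kappa>]) blast+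
  qed
  have inv: "inv_into S1 \<phi> (cis y) = \<kappa> (cis y)" for y
    by (rule inv_into_f_eq[OF bij_betw_imp_inj_on[OF bij]]) (simp_all add: \<kappa>c \<phi>c g\<psi>)
  show thesis
  proof (rule that[of \<phi>])
    show "\<phi> \<in> Diff_S1"
      unfolding Diff_S1_def smooth_curve_def
      using bij smooth_compose[OF smooth_cis g_smooth] smooth_compose[OF smooth_cis \<psi>_smooth]
      by (simp add: \<phi>c inv \<kappa>c smooth_imp_smooth_on)
    show "\<phi> (cis (?\<psi> x)) = cis x" for x by (simp add: \<phi>c g\<psi>)
    fix u :: complex assume "u \<in> S1"
    then have u: "u = cis (Arg2pi u)"
      using complex_norm_eq_1_exp[of u] by (simp add: cis_conv_exp)
    obtain x where "Arg2pi u = ?\<psi> x" "x \<in> {0..2*pi}"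
      using onto[of "Arg2pi u"] Arg2pi[of u] by auto
    then show "\<exists>x\<in>{0..2*pi}. u = cis (?\<psi> x)" using u by auto
  qed
qed

text \<open>
  The lower bound makes \<^const>\<open>d_f\<close> a genuine infimum of nonnegative numbers: over the reals the supremum
  and the infimum have their meaning only for bounded sets, and the suprema are finite because the
  curves are continuous on a compact circle.
\<close>

lemma d_f_bounds:
  fixes c \<gamma> :: "complex \<Rightarrow> 'b::real_normed_vector"
  assumes c: "continuous_on S1 c" and \<gamma>: "continuous_on UNIV (\<lambda>x::real. \<gamma> (cis x))"
    and \<phi>: "\<phi> \<in> Diff_S1" and e: "\<And>u. u \<in> S1 \<Longrightarrow> norm (c (\<phi> u) - \<gamma> u) \<le> e"
  shows "\<bar>d_f \<gamma> c\<bar> \<le> e"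
proof -
  have ne: "1 \<in> S1" by simp
  have nonneg: "0 \<le> (SUP u\<in>S1. norm (c (\<psi> u) - \<gamma> u))" if \<psi>: "\<psi> \<in> Diff_S1" for \<psi>
  proof -
    have S1: "S1 = cis ` {0..2*pi}"
    proof -
      have "u \<in> cis ` {0..2*pi}" if "u \<in> S1" for u
        using complex_norm_eq_1_exp[of u] that Arg2pi[of u]
        by (intro image_eqI[of _ _ "Arg2pi u"]) (auto simp: cis_conv_exp)
      then show ?thesis by auto
    qed
    have "continuous_on UNIV (\<lambda>x. \<psi> (cis x))"
      using \<psi> by (auto simp: Diff_S1_def smooth_curve_def intro!: smooth_continuous_on smooth_on_UNIV_D)
    moreover have "\<psi> (cis x) \<in> S1" for x
      using \<psi> by (auto simp: Diff_S1_def bij_betw_def)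
    ultimately have "continuous_on UNIV (\<lambda>x. norm (c (\<psi> (cis x)) - \<gamma> (cis x)))"
      using \<gamma> by (intro continuous_intros continuous_on_compose2[OF c]) auto
    then have "compact ((\<lambda>x. norm (c (\<psi> (cis x)) - \<gamma> (cis x))) ` {0..2*pi})"
      by (intro compact_continuous_image) (auto intro: continuous_on_subset)
    then have "bdd_above ((\<lambda>u. norm (c (\<psi> u) - \<gamma> u)) ` S1)"
      unfolding S1 image_image by (intro bounded_imp_bdd_above compact_imp_bounded)
    then have "norm (c (\<psi> 1) - \<gamma> 1) \<le> (SUP u\<in>S1. norm (c (\<psi> u) - \<gamma> u))"
      by (rule cSUP_upper[OF ne])
    then show ?thesis using norm_ge_zero order_trans by blast
  qed
  have "0 \<le> d_f \<gamma> c"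
    unfolding d_f_def using \<phi> nonneg by (intro cINF_greatest) auto
  moreover have "d_f \<gamma> c \<le> (SUP u\<in>S1. norm (c (\<phi> u) - \<gamma> u))"
    unfolding d_f_def using nonneg by (intro cINF_lower[OF _ \<phi>] bdd_belowI2) auto
  moreover have "\<dots> \<le> e" using ne e by (intro cSUP_least) auto
  ultimately show ?thesis by simp
qed

section \<open>Approximation of rectifiable curves\<close>

text \<open>
  Between concentric circles the radius is interpolated linearly. The variation field has constant
  length \<open>\<bar>r' - r\<bar>\<close>, and in the second term of the norm the radius cancels between
  the length of the circle and \<open>|D\<^sub>sh|\<^sup>2 ds\<close>, so the distance does not blow up as the radii tend to zero.
\<close>

lemma concentric_circles:
  fixes p :: "real ^ 2"
  assumes lam: "0 \<le> lam"
  defines "circ \<equiv> \<lambda>r z. p + r *\<^sub>R unit_vec (Arg z)"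
  shows "0 < r \<Longrightarrow> immersed (circ r)"
    and "0 < r \<Longrightarrow> 0 < r' \<Longrightarrow> d_H1 lam (circ r) (circ r') \<le> ereal (\<bar>r' - r\<bar> * sqrt (1 + 4 * pi\<^sup>2 * lam))"
proof -
  have circ_cis: "circ r (cis x) = p + r *\<^sub>R unit_vec x" for r x
    unfolding circ_def using periodic_Arg_cis[of unit_vec x] by simp
  have deriv: "d_theta (\<lambda>z. q + r *\<^sub>R unit_vec (Arg z)) x = r *\<^sub>R unit_vec (x + pi / 2)" for q r x
    unfolding d_theta_def periodic_Arg_cis[of unit_vec, OF unit_vec_plus_2pi]
    by (rule vector_derivative_at) (auto intro!: derivative_eq_intros has_vector_derivative_unit_vec)
  have smooth2: "smooth (\<lambda>(x, v). p + (a + v * b) *\<^sub>R unit_vec x)" for a b :: real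
    unfolding case_prod_beta'
    by (intro smooth_add smooth_scaleR smooth_mult smooth_const smooth_snd smooth_compose[OF smooth_unit_vec smooth_fst])
  have smooth1: "smooth (\<lambda>x. p + r *\<^sub>R unit_vec x)" for r :: real
    by (intro smooth_add smooth_scaleR smooth_const smooth_unit_vec)
  show imm: "immersed (circ r)" if "0 < r" for r
    unfolding immersed_def smooth_curve_def circ_cis
    using that smooth1 deriv[of p r] by (auto simp: circ_def smooth_imp_smooth_on) (metis norm_unit_vec norm_zero zero_neq_one)
  show "d_H1 lam (circ r) (circ r') \<le> ereal (\<bar>r' - r\<bar> * sqrt (1 + 4 * pi\<^sup>2 * lam))" if r: "0 < r" "0 < r'"
  proof -
    define C where "C u v = circ (r + v * (r' - r)) u" for u v
    have rad: "0 < r + v * (r' - r)" if "v \<in> {0..1}" for v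
    proof -
      have "r + v * (r' - r) = (1 - v) * r + v * r'" by (simp add: algebra_simps)
      then show ?thesis
        using r that by (cases "v = 0") (auto intro!: add_nonneg_pos)
    qed
    have adm: "C \<in> admissible_homotopies (circ r) (circ r')"
      unfolding admissible_homotopies_def mem_Collect_eq
    proof (intro conjI ballI)
      show "smooth_homotopy C"
        unfolding smooth_homotopy_def C_def circ_cis by (rule smooth_imp_smooth_on[OF smooth2])
      show "immersed (\<lambda>u. C u v)" if "v \<in> {0..1}" for v
        unfolding C_def using imm[OF rad[OF that]] by simp
      show "\<exists>\<phi>\<in>Diff_S1. \<forall>u\<in>S1. C u 1 = circ r' (\<phi> u)"
        by (rule bexI[OF _ id_Diff_S1]) (simp add: C_def)
    qed (simp add: C_def)
    have dv: "d_v C v z = (r' - r) *\<^sub>R unit_vec (Arg z)" if "v \<in> {0..1}" for v z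
    proof -
      have "((\<lambda>v. (r + v * (r' - r)) *\<^sub>R unit_vec (Arg z)) has_vector_derivative (r' - r) *\<^sub>R unit_vec (Arg z)) (at v within {0..1})"
        by (auto intro!: derivative_eq_intros)
      from has_vector_derivative_add[OF has_vector_derivative_const this, of p]
      have "((\<lambda>v. C z v) has_vector_derivative (r' - r) *\<^sub>R unit_vec (Arg z)) (at v within {0..1})"
        by (simp add: C_def circ_def)
      then show ?thesis
        unfolding d_v_def using that by (intro vector_derivative_within_closed_interval) auto
    qed
    have "H1_norm lam (\<lambda>u. C u v) (d_v C v) \<le> \<bar>r' - r\<bar> * sqrt (1 + 4 * pi\<^sup>2 * lam)" if v: "v \<in> {0..1}" for v
    proof -
      define R where "R = r + v * (r' - r)"
      have R: "0 < R" unfolding R_def by (rule rad[OF v])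
      have Cv: "(\<lambda>u. C u v) = (\<lambda>z. p + R *\<^sub>R unit_vec (Arg z))" by (simp add: C_def R_def circ_def)
      let ?h = "\<lambda>z. (r' - r) *\<^sub>R unit_vec (Arg z)"
      have dh: "d_theta ?h x = (r' - r) *\<^sub>R unit_vec (x + pi / 2)" for x
        using deriv[of 0 "r' - r" x] by simp
      have uc: "continuous_on S (\<lambda>x. unit_vec (x + a))" for S a
        by (intro continuous_on_compose2[OF smooth_continuous_on[OF smooth_unit_vec, of UNIV]] continuous_intros) auto
      have "H1_norm lam (\<lambda>u. C u v) ?h \<le> sqrt (\<bar>r' - r\<bar>\<^sup>2 + lam * (2 * pi * R) * (2 * pi * (r' - r)\<^sup>2 / R))"
        unfolding Cv
      proof (rule H1_norm_le[OF lam R])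
        show "continuous_on {0..2*pi} (d_theta (\<lambda>z. p + R *\<^sub>R unit_vec (Arg z)))"
          unfolding deriv[abs_def] by (intro continuous_intros uc)
        show "continuous_on {0..2*pi} (d_theta ?h)"
          unfolding dh[abs_def] by (intro continuous_intros uc)
        show "continuous_on {0..2*pi} (\<lambda>x. ?h (cis x))"
          unfolding periodic_Arg_cis[of unit_vec, OF unit_vec_plus_2pi]
          using uc[of "{0..2*pi}" 0] by (intro continuous_intros) simp
      qed (use R in \<open>simp_all add: deriv dh\<close>)
      also have "\<dots> = sqrt ((r' - r)\<^sup>2 * (1 + 4 * pi\<^sup>2 * lam))"
      proof -
        have "lam * (2 * pi * R) * (2 * pi * w / R) = w * (4 * pi\<^sup>2 * lam)" for w
          using R by (simp add: power2_eq_square)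
        then show ?thesis by (simp add: distrib_left)
      qed
      also have "\<dots> = \<bar>r' - r\<bar> * sqrt (1 + 4 * pi\<^sup>2 * lam)"
        by (simp add: real_sqrt_mult)
      finally show ?thesis using dv[OF v] by presburger
    qed
    then show ?thesis
      by (intro d_H1_le[OF adm]) (use lam in auto)
  qed
qed

lemma constant_curve_approximable:
  fixes c :: "complex \<Rightarrow> real ^ 2"
  assumes lam: "0 \<le> lam" and c: "\<And>u. u \<in> S1 \<Longrightarrow> c u = p"
  shows "\<exists>ck :: nat \<Rightarrow> complex \<Rightarrow> real ^ 2.
           (\<forall>k. immersed (ck k)) \<and> d_H1_Cauchy lam ck \<and> (\<lambda>k. d_f (ck k) c) \<longlonglongrightarrow> 0"
proof (intro exI conjI allI)
  let ?r = "\<lambda>k::nat. 1 / real (Suc k)"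
  let ?ck = "\<lambda>k z. p + ?r k *\<^sub>R unit_vec (Arg z)"
  show "immersed (?ck k)" for k
    by (rule concentric_circles(1)[OF lam]) simp
  show "d_H1_Cauchy lam ?ck"
    unfolding d_H1_Cauchy_def
  proof (intro allI impI)
    fix e :: real assume "0 < e"
    define K where "K = sqrt (1 + 4 * pi\<^sup>2 * lam)"
    have K: "0 < K" using lam by (simp add: K_def add_pos_nonneg)
    have "(\<lambda>k. ?r k * K) \<longlonglongrightarrow> 0 * K"
      by (intro tendsto_mult LIMSEQ_Suc[OF lim_1_over_n] tendsto_const)
    then have "\<forall>\<^sub>F k in sequentially. ?r k * K < e"
      by (rule order_tendstoD(2)) (use \<open>0 < e\<close> in simp)
    then obtain N where N: "\<And>k. N \<le> k \<Longrightarrow> ?r k * K < e"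
      by (auto simp: eventually_sequentially)
    show "\<exists>N. \<forall>m\<ge>N. \<forall>n\<ge>N. d_H1 lam (?ck m) (?ck n) < ereal e"
    proof (rule exI[of _ N], intro allI impI)
      fix m n assume mn: "N \<le> m" "N \<le> n"
      have "\<bar>?r n - ?r m\<bar> \<le> ?r N"
      proof -
        have "0 < ?r m" "0 < ?r n" by simp_all
        moreover have "?r m \<le> ?r N" "?r n \<le> ?r N" using mn by (intro frac_le; simp)+
        ultimately show ?thesis by linarith
      qed
      then have "\<bar>?r n - ?r m\<bar> * K \<le> ?r N * K" using K by (intro mult_right_mono) auto
      also have "\<dots> < e" by (rule N) simp
      finally have small: "ereal (\<bar>?r n - ?r m\<bar> * K) < ereal e" by simp
      have "d_H1 lam (?ck m) (?ck n) \<le> ereal (\<bar>?r n - ?r m\<bar> * K)"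
        unfolding K_def by (rule concentric_circles(2)[OF lam]) simp_all
      also note small
      finally show "d_H1 lam (?ck m) (?ck n) < ereal e" .
    qed
  qed
  have "\<bar>d_f (?ck k) c\<bar> \<le> ?r k" for k
  proof (rule d_f_bounds[OF _ _ id_Diff_S1])
    show "continuous_on S1 c"
      using continuous_on_const[of S1 p] c by (metis (mono_tags, lifting) continuous_on_cong)
    show "continuous_on UNIV (\<lambda>x. ?ck k (cis x))"
      unfolding periodic_Arg_cis[of unit_vec, OF unit_vec_plus_2pi]
      by (intro continuous_intros smooth_continuous_on smooth_unit_vec)
    show "norm (c (id u) - ?ck k u) \<le> ?r k" if "u \<in> S1" for u
      using c[OF that] by simp
  qed
  then show "(\<lambda>k. d_f (?ck k) c) \<longlonglongrightarrow> 0"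
    by (intro Lim_null_comparison[OF _ LIMSEQ_Suc[OF lim_1_over_n]]) auto
qed

text \<open>
  The function \<open>\<sigma>\<close> is the arc length rescaled to total length \<open>2\<pi>\<close>, and \<open>l\<close> is the scaling factor. Uniform
  convergence at the end point \<open>2\<pi>\<close>, where the curve returns to its start, is what forces the mean directions
  to tend to zero.
\<close>

lemma nonconstant_curve_approximable:
  fixes c :: "complex \<Rightarrow> real ^ 2"
  assumes lam: "0 \<le> lam" and c: "continuous_on S1 c"
    and l: "0 < l" and \<sigma>: "continuous_on {0..2*pi} \<sigma>" "\<sigma> 0 = 0" "\<sigma> (2*pi) = 2*pi"
    and lip: "\<And>a b. 0 \<le> a \<Longrightarrow> a \<le> b \<Longrightarrow> b \<le> 2*pi \<Longrightarrow> norm (c (cis b) - c (cis a)) \<le> l * (\<sigma> b - \<sigma> a)"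
    and lim: "(\<lambda>n. \<Sum>j<2 ^ n. norm (c (cis (dyadic (2*pi) n (Suc j))) - c (cis (dyadic (2*pi) n j)))) \<longlonglongrightarrow> l * (2 * pi)"
  shows "\<exists>ck :: nat \<Rightarrow> complex \<Rightarrow> real ^ 2.
           (\<forall>k. immersed (ck k)) \<and> d_H1_Cauchy lam ck \<and> (\<lambda>k. d_f (ck k) c) \<longlonglongrightarrow> 0"
proof -
  define f where "f t = c (cis t)" for t
  have fc: "continuous_on {0..2*pi} f"
    unfolding f_def by (intro continuous_on_compose2[OF c] continuous_intros) auto
  have f_end: "f (2 * pi) = f 0" by (simp add: f_def)
  have \<sigma>_mono: "\<sigma> a \<le> \<sigma> b" if "0 \<le> a" "a \<le> b" "b \<le> 2*pi" for a b
    using lip[OF that] l norm_ge_zero[of "c (cis b) - c (cis a)"] by (smt (verit) mult_pos_neg)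
  have \<sigma>_range: "\<sigma> t \<in> {0..2*pi}" if "t \<in> {0..2*pi}" for t
    using \<sigma>_mono[of 0 t] \<sigma>_mono[of t "2*pi"] that \<sigma> by auto
  obtain d :: "nat \<Rightarrow> real \<Rightarrow> real ^ 2" and \<eta> where
    d: "\<And>n. simple_function borel (d n)" "\<And>n y. norm (d n y) \<le> 1" and \<eta>: "\<eta> \<longlonglongrightarrow> 0"
    and d1: "\<And>n. integral {0..2*pi} (\<lambda>y. 1 - norm (d n y)) \<le> \<eta> n"
    and d2: "\<And>m n. m \<le> n \<Longrightarrow> integral {0..2*pi} (\<lambda>y. (norm (d n y - d m y))\<^sup>2) \<le> \<eta> m"
    and df: "\<And>e. 0 < e \<Longrightarrow> \<forall>\<^sub>F n in sequentially. \<forall>t\<in>{0..2*pi}. norm (f 0 + l *\<^sub>R integral {0..\<sigma> t} (d n) - f t) \<le> e"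
  proof (rule chord_directions[of "2 * pi" l f \<sigma>])
    show "0 < 2 * pi" "0 < l" "continuous_on {0..2*pi} f" "\<sigma> 0 = 0" "\<sigma> (2*pi) = 2*pi"
      using l fc \<sigma> by auto
    show "norm (f b - f a) \<le> l * (\<sigma> b - \<sigma> a)" if "0 \<le> a" "a \<le> b" "b \<le> 2*pi" for a b
      unfolding f_def by (rule lip[OF that])
    show "(\<lambda>n. \<Sum>j<2 ^ n. norm (f (dyadic (2*pi) n (Suc j)) - f (dyadic (2*pi) n j))) \<longlonglongrightarrow> l * (2 * pi)"
      unfolding f_def by (rule lim)
  qed (use that in blast)
  obtain r where r: "strict_mono r" "\<And>k. \<eta> (r k) \<le> 1 / 8 ^ k"
    using fast_subsequence[OF \<eta>, of "\<lambda>k. 1 / 8 ^ k"] by auto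
  obtain \<beta> :: "nat \<Rightarrow> real \<Rightarrow> real" where \<beta>: "\<And>n. smooth (\<beta> n)" "\<And>n x. \<beta> n (x + 2 * pi) = \<beta> n x"
    and \<beta>1: "\<And>m n. m \<le> n \<Longrightarrow> integral {0..2*pi} (\<lambda>x. (\<beta> n x - \<beta> m x)\<^sup>2) \<le> 480 / 8 ^ m"
    and \<beta>2: "\<And>n x. x \<in> {0..2*pi} \<Longrightarrow> norm (prim (\<lambda>t. unit_vec (\<beta> n t)) x - integral {0..x} (d (r n))) \<le> sqrt (2 * pi / 8 ^ n) + 1 / 8 ^ n"
  proof (rule smooth_angle_sequence[of "\<lambda>n. d (r n)"])
    show "integral {0..2*pi} (\<lambda>y. 1 - norm (d (r n) y)) \<le> 1 / 8 ^ n" for n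
      using d1[of "r n"] r(2)[of n] by simp
    show "integral {0..2*pi} (\<lambda>y. (norm (d (r (Suc n)) y - d (r n) y))\<^sup>2) \<le> 1 / 8 ^ n" for n
      using d2[of "r n" "r (Suc n)"] r(2)[of n] strict_mono_leD[OF r(1), of n "Suc n"] by simp
  qed (use d in auto)
  let ?P = "\<lambda>n. prim (\<lambda>t. unit_vec (\<beta> n t))"
  let ?w = "\<lambda>n. mean (\<lambda>t. unit_vec (\<beta> n t))"
  have \<beta>c: "continuous_on S (\<beta> n)" for S n by (rule smooth_continuous_on[OF \<beta>(1)])
  have Ec: "continuous_on UNIV (\<lambda>t. unit_vec (\<beta> n t))" for n by (rule continuous_unit_vec_comp[OF \<beta>c])
  have conv: "\<forall>\<^sub>F n in sequentially. \<forall>t\<in>{0..2*pi}. norm (f 0 + l *\<^sub>R ?P n (\<sigma> t) - f t) \<le> e" if "0 < e" for e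
  proof -
    have "(\<lambda>n. l * (sqrt (2 * pi * (1 / 8) ^ n) + (1 / 8) ^ n)) \<longlonglongrightarrow> l * (sqrt (2 * pi * 0) + 0)"
      by (intro tendsto_intros LIMSEQ_power_zero) auto
    then have "\<forall>\<^sub>F n in sequentially. l * (sqrt (2 * pi * (1 / 8) ^ n) + (1 / 8) ^ n) < e / 2"
      by (rule order_tendstoD(2)) (use \<open>0 < e\<close> in simp)
    moreover have "\<forall>\<^sub>F n in sequentially. \<forall>t\<in>{0..2*pi}. norm (f 0 + l *\<^sub>R integral {0..\<sigma> t} (d (r n)) - f t) \<le> e / 2"
      using df[of "e / 2"] \<open>0 < e\<close> filterlim_subseq[OF r(1)] by (auto simp: filterlim_iff)
    ultimately show ?thesis
    proof eventually_elim
      case (elim n)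
      show ?case
      proof
        fix t assume t: "t \<in> {0..2*pi}"
        have "norm (l *\<^sub>R (?P n (\<sigma> t) - integral {0..\<sigma> t} (d (r n)))) \<le> l * (sqrt (2 * pi * (1 / 8) ^ n) + (1 / 8) ^ n)"
          using mult_left_mono[OF \<beta>2[OF \<sigma>_range[OF t], of n], of l] l by (simp add: power_divide)
        moreover have "f 0 + l *\<^sub>R ?P n (\<sigma> t) - f t
            = l *\<^sub>R (?P n (\<sigma> t) - integral {0..\<sigma> t} (d (r n))) + (f 0 + l *\<^sub>R integral {0..\<sigma> t} (d (r n)) - f t)"
          by (simp add: algebra_simps)
        ultimately show "norm (f 0 + l *\<^sub>R ?P n (\<sigma> t) - f t) \<le> e"
          using elim t norm_triangle_ineq[of "l *\<^sub>R (?P n (\<sigma> t) - integral {0..\<sigma> t} (d (r n)))"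
              "f 0 + l *\<^sub>R integral {0..\<sigma> t} (d (r n)) - f t"]
          by (smt (verit, best) field_sum_of_halves)
      qed
    qed
  qed
  have norm_w: "norm (?w n) = norm (?P n (2 * pi)) / (2 * pi)" for n
    by (simp add: mean_def)
  have w_small: "\<forall>\<^sub>F n in sequentially. norm (?w n) \<le> e" if "0 < e" for e
  proof -
    have "0 < l * (2 * pi * e)" using l that by simp
    from conv[OF this] show ?thesis
    proof eventually_elim
      case (elim n)
      then have "norm (l *\<^sub>R ?P n (2 * pi)) \<le> l * (2 * pi * e)"
        using \<sigma>(3) f_end by (auto dest: bspec[of _ _ "2*pi"])
      then have "norm (?P n (2 * pi)) \<le> 2 * pi * e" using l by simp
      then show ?case unfolding norm_w by (simp add: field_simps)
    qed
  qed
  have "\<forall>\<^sub>F n in sequentially. 480 * (1 / 8) ^ n < (1 / 4 :: real)"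
    by (rule order_tendstoD(2)[where y = 0]) (auto intro!: tendsto_mult_right_zero LIMSEQ_power_zero)
  moreover have "\<forall>\<^sub>F n in sequentially. norm (?w n) \<le> 1 / 4"
    by (rule w_small) simp
  ultimately have "\<forall>\<^sub>F n in sequentially. norm (?w n) \<le> 1 / 4 \<and> 480 / 8 ^ n \<le> (1 / 4 :: real)"
    by eventually_elim (simp add: power_divide)
  then obtain K where K: "\<And>n. K \<le> n \<Longrightarrow> norm (?w n) \<le> 1 / 4" "\<And>n. K \<le> n \<Longrightarrow> 480 / 8 ^ n \<le> (1 / 4 :: real)"
    by (auto simp: eventually_sequentially)
  define ck where "ck k = angle_curve (f 0) l (\<beta> (K + k))" for k
  have imm: "immersed (ck k)" for k
    unfolding ck_def using K(1)[of "K + k"] by (intro immersed_angle_curve \<beta> l) auto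
  have cauchy: "d_H1_Cauchy lam ck"
    unfolding d_H1_Cauchy_def
  proof (intro allI impI)
    fix e :: real assume "0 < e"
    let ?B = "8 * pi * l\<^sup>2 * (1 + 3 * lam)"
    have "(\<lambda>n. sqrt (?B * (480 * (1 / 8) ^ n))) \<longlonglongrightarrow> sqrt (?B * (480 * 0))"
      by (intro tendsto_intros LIMSEQ_power_zero) auto
    then have "\<forall>\<^sub>F n in sequentially. sqrt (?B * (480 * (1 / 8) ^ n)) < e"
      by (rule order_tendstoD(2)) (use \<open>0 < e\<close> in simp)
    then obtain N where "\<forall>n\<ge>N. sqrt (?B * (480 * (1 / 8) ^ n)) < e"
      unfolding eventually_sequentially by blast
    then have "sqrt (?B * (480 * (1 / 8) ^ (K + N))) < e" by simp
    then have N: "sqrt (?B * (480 / 8 ^ (K + N))) < e" by (simp add: power_divide)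
    show "\<exists>N. \<forall>m\<ge>N. \<forall>n\<ge>N. d_H1 lam (ck m) (ck n) < ereal e"
    proof (rule exI[of _ N], intro allI impI)
      fix m n assume mn: "N \<le> m" "N \<le> n"
      have mono: "480 / 8 ^ (K + k) \<le> (480 / 8 ^ (K + N) :: real)" if "N \<le> k" for k
        using that by (intro divide_left_mono power_increasing) auto
      have "integral {0..2*pi} (\<lambda>x. (\<beta> (K + n) x - \<beta> (K + m) x)\<^sup>2) \<le> 480 / 8 ^ (K + N)"
      proof (cases "m \<le> n")
        case True
        then show ?thesis using \<beta>1[of "K + m" "K + n"] mono[OF mn(1)] by simp
      next
        case False
        then show ?thesis using \<beta>1[of "K + n" "K + m"] mono[OF mn(2)]
          by (simp add: power2_commute[of "\<beta> (K + n) _"])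
      qed
      then have "d_H1 lam (ck m) (ck n) \<le> ereal (sqrt (?B * (480 / 8 ^ (K + N))))"
        unfolding ck_def using K by (intro d_H1_angle_curve_le lam l \<beta>) auto
      also have "\<dots> < ereal e" using N by simp
      finally show "d_H1 lam (ck m) (ck n) < ereal e" .
    qed
  qed
  have P_lip: "norm (?P n y - ?P n x) \<le> \<bar>y - x\<bar>" for n x y
  proof -
    have *: "norm (?P n y - ?P n x) \<le> y - x" if "x \<le> y" for x y
    proof -
      have "norm (integral {x..y} (\<lambda>t. unit_vec (\<beta> n t))) \<le> 1 * (y - x)"
        using that by (intro integral_bound continuous_on_subset[OF Ec]) auto
      then show ?thesis using prim_diff_integral[OF Ec that] by simp
    qed
    show ?thesis
      using *[of x y] *[of y x] by (cases "x \<le> y") (auto simp: norm_minus_commute)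
  qed
  have "(\<lambda>k. d_f (ck k) c) \<longlonglongrightarrow> 0"
  proof (rule tendstoI)
    fix e :: real assume "0 < e"
    define e' where "e' = e / 4"
    have e': "0 < e'" using \<open>0 < e\<close> by (simp add: e'_def)
    have "0 < e' / (2 * pi * l)" using e' l by simp
    from conv[OF e'] w_small[OF this]
    have "\<forall>\<^sub>F n in sequentially. (\<forall>t\<in>{0..2*pi}. norm (f 0 + l *\<^sub>R ?P n (\<sigma> t) - f t) \<le> e') \<and> norm (?w n) \<le> e' / (2 * pi * l)"
      by (rule eventually_conj)
    then have "\<forall>\<^sub>F k in sequentially. (\<forall>t\<in>{0..2*pi}. norm (f 0 + l *\<^sub>R ?P (K + k) (\<sigma> t) - f t) \<le> e') \<and> norm (?w (K + k)) \<le> e' / (2 * pi * l)"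
      unfolding add.commute[of K] by (rule eventually_all_ge_at_top[THEN eventually_mono, THEN eventually_sequentially_seg[THEN iffD2]]) auto
    then show "\<forall>\<^sub>F k in sequentially. dist (d_f (ck k) c) 0 < e"
    proof eventually_elim
      case (elim k)
      obtain q where q: "smooth q" "\<And>x. q (x + 2 * pi) = q x" "\<And>x. 0 < q x" "prim q (2*pi) = 2*pi"
        and q\<sigma>: "\<And>x. x \<in> {0..2*pi} \<Longrightarrow> \<bar>prim q x - \<sigma> x\<bar> \<le> e' / l"
        using smooth_monotone_approx[OF \<sigma>(1) \<sigma>_mono \<sigma>(2,3), of "e' / l"] e' l by auto
      obtain \<phi> where \<phi>: "\<phi> \<in> Diff_S1" "\<And>x. \<phi> (cis (prim q x)) = cis x"
        and onto: "\<And>u. u \<in> S1 \<Longrightarrow> \<exists>x\<in>{0..2*pi}. u = cis (prim q x)"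
        using Diff_S1_of_density[OF q] by metis
      have "\<bar>d_f (ck k) c\<bar> \<le> 3 * e'"
      proof (rule d_f_bounds[OF c _ \<phi>(1)])
        show "continuous_on UNIV (\<lambda>x. ck k (cis x))"
          unfolding ck_def by (rule smooth_continuous_on[OF smooth_angle_curve[OF \<beta>]])
        fix u assume "u \<in> S1"
        then obtain x where x: "x \<in> {0..2*pi}" and u: "u = cis (prim q x)" using onto by blast
        let ?y = "prim q x"
        have q_mono: "mono (prim q)"
        proof (rule monoI)
          fix a b :: real assume "a \<le> b"
          then have "0 \<le> integral {a..b} q"
            using q(3) by (intro integral_nonneg integrable_continuous_interval smooth_continuous_on[OF q(1)]) (auto intro: less_imp_le)
          then show "prim q a \<le> prim q b"
            using prim_diff_integral[OF smooth_continuous_on[OF q(1)] \<open>a \<le> b\<close>] by simp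
        qed
        have y: "0 \<le> ?y" "?y \<le> 2 * pi"
          using monoD[OF q_mono, of 0 x] monoD[OF q_mono, of x "2*pi"] x q(4) by auto
        \<comment> \<open>error of the polygons, of replacing \<open>\<sigma>\<close> by \<open>prim q\<close>, and of the closing correction\<close>
        have "c (\<phi> u) - ck k u = (f x - (f 0 + l *\<^sub>R ?P (K + k) (\<sigma> x))) + l *\<^sub>R (?P (K + k) (\<sigma> x) - ?P (K + k) ?y) + (l * ?y) *\<^sub>R ?w (K + k)"
          unfolding ck_def u \<phi>(2) angle_curve_cis[OF \<beta>c \<beta>(2)] closed_prim_def
          by (simp add: f_def algebra_simps)
        also have "norm \<dots> \<le> e' + e' + e'"
        proof (intro norm_triangle_mono)
          show "norm (f x - (f 0 + l *\<^sub>R ?P (K + k) (\<sigma> x))) \<le> e'"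
            using elim x by (simp add: norm_minus_commute)
          have "l * norm (?P (K + k) (\<sigma> x) - ?P (K + k) ?y) \<le> l * (e' / l)"
            using P_lip[of "K + k" "\<sigma> x" ?y] q\<sigma>[OF x] l by (intro mult_left_mono) (auto simp: abs_minus_commute)
          then show "norm (l *\<^sub>R (?P (K + k) (\<sigma> x) - ?P (K + k) ?y)) \<le> e'" using l by simp
          have "(l * ?y) * norm (?w (K + k)) \<le> (l * (2 * pi)) * (e' / (2 * pi * l))"
            using y l elim e' by (intro mult_mono) auto
          then show "norm ((l * ?y) *\<^sub>R ?w (K + k)) \<le> e'" using y l by (simp add: abs_mult)
        qed
        finally show "norm (c (\<phi> u) - ck k u) \<le> 3 * e'" by simp
      qed
      then show ?case using \<open>0 < e\<close> by (simp add: e'_def)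
    qed
  qed
  with imm cauchy show ?thesis by blast
qed

theorem theorem3p11:
  fixes lam :: real and c :: "complex \<Rightarrow> real ^ 2"
  assumes "lam > 0"
    and "rectifiable_closed_curve c"
  shows "\<exists>ck :: nat \<Rightarrow> complex \<Rightarrow> real ^ 2.
           (\<forall>k. immersed (ck k)) \<and> d_H1_Cauchy lam ck \<and> (\<lambda>k. d_f (ck k) c) \<longlonglongrightarrow> 0"
proof -
  have c: "continuous_on S1 c" and fin: "polygonal_length c < \<infinity>"
    using assms(2) by (auto simp: rectifiable_closed_curve_def)
  have fc: "continuous_on {0..2*pi} (\<lambda>t. c (cis t))"
    by (intro continuous_on_compose2[OF c] continuous_intros) auto
  have le: "ereal (\<Sum>i<n. norm (c (cis (t (Suc i))) - c (cis (t i)))) \<le> polygonal_length c"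
    if "mono_on {..n} t" "t ` {..n} \<subseteq> {0..2*pi}" for n t
    unfolding polygonal_length_def by (rule SUP_upper2[of "(n, t)"]) (use that in auto)
  have bound: "(\<Sum>i<n. norm (c (cis (t (Suc i))) - c (cis (t i)))) \<le> real_of_ereal (polygonal_length c)"
    if "mono_on {..n} t" "t ` {..n} \<subseteq> {0..2*pi}" for n t
  proof -
    have "0 \<le> polygonal_length c" using le[of 0 "\<lambda>_. 0"] by (simp add: mono_on_def zero_ereal_def)
    then show ?thesis using le[OF that] fin by (cases "polygonal_length c") auto
  qed
  obtain s where s: "continuous_on {0..2*pi} s" "s 0 = 0"
    and s_lip: "\<And>a b. 0 \<le> a \<Longrightarrow> a \<le> b \<Longrightarrow> b \<le> 2*pi \<Longrightarrow> norm (c (cis b) - c (cis a)) \<le> s b - s a"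
    and s_lim: "(\<lambda>n. \<Sum>j<2 ^ n. norm (c (cis (dyadic (2*pi) n (Suc j))) - c (cis (dyadic (2*pi) n j)))) \<longlonglongrightarrow> s (2*pi)"
  proof (rule arc_length_function[of "2 * pi" "\<lambda>t. c (cis t)" "real_of_ereal (polygonal_length c)"])
    show "0 < 2 * pi" by simp
    show "continuous_on {0..2*pi} (\<lambda>t. c (cis t))" by (rule fc)
    show "(\<Sum>i<n. norm (c (cis (t (Suc i))) - c (cis (t i)))) \<le> real_of_ereal (polygonal_length c)"
      if "mono_on {..n} t" "t ` {..n} \<subseteq> {0..2*pi}" for n t
      by (rule bound[OF that])
  qed (use that in blast)
  show ?thesis
  proof (cases "s (2 * pi) = 0")
    case True
    have "c u = c 1" if "u \<in> S1" for u
    proof -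
      have u: "u = cis (Arg2pi u)" using complex_norm_eq_1_exp[of u] that by (simp add: cis_conv_exp)
      have "norm (c (cis (Arg2pi u)) - c (cis 0)) \<le> s (Arg2pi u) - s 0"
        using Arg2pi[of u] by (intro s_lip) auto
      also have "\<dots> \<le> s (2 * pi) - s 0"
        using s_lip[of "Arg2pi u" "2 * pi"] Arg2pi[of u] norm_ge_zero by (smt (verit))
      finally show ?thesis using True s u by simp
    qed
    then show ?thesis by (rule constant_curve_approximable[OF less_imp_le[OF assms(1)]])
  next
    case False
    then have L: "0 < s (2 * pi)" using s_lip[of 0 "2 * pi"] s(2) by (simp add: less_le)
    let ?l = "s (2 * pi) / (2 * pi)"
    show ?thesis
    proof (rule nonconstant_curve_approximable[where l = ?l and \<sigma> = "\<lambda>t. s t / ?l"])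
      show "norm (c (cis b) - c (cis a)) \<le> ?l * (s b / ?l - s a / ?l)" if "0 \<le> a" "a \<le> b" "b \<le> 2 * pi" for a b
        using s_lip[OF that] L by (simp add: right_diff_distrib)
      show "continuous_on {0..2*pi} (\<lambda>t. s t / ?l)"
        by (intro continuous_intros s) (use L in auto)
      show "(\<lambda>n. \<Sum>j<2 ^ n. norm (c (cis (dyadic (2*pi) n (Suc j))) - c (cis (dyadic (2*pi) n j)))) \<longlonglongrightarrow> ?l * (2 * pi)"
        using s_lim by simp
      show "0 \<le> lam" "continuous_on S1 c" "0 < ?l" "s 0 / ?l = 0" "s (2 * pi) / ?l = 2 * pi"
        using assms(1) c L s by simp_all
    qed
  qed
qed

end
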